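(* Let $(X^4,g)$ be an oriented Poincaré–Einstein 4-manifold equipped with a $0$-spin structure $(\mathbb{S}_\pm,{}^0\mathbf{c})$. Then the Levi-Civita spin $0$-connection on $\mathbb{S}_+$ is self-dual and satisfies the Nahm pole boundary condition.
   Context: $X$ is a compact manifold with boundary; a boundary defining function (bdf) is a smooth $x:X\to[0,\infty)$ with $x^{-1}(0)=\partial X$, $dx\neq0$ along $\partial X$. ${}^0TX$ is the bundle whose sections are the smooth vector fields vanishing on $\partial X$; ${}^0T^*X$ is its dual, ${}^0\Lambda^k=\Lambda^k({}^0T^*X)$. A (polyhomogeneous) conformally compact metric is a bundle metric on ${}^0TX$ which is smooth (resp. $O(1)$ polyhomogeneous, i.e. with an asymptotic expansion at $\partial X$ in terms $x^\gamma(\log x)^l$). It is Poincaré–Einstein (dimension 4) if $\mathrm{Ric}(g)+3g=0$; it is then asymptotically hyperbolic, i.e. $|dx|^2_{x^2g}\equiv1$ on $\partial X$. Boundaries are oriented outward-normal-first. A $0$-spin structure on $(X^4,g)$ consists of two $\mathrm{SU}(2)$ bundles $\mathbb S_\pm$ and a map ${}^0\mathbf c:{}^0T^*X\to\mathfrak u(\mathbb S_+\oplus\mathbb S_-)$ exchanging $\mathbb S_\pm$ with ${}^0\mathbf c(\alpha)^2=-|\alpha|^2$, such that each pair of $\mathrm{SU}(2)$ frames of $\mathbb S_+,\mathbb S_-$ determines an oriented orthonormal coframe $e^0,\dots,e^3$ of ${}^0T^*X$ with ${}^0\mathbf c(e^0)=\begin{pmatrix}0&1\\-1&0\end{pmatrix}$,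 ${}^0\mathbf c(e^i)=\begin{pmatrix}0&\sigma_i\\\sigma_i&0\end{pmatrix}$ (blocks in $\mathbb S_+\oplus\mathbb S_-$), where $\sigma_1=\begin{pmatrix}i&0\\0&-i\end{pmatrix}$, $\sigma_2=\begin{pmatrix}0&1\\-1&0\end{pmatrix}$, $\sigma_3=\begin{pmatrix}0&i\\i&0\end{pmatrix}$. A $0$-connection on $E$ is a map $(V,s)\mapsto A_Vs$ for sections $V$ of ${}^0TX$ and $s$ of $E$, $C^\infty(X)$-linear in $V$ and Leibniz in $s$ (coefficients allowed to be polyhomogeneous). The Levi-Civita spin $0$-connections on $\mathbb S_\pm$ are the $\mathrm{SU}(2)$ $0$-connections which, with the Levi-Civita $0$-connection of $g$ on ${}^0T^*X$, make ${}^0\mathbf c$ parallel. Self-dual means $F_A=*F_A$ as a section of ${}^0\Lambda^2\otimes\mathfrak{su}(E)$. Residue: $\mathrm{res}_A=(A-D)_{|\partial X}:{}^0TX_{|\partial X}\to\mathfrak{su}(E_{|\partial X})$, $D$ any ordinary connection. Let $K\subset{}^0TX_{|\partial X}$ be the annihilator of $(dx/x)_{|\partial X}$, with metric from $g$, orientation from $\partial X$ via $T\partial X\to K$, $V\mapsto xV$, and Lie bracket the fibrewise cross product. Nahm pole boundary condition: $\mathrm{res}_A$ vanishes on $K^\perp$ and restricts to a Lie algebra bundle isomorphism $K\to\mathfrak{su}(E_{|\partial X})$. *)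

theory Defs
  imports "HOL-Analysis.Analysis"
begin

section \<open>Smooth functions and oriented 4-manifolds with boundary\<close>

primrec Ck_on :: "nat \<Rightarrow> 'a::euclidean_space set \<Rightarrow> ('a \<Rightarrow> 'b::real_normed_vector) \<Rightarrow> bool" where
  "Ck_on 0 S f \<longleftrightarrow> continuous_on S f"
| "Ck_on (Suc k) S f \<longleftrightarrow>
     f differentiable_on S \<and> (\<forall>v. Ck_on k S (\<lambda>x. frechet_derivative f (at x) v))"

text \<open>Smoothness on an arbitrary subset of a Euclidean space (in practice: a relatively open
  subset of a half-space) is local extendability to a smooth function on an open set.\<close>

definition smooth_on :: "'a::euclidean_space set \<Rightarrow> ('a \<Rightarrow> 'b::real_normed_vector) \<Rightarrow> bool" where
  "smooth_on S f \<longleftrightarrow>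
     (\<forall>x\<in>S. \<exists>U h. open U \<and> x \<in> U \<and> (\<forall>k. Ck_on k U h) \<and> (\<forall>y\<in>S \<inter> U. h y = f y))"

text \<open>The coordinates on \<open>real^4\<close> are numbered 0, 1, 2, 3 (in the type \<open>4\<close> one has \<open>4 = 0\<close>).
  All determinants below use this order of the indices.\<close>

definition half_space :: "(real^4) set" where
  "half_space = {v. v $ 0 \<ge> 0}"

type_synonym 'm chart = "'m set \<times> ('m \<Rightarrow> real^4)"

definition oriented_atlas :: "'m::topological_space chart set \<Rightarrow> bool" where
  "oriented_atlas M \<longleftrightarrow>
     (\<Union>(U, \<phi>)\<in>M. U) = UNIV \<and>
     (\<forall>(U, \<phi>)\<in>M. open U \<and> openin (top_of_set half_space) (\<phi> ` U) \<and>
        homeomorphism U (\<phi> ` U) \<phi> (inv_into U \<phi>)) \<and>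
     (\<forall>(U, \<phi>)\<in>M. \<forall>(U', \<phi>')\<in>M.
        smooth_on (\<phi> ` (U \<inter> U')) (\<phi>' \<circ> inv_into U \<phi>) \<and>
        (\<forall>p\<in>U \<inter> U'. det (matrix (frechet_derivative (\<phi>' \<circ> inv_into U \<phi>)
            (at (\<phi> p) within \<phi> ` (U \<inter> U')))) > 0))"

definition compact_oriented_manifold :: "'m::t2_space chart set \<Rightarrow> bool" where
  "compact_oriented_manifold M \<longleftrightarrow> compact (UNIV :: 'm set) \<and> oriented_atlas M"

definition bdry :: "'m chart set \<Rightarrow> 'm set" where
  "bdry M = {p. \<exists>(U, \<phi>)\<in>M. p \<in> U \<and> \<phi> p $ 0 = 0}"

definition smooth_fun ::
  "'m chart set \<Rightarrow> 'm set \<Rightarrow> ('m \<Rightarrow> 'b::real_normed_vector) \<Rightarrow> bool" where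
  "smooth_fun M W f \<longleftrightarrow> (\<forall>(U, \<phi>)\<in>M. smooth_on (\<phi> ` (U \<inter> W)) (f \<circ> inv_into U \<phi>))"

text \<open>The tangent space at \<open>p\<close> is modelled by \<open>real^4\<close>: \<open>v\<close> stands for the vector with components
  \<open>v\<close> in the chart \<open>chart_at M p\<close>. No continuity in \<open>p\<close> of this identification is used; the smooth
  structure of the tangent bundle is carried by its local trivialisations, given further down.
  \<open>tderiv M f p v\<close> is the derivative of \<open>f\<close> at \<open>p\<close> along \<open>v\<close>.\<close>

definition chart_at :: "'m chart set \<Rightarrow> 'm \<Rightarrow> 'm chart" where
  "chart_at M p = (SOME c. c \<in> M \<and> p \<in> fst c)"

definition tderiv ::
  "'m chart set \<Rightarrow> ('m \<Rightarrow> 'b::real_normed_vector) \<Rightarrow> 'm \<Rightarrow> real^4 \<Rightarrow> 'b" where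
  "tderiv M f p v =
     (let (U, \<phi>) = chart_at M p
      in frechet_derivative (f \<circ> inv_into U \<phi>) (at (\<phi> p) within \<phi> ` U) v)"

definition bdf :: "'m::topological_space chart set \<Rightarrow> ('m \<Rightarrow> real) \<Rightarrow> bool" where
  "bdf M x \<longleftrightarrow> smooth_fun M UNIV x \<and> (\<forall>p. x p \<ge> 0) \<and> {p. x p = 0} = bdry M \<and>
     (\<forall>p\<in>bdry M. \<exists>v. tderiv M x p v \<noteq> 0)"


section \<open>Vector bundles\<close>

text \<open>A vector bundle with typical fibre \<open>'v\<close> is a set of local trivialisations \<open>(U, T)\<close>. Every fibre
  is identified, as a vector space and without any continuity, with \<open>'v\<close>, so that a section is a
  function \<open>'m \<Rightarrow> 'v\<close>; the trivialisation over \<open>U\<close> sends \<open>u\<close> in the fibre at \<open>p\<close> to \<open>T p u\<close>.\<close>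

type_synonym ('m, 'v) vbundle = "('m set \<times> ('m \<Rightarrow> 'v \<Rightarrow> 'v)) set"

definition vector_bundle ::
  "'m::topological_space chart set \<Rightarrow> ('m, 'v::euclidean_space) vbundle \<Rightarrow> bool" where
  "vector_bundle M E \<longleftrightarrow>
     (\<Union>(U, T)\<in>E. U) = UNIV \<and>
     (\<forall>(U, T)\<in>E. open U \<and> (\<forall>p\<in>U. linear (T p) \<and> bij (T p))) \<and>
     (\<forall>(U, T)\<in>E. \<forall>(U', T')\<in>E. \<forall>v. smooth_fun M (U \<inter> U') (\<lambda>p. T' p (inv (T p) v)))"

definition smooth_section ::
  "'m chart set \<Rightarrow> ('m, 'v::euclidean_space) vbundle \<Rightarrow> ('m \<Rightarrow> 'v) \<Rightarrow> bool" where
  "smooth_section M E s \<longleftrightarrow> (\<forall>(U, T)\<in>E. smooth_fun M U (\<lambda>p. T p (s p)))"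

definition tangent_bundle :: "'m chart set \<Rightarrow> ('m, real^4) vbundle" where
  "tangent_bundle M = {(U, \<lambda>p v. tderiv M \<phi> p v) | U \<phi>. (U, \<phi>) \<in> M}"

text \<open>The dual bundle; covectors are elements of the same fibre, paired with vectors by \<open>\<bullet>\<close>.\<close>

definition dual_bundle ::
  "('m, 'v::euclidean_space) vbundle \<Rightarrow> ('m, 'v) vbundle" where
  "dual_bundle E = {(U, \<lambda>p. adjoint (inv (T p))) | U T. (U, T) \<in> E}"

definition extend :: "'m chart set \<Rightarrow> ('m, 'v::euclidean_space) vbundle \<Rightarrow> 'm \<Rightarrow> 'v \<Rightarrow> 'm \<Rightarrow> 'v" where
  "extend M E p u = (SOME s. smooth_section M E s \<and> s p = u)"


section \<open>Polyhomogeneous functions and sections\<close>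

definition tangential_field :: "'m chart set \<Rightarrow> ('m \<Rightarrow> real) \<Rightarrow> ('m \<Rightarrow> real^4) \<Rightarrow> bool" where
  "tangential_field M x V \<longleftrightarrow> smooth_section M (tangent_bundle M) V \<and>
     (\<forall>p\<in>bdry M. tderiv M x p (V p) = 0)"

text \<open>\<open>f \<sim> (\<Sum>(\<gamma>,l)\<in>I. a (\<gamma>,l) * x^\<gamma> * (ln x)^l)\<close>, where the \<open>a (\<gamma>,l)\<close> are smooth up to the boundary
  and the expansion may be differentiated arbitrarily often along vector fields tangent to the
  boundary. The only term without decay is the one with \<open>(\<gamma>,l) = (0,0)\<close>, so that \<open>f\<close> is \<open>O(1)\<close>
  with a well-defined restriction to the boundary.\<close>

definition phg_fun :: "'m::topological_space chart set \<Rightarrow> ('m \<Rightarrow> real) \<Rightarrow> 'm set \<Rightarrow> ('m \<Rightarrow> real) \<Rightarrow> bool"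
where
  "phg_fun M x U f \<longleftrightarrow>
     continuous_on U f \<and> smooth_fun M (U - bdry M) f \<and>
     (\<exists>(I :: (complex \<times> nat) set) (a :: complex \<times> nat \<Rightarrow> 'm \<Rightarrow> complex).
        (\<forall>(\<gamma>, l)\<in>I. Re \<gamma> > 0 \<or> (\<gamma> = 0 \<and> l = 0)) \<and>
        (\<forall>N::nat. finite {i\<in>I. Re (fst i) \<le> real N}) \<and>
        (\<forall>i\<in>I. smooth_fun M U (a i)) \<and>
        (\<forall>(N::nat) Vs K. (\<forall>V\<in>set Vs. tangential_field M x V) \<and> compact K \<and> K \<subseteq> U \<longrightarrow>
           (\<exists>C. \<forall>p\<in>K - bdry M.
              cmod (foldr (\<lambda>V h q. tderiv M h q (V q)) Vs
                (\<lambda>q. of_real (f q) - (\<Sum>(\<gamma>, l)\<in>{i\<in>I. Re (fst i) \<le> real N}.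
                   a (\<gamma>, l) q * of_real (x q) powr \<gamma> * of_real (ln (x q)) ^ l)) p)
              \<le> C * x p ^ N)))"

definition phg_section ::
  "'m::topological_space chart set \<Rightarrow> ('m \<Rightarrow> real) \<Rightarrow> ('m, 'v::euclidean_space) vbundle \<Rightarrow> ('m \<Rightarrow> 'v) \<Rightarrow> bool"
where
  "phg_section M x E s \<longleftrightarrow> (\<forall>(U, T)\<in>E. \<forall>b\<in>Basis. phg_fun M x U (\<lambda>p. T p (s p) \<bullet> b))"


section \<open>The 0-tangent bundle\<close>

text \<open>For a boundary defining function \<open>x\<close>, every smooth vector field vanishing on the boundary is
  \<open>x V\<close> for a unique smooth vector field \<open>V\<close>. Thus \<open>V \<mapsto> x V\<close> identifies the tangent bundle with the
  0-tangent bundle, and a section \<open>V\<close> of \<open>zero_tangent_bundle M\<close> always stands for the vector field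
  \<open>x V\<close>; this is the role of the factors \<open>x p\<close> in the next two definitions. In particular
  \<open>dx/x\<close> evaluates on \<open>V\<close> to \<open>tderiv M x p (V p)\<close>, and the isomorphism \<open>V \<mapsto> x V\<close> from the tangent
  bundle of the boundary to the kernel of \<open>dx/x\<close> on the boundary becomes an equality of subspaces
  of the fibre.

  The orientation of the manifold is the standard orientation of the fibres \<open>real^4\<close>.\<close>

abbreviation zero_tangent_bundle :: "'m chart set \<Rightarrow> ('m, real^4) vbundle" where
  "zero_tangent_bundle M \<equiv> tangent_bundle M"

abbreviation zero_cotangent_bundle :: "'m chart set \<Rightarrow> ('m, real^4) vbundle" where
  "zero_cotangent_bundle M \<equiv> dual_bundle (tangent_bundle M)"

abbreviation zero_field :: "'m chart set \<Rightarrow> ('m \<Rightarrow> real^4) \<Rightarrow> bool" where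
  "zero_field M V \<equiv> smooth_section M (zero_tangent_bundle M) V"

text \<open>The action of \<open>x V\<close> on functions. For a polyhomogeneous \<open>f\<close>, which need not be differentiable
  at the boundary, the boundary value is the limit \<open>0\<close>.\<close>

definition zderiv ::
  "'m chart set \<Rightarrow> ('m \<Rightarrow> real) \<Rightarrow> ('m \<Rightarrow> real^4) \<Rightarrow> ('m \<Rightarrow> 'b::real_normed_vector) \<Rightarrow> 'm \<Rightarrow> 'b" where
  "zderiv M x V f p = x p *\<^sub>R tderiv M f p (V p)"

definition lie_bracket ::
  "'m chart set \<Rightarrow> ('m \<Rightarrow> real^4) \<Rightarrow> ('m \<Rightarrow> real^4) \<Rightarrow> 'm \<Rightarrow> real^4" where
  "lie_bracket M V W p =
     (let (U, \<phi>) = chart_at M p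
      in tderiv M (\<lambda>q. tderiv M \<phi> q (W q)) p (V p) - tderiv M (\<lambda>q. tderiv M \<phi> q (V q)) p (W p))"

text \<open>\<open>[x V, x W] = x (dx(V) W - dx(W) V + x [V, W])\<close>\<close>

definition zero_bracket ::
  "'m chart set \<Rightarrow> ('m \<Rightarrow> real) \<Rightarrow> ('m \<Rightarrow> real^4) \<Rightarrow> ('m \<Rightarrow> real^4) \<Rightarrow> 'm \<Rightarrow> real^4" where
  "zero_bracket M x V W p =
     tderiv M x p (V p) *\<^sub>R W p - tderiv M x p (W p) *\<^sub>R V p + x p *\<^sub>R lie_bracket M V W p"


section \<open>Connections and curvature\<close>

definition ordinary_connection ::
  "'m chart set \<Rightarrow> ('m, 'v::euclidean_space) vbundle \<Rightarrow> (('m \<Rightarrow> real^4) \<Rightarrow> ('m \<Rightarrow> 'v) \<Rightarrow> 'm \<Rightarrow> 'v) \<Rightarrow> bool"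
where
  "ordinary_connection M E D \<longleftrightarrow>
     (\<forall>V s. smooth_section M (tangent_bundle M) V \<and> smooth_section M E s \<longrightarrow>
        smooth_section M E (D V s)) \<and>
     (\<forall>V W s. smooth_section M (tangent_bundle M) V \<and> smooth_section M (tangent_bundle M) W \<and>
        smooth_section M E s \<longrightarrow> D (\<lambda>p. V p + W p) s = (\<lambda>p. D V s p + D W s p)) \<and>
     (\<forall>f V s. smooth_fun M UNIV f \<and> smooth_section M (tangent_bundle M) V \<and>
        smooth_section M E s \<longrightarrow> D (\<lambda>p. f p *\<^sub>R V p) s = (\<lambda>p. f p *\<^sub>R D V s p)) \<and>
     (\<forall>V s t. smooth_section M (tangent_bundle M) V \<and> smooth_section M E s \<and>
        smooth_section M E t \<longrightarrow> D V (\<lambda>p. s p + t p) = (\<lambda>p. D V s p + D V t p)) \<and>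
     (\<forall>V f s. smooth_section M (tangent_bundle M) V \<and> smooth_fun M UNIV f \<and>
        smooth_section M E s \<longrightarrow>
        D V (\<lambda>p. f p *\<^sub>R s p) = (\<lambda>p. tderiv M f p (V p) *\<^sub>R s p + f p *\<^sub>R D V s p))"

text \<open>0-connections with polyhomogeneous coefficients. Such a connection is determined by its action
  on smooth sections, where its values are polyhomogeneous, and it extends uniquely, by the Leibniz
  rule, to polyhomogeneous sections. The extended operator is taken as the primitive object since
  only it can be iterated.\<close>

definition zero_connection ::
  "'m::topological_space chart set \<Rightarrow> ('m \<Rightarrow> real) \<Rightarrow> ('m, 'v::euclidean_space) vbundle \<Rightarrow>
   (('m \<Rightarrow> real^4) \<Rightarrow> ('m \<Rightarrow> 'v) \<Rightarrow> 'm \<Rightarrow> 'v) \<Rightarrow> bool" where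
  "zero_connection M x E A \<longleftrightarrow>
     (\<forall>V s. zero_field M V \<and> phg_section M x E s \<longrightarrow> phg_section M x E (A V s)) \<and>
     (\<forall>V W s. zero_field M V \<and> zero_field M W \<and> phg_section M x E s \<longrightarrow>
        A (\<lambda>p. V p + W p) s = (\<lambda>p. A V s p + A W s p)) \<and>
     (\<forall>f V s. smooth_fun M UNIV f \<and> zero_field M V \<and> phg_section M x E s \<longrightarrow>
        A (\<lambda>p. f p *\<^sub>R V p) s = (\<lambda>p. f p *\<^sub>R A V s p)) \<and>
     (\<forall>V s t. zero_field M V \<and> phg_section M x E s \<and> phg_section M x E t \<longrightarrow>
        A V (\<lambda>p. s p + t p) = (\<lambda>p. A V s p + A V t p)) \<and>
     (\<forall>V f s. zero_field M V \<and> phg_fun M x UNIV f \<and> phg_section M x E s \<longrightarrow>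
        A V (\<lambda>p. f p *\<^sub>R s p) = (\<lambda>p. zderiv M x V f p *\<^sub>R s p + f p *\<^sub>R A V s p))"

text \<open>The value at \<open>p\<close> of \<open>F_A(v, w) u\<close>, for \<open>v\<close>, \<open>w\<close>, \<open>u\<close> in the fibres at \<open>p\<close>; the curvature is
  tensorial, so the choice of the smooth extensions is immaterial.\<close>

definition curvature ::
  "'m chart set \<Rightarrow> ('m \<Rightarrow> real) \<Rightarrow> ('m, 'v::euclidean_space) vbundle \<Rightarrow>
   (('m \<Rightarrow> real^4) \<Rightarrow> ('m \<Rightarrow> 'v) \<Rightarrow> 'm \<Rightarrow> 'v) \<Rightarrow> 'm \<Rightarrow> real^4 \<Rightarrow> real^4 \<Rightarrow> 'v \<Rightarrow> 'v" where
  "curvature M x E A p v w u =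
     (let V = extend M (zero_tangent_bundle M) p v;
          W = extend M (zero_tangent_bundle M) p w;
          s = extend M E p u
      in A V (A W s) p - A W (A V s) p - A (zero_bracket M x V W) s p)"


section \<open>Metrics, the Hodge star and Poincare-Einstein manifolds\<close>

definition sharp :: "(real^4 \<Rightarrow> real^4 \<Rightarrow> real) \<Rightarrow> real^4 \<Rightarrow> real^4" where
  "sharp G \<alpha> = (THE v. \<forall>w. G v w = \<alpha> \<bullet> w)"

definition dual_metric :: "(real^4 \<Rightarrow> real^4 \<Rightarrow> real) \<Rightarrow> real^4 \<Rightarrow> real^4 \<Rightarrow> real" where
  "dual_metric G \<alpha> \<beta> = \<alpha> \<bullet> sharp G \<beta>"

definition volume_form ::
  "(real^4 \<Rightarrow> real^4 \<Rightarrow> real) \<Rightarrow> real^4 \<Rightarrow> real^4 \<Rightarrow> real^4 \<Rightarrow> real^4 \<Rightarrow> real" where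
  "volume_form G a b c d =
     sqrt (det (\<chi> i j. G (axis i 1) (axis j 1) :: real^4^4)) *
     det (\<chi> i. (if i = 0 then a else if i = 1 then b else if i = 2 then c else d) :: real^4^4)"

text \<open>In index notation, \<open>(*\<beta>)_kl = 1/2 \<beta>^ij vol_ijkl\<close>; so \<open>*(e^0 \<and> e^1) = e^2 \<and> e^3\<close> for an
  oriented orthonormal coframe.\<close>

definition hodge_star ::
  "(real^4 \<Rightarrow> real^4 \<Rightarrow> real) \<Rightarrow> (real^4 \<Rightarrow> real^4 \<Rightarrow> 'a::real_vector) \<Rightarrow> real^4 \<Rightarrow> real^4 \<Rightarrow> 'a" where
  "hodge_star G \<beta> v w =
     (1/2) *\<^sub>R (\<Sum>i\<in>UNIV. \<Sum>j\<in>UNIV.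
        volume_form G (sharp G (axis i 1)) (sharp G (axis j 1)) v w *\<^sub>R \<beta> (axis i 1) (axis j 1))"

definition conformally_compact_metric ::
  "'m::topological_space chart set \<Rightarrow> ('m \<Rightarrow> real) \<Rightarrow> ('m \<Rightarrow> real^4 \<Rightarrow> real^4 \<Rightarrow> real) \<Rightarrow> bool" where
  "conformally_compact_metric M x g \<longleftrightarrow>
     (\<forall>p. bilinear (g p) \<and> (\<forall>v w. g p v w = g p w v) \<and> (\<forall>v. v \<noteq> 0 \<longrightarrow> g p v v > 0)) \<and>
     (\<forall>V W. zero_field M V \<and> zero_field M W \<longrightarrow> phg_fun M x UNIV (\<lambda>p. g p (V p) (W p)))"

definition levi_civita ::
  "'m::topological_space chart set \<Rightarrow> ('m \<Rightarrow> real) \<Rightarrow> ('m \<Rightarrow> real^4 \<Rightarrow> real^4 \<Rightarrow> real) \<Rightarrow>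
   (('m \<Rightarrow> real^4) \<Rightarrow> ('m \<Rightarrow> real^4) \<Rightarrow> 'm \<Rightarrow> real^4) \<Rightarrow> bool" where
  "levi_civita M x g nab \<longleftrightarrow>
     zero_connection M x (zero_tangent_bundle M) nab \<and>
     (\<forall>V Y Z. zero_field M V \<and> phg_section M x (zero_tangent_bundle M) Y \<and>
        phg_section M x (zero_tangent_bundle M) Z \<longrightarrow>
        zderiv M x V (\<lambda>p. g p (Y p) (Z p)) = (\<lambda>p. g p (nab V Y p) (Z p) + g p (Y p) (nab V Z p))) \<and>
     (\<forall>V W. zero_field M V \<and> zero_field M W \<longrightarrow>
        (\<lambda>p. nab V W p - nab W V p) = zero_bracket M x V W)"

definition dual_connection ::
  "'m::topological_space chart set \<Rightarrow> ('m \<Rightarrow> real) \<Rightarrow>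
   (('m \<Rightarrow> real^4) \<Rightarrow> ('m \<Rightarrow> real^4) \<Rightarrow> 'm \<Rightarrow> real^4) \<Rightarrow>
   (('m \<Rightarrow> real^4) \<Rightarrow> ('m \<Rightarrow> real^4) \<Rightarrow> 'm \<Rightarrow> real^4) \<Rightarrow> bool" where
  "dual_connection M x nab nab' \<longleftrightarrow>
     zero_connection M x (zero_cotangent_bundle M) nab' \<and>
     (\<forall>V \<alpha> Y. zero_field M V \<and> phg_section M x (zero_cotangent_bundle M) \<alpha> \<and>
        phg_section M x (zero_tangent_bundle M) Y \<longrightarrow>
        zderiv M x V (\<lambda>p. \<alpha> p \<bullet> Y p) = (\<lambda>p. nab' V \<alpha> p \<bullet> Y p + \<alpha> p \<bullet> nab V Y p))"

text \<open>\<open>Ric(v, w)\<close> is the trace of \<open>u \<mapsto> R(u, v) w\<close>.\<close>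

definition ricci ::
  "'m chart set \<Rightarrow> ('m \<Rightarrow> real) \<Rightarrow> (('m \<Rightarrow> real^4) \<Rightarrow> ('m \<Rightarrow> real^4) \<Rightarrow> 'm \<Rightarrow> real^4) \<Rightarrow>
   'm \<Rightarrow> real^4 \<Rightarrow> real^4 \<Rightarrow> real" where
  "ricci M x nab p v w = trace (matrix (\<lambda>u. curvature M x (zero_tangent_bundle M) nab p u v w))"

definition poincare_einstein ::
  "'m::topological_space chart set \<Rightarrow> ('m \<Rightarrow> real) \<Rightarrow> ('m \<Rightarrow> real^4 \<Rightarrow> real^4 \<Rightarrow> real) \<Rightarrow>
   (('m \<Rightarrow> real^4) \<Rightarrow> ('m \<Rightarrow> real^4) \<Rightarrow> 'm \<Rightarrow> real^4) \<Rightarrow> bool" where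
  "poincare_einstein M x g nab \<longleftrightarrow>
     conformally_compact_metric M x g \<and> levi_civita M x g nab \<and>
     (\<forall>p v w. ricci M x nab p v w + 3 * g p v w = 0)"


section \<open>SU(2) bundles and 0-spin structures\<close>

definition ctranspose :: "complex^'n^'m \<Rightarrow> complex^'m^'n" where
  "ctranspose a = (\<chi> i j. cnj (a $ j $ i))"

definition SU2 :: "(complex^2^2) set" where
  "SU2 = {a. ctranspose a ** a = mat 1 \<and> det a = 1}"

definition su2 :: "(complex^2^2) set" where
  "su2 = {a. ctranspose a = - a \<and> trace a = 0}"

text \<open>The Hermitian metric and the complex volume form of \<open>complex^2\<close>.\<close>

definition herm :: "complex^2 \<Rightarrow> complex^2 \<Rightarrow> complex" where
  "herm u w = (\<Sum>i\<in>UNIV. u $ i * cnj (w $ i))"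

definition cvol :: "complex^2 \<Rightarrow> complex^2 \<Rightarrow> complex" where
  "cvol u w = u $ 1 * w $ 2 - u $ 2 * w $ 1"

text \<open>The fibres of an SU(2) vbundle carry the standard Hermitian metric and volume form of
  \<open>complex^2\<close>: choose an SU(2) frame in every fibre.\<close>

definition su2_bundle ::
  "'m::topological_space chart set \<Rightarrow> ('m, complex^2) vbundle \<Rightarrow> bool" where
  "su2_bundle M E \<longleftrightarrow> vector_bundle M E \<and> (\<forall>(U, T)\<in>E. \<forall>p\<in>U. \<exists>a\<in>SU2. T p = (\<lambda>u. a *v u))"

definition su2_connection ::
  "'m::topological_space chart set \<Rightarrow> ('m \<Rightarrow> real) \<Rightarrow> ('m, complex^2) vbundle \<Rightarrow>
   (('m \<Rightarrow> real^4) \<Rightarrow> ('m \<Rightarrow> complex^2) \<Rightarrow> 'm \<Rightarrow> complex^2) \<Rightarrow> bool" where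
  "su2_connection M x E A \<longleftrightarrow>
     zero_connection M x E A \<and>
     (\<forall>V s. zero_field M V \<and> phg_section M x E s \<longrightarrow>
        A V (\<lambda>p. \<i> *s s p) = (\<lambda>p. \<i> *s A V s p)) \<and>
     (\<forall>V s t. zero_field M V \<and> phg_section M x E s \<and> phg_section M x E t \<longrightarrow>
        zderiv M x V (\<lambda>p. herm (s p) (t p)) = (\<lambda>p. herm (A V s p) (t p) + herm (s p) (A V t p)) \<and>
        zderiv M x V (\<lambda>p. cvol (s p) (t p)) = (\<lambda>p. cvol (A V s p) (t p) + cvol (s p) (A V t p)))"

definition sigma :: "4 \<Rightarrow> complex^2^2" where
  "sigma i =
     (if i = 1 then vector [vector [\<i>, 0], vector [0, - \<i>]]
      else if i = 2 then vector [vector [0, 1], vector [- 1, 0]]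
      else vector [vector [0, \<i>], vector [\<i>, 0]])"

definition standard_clifford :: "4 \<Rightarrow> (complex^2) \<times> (complex^2) \<Rightarrow> (complex^2) \<times> (complex^2)" where
  "standard_clifford i \<psi> =
     (if i = 0 then (snd \<psi>, - fst \<psi>) else (sigma i *v snd \<psi>, sigma i *v fst \<psi>))"

definition oriented_orthonormal_coframe ::
  "(real^4 \<Rightarrow> real^4 \<Rightarrow> real) \<Rightarrow> (4 \<Rightarrow> real^4) \<Rightarrow> bool" where
  "oriented_orthonormal_coframe G e \<longleftrightarrow>
     (\<forall>i j. dual_metric G (e i) (e j) = (if i = j then 1 else 0)) \<and> det (\<chi> i. e i) > 0"

text \<open>Clifford multiplication maps covectors to endomorphisms of the sum of the spinor bundles, with
  fibre \<open>(complex^2) \<times> (complex^2)\<close>. The first three conjuncts of the condition on \<open>c p\<close> say that it is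
  linear with values in the skew-Hermitian endomorphisms. SU(2) frames of the two spinor spaces at
  \<open>p\<close> are given by the columns of \<open>a\<close> and \<open>b\<close> in \<open>SU2\<close>. It is enough to compare with the standard matrices
  fibrewise: \<open>c\<close> is injective and polyhomogeneous, so local SU(2) frames yield a local coframe which
  is unique and as regular as \<open>c\<close>.\<close>

definition zero_spin_structure ::
  "'m::topological_space chart set \<Rightarrow> ('m \<Rightarrow> real) \<Rightarrow> ('m \<Rightarrow> real^4 \<Rightarrow> real^4 \<Rightarrow> real) \<Rightarrow>
   ('m, complex^2) vbundle \<Rightarrow> ('m, complex^2) vbundle \<Rightarrow>
   ('m \<Rightarrow> real^4 \<Rightarrow> (complex^2) \<times> (complex^2) \<Rightarrow> (complex^2) \<times> (complex^2)) \<Rightarrow> bool" where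
  "zero_spin_structure M x g Sp Sm c \<longleftrightarrow>
     su2_bundle M Sp \<and> su2_bundle M Sm \<and>
     (\<forall>p.
        (\<forall>\<psi>. linear (\<lambda>\<alpha>. c p \<alpha> \<psi>)) \<and>
        (\<forall>\<alpha>. linear (c p \<alpha>) \<and> (\<forall>u w. c p \<alpha> (\<i> *s u, \<i> *s w) =
           (\<i> *s fst (c p \<alpha> (u, w)), \<i> *s snd (c p \<alpha> (u, w))))) \<and>
        (\<forall>\<alpha> \<psi> \<xi>. herm (fst (c p \<alpha> \<psi>)) (fst \<xi>) + herm (snd (c p \<alpha> \<psi>)) (snd \<xi>) =
           - (herm (fst \<psi>) (fst (c p \<alpha> \<xi>)) + herm (snd \<psi>) (snd (c p \<alpha> \<xi>)))) \<and>
        (\<forall>\<alpha> u w. fst (c p \<alpha> (u, 0)) = 0 \<and> snd (c p \<alpha> (0, w)) = 0) \<and>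
        (\<forall>\<alpha> \<psi>. c p \<alpha> (c p \<alpha> \<psi>) = - (dual_metric (g p) \<alpha> \<alpha> *\<^sub>R \<psi>)) \<and>
        (\<forall>a\<in>SU2. \<forall>b\<in>SU2. \<exists>e. oriented_orthonormal_coframe (g p) e \<and>
           (\<forall>i \<psi>. c p (e i) (a *v fst \<psi>, b *v snd \<psi>) =
              (a *v fst (standard_clifford i \<psi>), b *v snd (standard_clifford i \<psi>))))) \<and>
     (\<forall>\<alpha> s t. smooth_section M (zero_cotangent_bundle M) \<alpha> \<and> smooth_section M Sp s \<and>
        smooth_section M Sm t \<longrightarrow>
        phg_section M x Sp (\<lambda>p. fst (c p (\<alpha> p) (s p, t p))) \<and>
        phg_section M x Sm (\<lambda>p. snd (c p (\<alpha> p) (s p, t p))))"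

text \<open>\<open>A_V (c(\<alpha>) \<psi>) = c(nab_V \<alpha>) \<psi> + c(\<alpha>) A_V \<psi>\<close> for the direct sum \<open>A\<close> of \<open>Ap\<close> and \<open>Am\<close> and
  \<open>\<psi> = (s, t)\<close>.\<close>

definition levi_civita_spin_connections ::
  "'m::topological_space chart set \<Rightarrow> ('m \<Rightarrow> real) \<Rightarrow>
   (('m \<Rightarrow> real^4) \<Rightarrow> ('m \<Rightarrow> real^4) \<Rightarrow> 'm \<Rightarrow> real^4) \<Rightarrow>
   ('m, complex^2) vbundle \<Rightarrow> ('m, complex^2) vbundle \<Rightarrow>
   ('m \<Rightarrow> real^4 \<Rightarrow> (complex^2) \<times> (complex^2) \<Rightarrow> (complex^2) \<times> (complex^2)) \<Rightarrow>
   (('m \<Rightarrow> real^4) \<Rightarrow> ('m \<Rightarrow> complex^2) \<Rightarrow> 'm \<Rightarrow> complex^2) \<Rightarrow>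
   (('m \<Rightarrow> real^4) \<Rightarrow> ('m \<Rightarrow> complex^2) \<Rightarrow> 'm \<Rightarrow> complex^2) \<Rightarrow> bool" where
  "levi_civita_spin_connections M x nab Sp Sm c Ap Am \<longleftrightarrow>
     su2_connection M x Sp Ap \<and> su2_connection M x Sm Am \<and>
     (\<exists>nab'. dual_connection M x nab nab' \<and>
        (\<forall>V \<alpha> s t. zero_field M V \<and> phg_section M x (zero_cotangent_bundle M) \<alpha> \<and>
           phg_section M x Sp s \<and> phg_section M x Sm t \<longrightarrow>
           (\<forall>p. (Ap V (\<lambda>q. fst (c q (\<alpha> q) (s q, t q))) p, Am V (\<lambda>q. snd (c q (\<alpha> q) (s q, t q))) p) =
                c p (nab' V \<alpha> p) (s p, t p) + c p (\<alpha> p) (Ap V s p, Am V t p))))"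


section \<open>Self-duality and the Nahm pole boundary condition\<close>

definition curvature_form ::
  "'m chart set \<Rightarrow> ('m \<Rightarrow> real) \<Rightarrow> ('m, complex^2) vbundle \<Rightarrow>
   (('m \<Rightarrow> real^4) \<Rightarrow> ('m \<Rightarrow> complex^2) \<Rightarrow> 'm \<Rightarrow> complex^2) \<Rightarrow> 'm \<Rightarrow> real^4 \<Rightarrow> real^4 \<Rightarrow> complex^2^2" where
  "curvature_form M x E A p v w = matrix (curvature M x E A p v w)"

definition self_dual ::
  "'m chart set \<Rightarrow> ('m \<Rightarrow> real) \<Rightarrow> ('m \<Rightarrow> real^4 \<Rightarrow> real^4 \<Rightarrow> real) \<Rightarrow> ('m, complex^2) vbundle \<Rightarrow>
   (('m \<Rightarrow> real^4) \<Rightarrow> ('m \<Rightarrow> complex^2) \<Rightarrow> 'm \<Rightarrow> complex^2) \<Rightarrow> bool" where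
  "self_dual M x g E A \<longleftrightarrow>
     (\<forall>p. curvature_form M x E A p = hodge_star (g p) (curvature_form M x E A p))"

text \<open>\<open>(A - D)_v\<close> at a boundary point \<open>p\<close>. As \<open>V\<close> stands for the vector field \<open>x V\<close>, the term
  \<open>D_(x V) s = x D_V s\<close> vanishes there, whence the choice of \<open>D\<close> and that of the smooth extensions
  are immaterial.\<close>

definition residue ::
  "'m chart set \<Rightarrow> ('m \<Rightarrow> real) \<Rightarrow> ('m, complex^2) vbundle \<Rightarrow>
   (('m \<Rightarrow> real^4) \<Rightarrow> ('m \<Rightarrow> complex^2) \<Rightarrow> 'm \<Rightarrow> complex^2) \<Rightarrow> 'm \<Rightarrow> real^4 \<Rightarrow> complex^2^2" where
  "residue M x E A p v = matrix (\<lambda>u.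
     let V = extend M (zero_tangent_bundle M) p v;
         s = extend M E p u;
         D = (SOME D. ordinary_connection M E D)
     in A V s p - x p *\<^sub>R D V s p)"

definition K_space :: "'m chart set \<Rightarrow> ('m \<Rightarrow> real) \<Rightarrow> 'm \<Rightarrow> (real^4) set" where
  "K_space M x p = {v. tderiv M x p v = 0}"

text \<open>The outward unit normal to \<open>K_space M x p\<close>, for \<open>p\<close> in the boundary.\<close>

definition outward_normal ::
  "'m chart set \<Rightarrow> ('m \<Rightarrow> real) \<Rightarrow> ('m \<Rightarrow> real^4 \<Rightarrow> real^4 \<Rightarrow> real) \<Rightarrow> 'm \<Rightarrow> real^4" where
  "outward_normal M x g p =
     (let n = sharp (g p) (\<chi> i. tderiv M x p (axis i 1)) in - (n /\<^sub>R sqrt (g p n n)))"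

text \<open>The cross product on \<open>K_space M x p\<close> is characterised by \<open>g (v \<times> w) u = vol_K v w u\<close>, where
  \<open>vol_K v w u = vol \<nu> v w u\<close> for the outward unit normal \<open>\<nu>\<close>.\<close>

definition K_cross ::
  "'m chart set \<Rightarrow> ('m \<Rightarrow> real) \<Rightarrow> ('m \<Rightarrow> real^4 \<Rightarrow> real^4 \<Rightarrow> real) \<Rightarrow> 'm \<Rightarrow> real^4 \<Rightarrow> real^4 \<Rightarrow> real^4" where
  "K_cross M x g p v w =
     sharp (g p) (\<chi> i. volume_form (g p) (outward_normal M x g p) v w (axis i 1))"

definition nahm_pole ::
  "'m chart set \<Rightarrow> ('m \<Rightarrow> real) \<Rightarrow> ('m \<Rightarrow> real^4 \<Rightarrow> real^4 \<Rightarrow> real) \<Rightarrow> ('m, complex^2) vbundle \<Rightarrow>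
   (('m \<Rightarrow> real^4) \<Rightarrow> ('m \<Rightarrow> complex^2) \<Rightarrow> 'm \<Rightarrow> complex^2) \<Rightarrow> bool" where
  "nahm_pole M x g E A \<longleftrightarrow>
     (\<forall>p\<in>bdry M.
        (\<forall>v. (\<forall>k\<in>K_space M x p. g p v k = 0) \<longrightarrow> residue M x E A p v = 0) \<and>
        (\<forall>v\<in>K_space M x p. \<forall>w\<in>K_space M x p. \<forall>a b.
           residue M x E A p (a *\<^sub>R v + b *\<^sub>R w) =
             a *\<^sub>R residue M x E A p v + b *\<^sub>R residue M x E A p w) \<and>
        bij_betw (residue M x E A p) (K_space M x p) su2 \<and>
        (\<forall>v\<in>K_space M x p. \<forall>w\<in>K_space M x p.
           residue M x E A p (K_cross M x g p v w) =
             residue M x E A p v ** residue M x E A p w -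
             residue M x E A p w ** residue M x E A p v))"

end

theory Submission
  imports Defs
begin

text \<open>The curvature \<open>F(v, w)\<close> of the connection on \<open>S_+\<close> is the image of the Riemannian curvature
  \<open>R(v, w)\<close> under \<open>so(4) \<rightarrow> su(2)\<close>: its component along \<open>\<sigma>_k\<close> is \<open>(R_0k + R_ij) / 2\<close> for cyclic
  \<open>(i, j, k)\<close>. For an Einstein metric \<open>R\<close> commutes with the Hodge star, so \<open>F\<close> is self-dual.

  At the boundary the vector fields \<open>x V\<close> vanish, whence the 0-connections act there by
  endomorphisms. The Koszul formula gives \<open>\<nabla>_V Y = g(V, Y) n - dx(Y) V\<close> with \<open>n\<close> dual to \<open>dx\<close>; the
  curvature of this is constant equal to \<open>- |n|^2\<close>, so the Einstein equation forces \<open>|n| = 1\<close>. In a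
  coframe with \<open>e^0 = - dx\<close> the lift of \<open>\<nabla>_V\<close> to \<open>S_+\<close> is \<open>(V_1 \<sigma>_1 + V_2 \<sigma>_2 + V_3 \<sigma>_3) / 2\<close>, which is the
  Nahm pole.

  Products of polyhomogeneous functions are never expanded: identities in the interior are tested on
  sections supported away from the boundary, and a connection compatible with a nondegenerate
  pairing has a curvature that is skew for it, hence tensorial.\<close>

section \<open>Smooth functions on Euclidean spaces\<close>

text \<open>The obstacle is regularity. \<open>zero_spin_structure\<close> gives polyhomogeneous
  Clifford products for smooth sections only, whereas curvature differentiates twice and meets
  products such as c(nab' \<alpha>) s whose factors are merely polyhomogeneous. A cutoff of \<alpha>
  supported in the open interior makes these products smooth. At a boundary point such a cutoff
  vanishes; but there a single derivative already acts on the value of the section, so the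
  curvatures are computed by hand from endomorphisms.

  The algebra is the same in both cases: a skew endomorphism of the tangent fibre, an element of
  su(2) on S_+ and a matrix on S_-, tied together by Clifford multiplication
  (\<open>spin_lift\<close>). It is applied to the curvature in the interior and to the connection
  itself at the boundary.

  The coframe with e^0 = - dx exists because the SU(2) frame of S_- can be changed independently of
  that of S_+: this moves e^0 through all unit covectors. Hence |dx| = 1 has to be known before the
  frame is chosen. The factor 1/2 in the residue compensates [\<sigma>_1, \<sigma>_2] = 2
  \<sigma>_3.\<close>

lemma Ck_on_cong:
  assumes "open S" "\<And>x. x \<in> S \<Longrightarrow> f x = g x" "Ck_on k S f"
  shows "Ck_on k S g"
  using assms(2,3)
proof (induction k arbitrary: f g)
  case 0
  then show ?case using continuous_on_cong[of S S f g] by auto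
next
  case (Suc k)
  have d: "(g has_derivative f') (at x) = (f has_derivative f') (at x)" if "x \<in> S" for x f'
    using has_derivative_transform_within_open[OF _ assms(1) that, of g f' UNIV f]
      has_derivative_transform_within_open[OF _ assms(1) that, of f f' UNIV g] Suc.prems(1)
    by auto
  have fd: "frechet_derivative f (at x) = frechet_derivative g (at x)" if "x \<in> S" for x
    unfolding frechet_derivative_def d[OF that] ..
  have "g differentiable_on S"
    using Suc.prems(2) d
    by (simp add: differentiable_on_def differentiable_def at_within_open[OF _ assms(1)])
  moreover have "Ck_on k S (\<lambda>x. frechet_derivative g (at x) v)" for v
    by (rule Suc.IH[where f="\<lambda>x. frechet_derivative f (at x) v"]) (use Suc.prems fd in auto)
  ultimately show ?case by simp
qed

lemma Ck_on_subset: "Ck_on k S f \<Longrightarrow> T \<subseteq> S \<Longrightarrow> Ck_on k T f"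
  by (induction k arbitrary: f) (auto intro: continuous_on_subset differentiable_on_subset)

lemma Ck_on_Suc_imp: "Ck_on (Suc k) S f \<Longrightarrow> Ck_on k S f"
proof (induction k arbitrary: f)
  case 0
  then show ?case by (simp add: differentiable_imp_continuous_on)
next
  case (Suc k)
  have "Ck_on k S (\<lambda>x. frechet_derivative f (at x) v)" for v
    by (rule Suc.IH) (use Suc.prems in simp)
  then show ?case using Suc.prems by simp
qed

lemma Ck_onI:
  assumes "open S" "\<And>x. x \<in> S \<Longrightarrow> (f has_derivative f' x) (at x)" "\<And>v. Ck_on k S (\<lambda>x. f' x v)"
  shows "Ck_on (Suc k) S f"
proof -
  have "f differentiable_on S"
    using assms(1,2) by (auto simp: differentiable_on_def differentiable_def at_within_open[OF _ assms(1)])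
  moreover have "Ck_on k S (\<lambda>x. frechet_derivative f (at x) v)" for v
    by (rule Ck_on_cong[OF assms(1) _ assms(3)[of v]]) (simp add: frechet_derivative_at[OF assms(2), symmetric])
  ultimately show ?thesis by simp
qed

lemma Ck_on_Suc_derivative:
  assumes "open S" "Ck_on (Suc k) S f" "x \<in> S"
  shows "(f has_derivative frechet_derivative f (at x)) (at x)"
  using assms by (auto simp: differentiable_on_def at_within_open[OF _ assms(1)] frechet_derivative_works)

lemma Ck_on_const: "Ck_on k S (\<lambda>x. c)"
proof (induction k arbitrary: c)
  case (Suc k)
  have "frechet_derivative (\<lambda>x. c) (at x) = (\<lambda>v. 0)" for x
    by simp
  then show ?case using Suc[of 0] by simp
qed simp

lemma Ck_on_bounded_linear: "open S \<Longrightarrow> bounded_linear f \<Longrightarrow> Ck_on k S f"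
proof (cases k)
  case 0
  then show "bounded_linear f \<Longrightarrow> ?thesis" by (simp add: linear_continuous_on)
next
  case (Suc j)
  assume "open S" "bounded_linear f"
  then show ?thesis unfolding Suc
    by (intro Ck_onI[where f'="\<lambda>_. f"] bounded_linear_imp_has_derivative Ck_on_const)
qed

lemma Ck_on_add:
  assumes "open S" "Ck_on k S f" "Ck_on k S g"
  shows "Ck_on k S (\<lambda>x. f x + g x)"
  using assms(2,3)
proof (induction k arbitrary: f g)
  case 0
  then show ?case by (simp add: continuous_on_add)
next
  case (Suc k)
  show ?case
    by (rule Ck_onI[OF assms(1) has_derivative_add[OF Ck_on_Suc_derivative[OF assms(1) Suc.prems(1)]
          Ck_on_Suc_derivative[OF assms(1) Suc.prems(2)]]]) (use Suc in auto)
qed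

lemma Ck_on_sum:
  assumes "open S" "\<And>i. i \<in> I \<Longrightarrow> Ck_on k S (f i)"
  shows "Ck_on k S (\<lambda>x. \<Sum>i\<in>I. f i x)"
  using assms(2)
  by (induction I rule: infinite_finite_induct) (auto intro: Ck_on_add[OF assms(1)] Ck_on_const)

lemma (in bounded_bilinear) Ck_on_bilinear:
  assumes "open S" "Ck_on k S f" "Ck_on k S g"
  shows "Ck_on k S (\<lambda>x. prod (f x) (g x))"
  using assms(2,3)
proof (induction k arbitrary: f g)
  case 0
  then show ?case by (simp add: continuous_on)
next
  case (Suc k)
  show ?case
  proof (rule Ck_onI[OF assms(1) FDERIV[OF Ck_on_Suc_derivative[OF assms(1) Suc.prems(1)]
          Ck_on_Suc_derivative[OF assms(1) Suc.prems(2)]]])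
    fix v
    have a: "Ck_on k S f" "Ck_on k S g" using Suc.prems Ck_on_Suc_imp by blast+
    show "Ck_on k S (\<lambda>x. prod (f x) (frechet_derivative g (at x) v) + prod (frechet_derivative f (at x) v) (g x))"
      using Suc a by (intro Ck_on_add[OF assms(1)]) auto
  qed
qed

lemma Ck_on_compose:
  fixes g :: "'a::euclidean_space \<Rightarrow> 'b::euclidean_space" and f :: "'b \<Rightarrow> 'c::real_normed_vector"
  assumes "open S" "open T" "Ck_on k T f" "Ck_on k S g" "g ` S \<subseteq> T"
  shows "Ck_on k S (\<lambda>x. f (g x))"
  using assms(3,4)
proof (induction k arbitrary: f)
  case 0
  then show ?case using assms(5) by (auto intro: continuous_on_compose2)
next
  case (Suc k)
  let ?f = "\<lambda>y. frechet_derivative f (at y)" and ?g = "\<lambda>x. frechet_derivative g (at x)"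
  have df: "(f has_derivative ?f y) (at y)" if "y \<in> T" for y
    by (rule Ck_on_Suc_derivative[OF assms(2) Suc.prems(1) that])
  have dg: "(g has_derivative ?g x) (at x)" if "x \<in> S" for x
    by (rule Ck_on_Suc_derivative[OF assms(1) Suc.prems(2) that])
  show ?case
  proof (rule Ck_onI[OF assms(1)])
    \<comment> \<open>The outer derivative is expanded in the basis because the induction hypothesis
      reaches \<open>?f (g x) b\<close> only for a fixed direction \<open>b\<close>, not for the
      moving direction \<open>?g x v\<close>.\<close>
    show "((\<lambda>x. f (g x)) has_derivative (\<lambda>v. \<Sum>b\<in>Basis. (?g x v \<bullet> b) *\<^sub>R ?f (g x) b)) (at x)"
      if x: "x \<in> S" for x
    proof -
      have gx: "g x \<in> T" using assms(5) x by auto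
      have "linear (?f (g x))" using df[OF gx] has_derivative_linear by blast
      then have "?f (g x) w = (\<Sum>b\<in>Basis. (w \<bullet> b) *\<^sub>R ?f (g x) b)" for w
        using linear_sum[of "?f (g x)" "\<lambda>b. (w \<bullet> b) *\<^sub>R b" Basis]
        by (simp add: linear_scale euclidean_representation)
      then have "(\<lambda>v. ?f (g x) (?g x v)) = (\<lambda>v. \<Sum>b\<in>Basis. (?g x v \<bullet> b) *\<^sub>R ?f (g x) b)"
        by (rule ext)
      then show ?thesis
        using has_derivative_compose[OF dg[OF x] df[OF gx]] by (simp only:)
    qed
    fix v
    have "Ck_on k S (\<lambda>x. ?f (g x) b)" for b
      by (rule Suc.IH) (use Suc.prems(1) Ck_on_Suc_imp[OF Suc.prems(2)] in auto)
    moreover have "Ck_on k S (\<lambda>x. ?g x v \<bullet> b)" for b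
      by (rule bounded_bilinear.Ck_on_bilinear[OF bounded_bilinear_inner assms(1)])
        (use Suc.prems(2) in \<open>simp_all add: Ck_on_const\<close>)
    ultimately show "Ck_on k S (\<lambda>x. \<Sum>b\<in>Basis. (?g x v \<bullet> b) *\<^sub>R ?f (g x) b)"
      by (intro Ck_on_sum assms(1) bounded_bilinear.Ck_on_bilinear[OF bounded_bilinear_scaleR])
  qed
qed

text \<open>Differentiation gives - v / x^2, a product of two copies of \<open>inverse\<close> and a
  constant, so the product rule closes the induction.\<close>

lemma Ck_on_inverse: "Ck_on k {0<..} (inverse :: real \<Rightarrow> real)"
proof (induction k)
  case 0
  then show ?case by (auto intro!: continuous_intros)
next
  case (Suc k)
  show ?case
  proof (rule Ck_onI)
    show "(inverse has_derivative (\<lambda>v. - (inverse x * v * inverse x))) (at x)" if "x \<in> {0<..}" for x :: real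
      using that has_derivative_inverse'[of x UNIV] by auto
    fix v :: real
    have "Ck_on k {0<..} (\<lambda>x. (inverse x * inverse x) * (-v))"
      by (intro bounded_bilinear.Ck_on_bilinear[OF bounded_bilinear_mult] Suc Ck_on_const) auto
    then show "Ck_on k {0<..} (\<lambda>x. - (inverse x * v * inverse x))"
      by (simp add: mult_ac)
  qed auto
qed

text \<open>The powers of 1/t are carried along because the family is then closed under
  differentiation up to linear combinations, so that one induction proves all members smooth. For
  \<open>n = 0\<close> this is the standard flat function.\<close>

definition exp_bump :: "nat \<Rightarrow> real \<Rightarrow> real" where
  "exp_bump n t = (if t > 0 then (1/t)^n * exp (- (1/t)) else 0)"

text \<open>With s = 1/t the right-hand limit becomes that of s^n / e^s at infinity; on the left the
  function is 0.\<close>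

lemma exp_bump_tendsto_0: "(exp_bump n \<longlongrightarrow> 0) (at 0)"
proof -
  have "((\<lambda>t::real. t ^ n / exp t) \<longlongrightarrow> 0) at_top"
    by (rule tendsto_power_div_exp_0)
  then have "((\<lambda>t. (inverse t) ^ n / exp (inverse t)) \<longlongrightarrow> 0) (at_right (0::real))"
    by (rule filterlim_compose[OF _ filterlim_inverse_at_top_right])
  then have "(exp_bump n \<longlongrightarrow> 0) (at_right 0)"
    by (rule Lim_transform_eventually)
      (auto simp: eventually_at_filter exp_bump_def exp_minus field_simps)
  moreover have "(exp_bump n \<longlongrightarrow> 0) (at_left 0)"
    by (rule Lim_transform_eventually[OF tendsto_const]) (auto simp: eventually_at_filter exp_bump_def)
  ultimately show ?thesis
    by (simp add: filterlim_split_at)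
qed

lemma exp_bump_has_derivative:
  "(exp_bump n has_real_derivative exp_bump (n + 2) t - real n * exp_bump (n + 1) t) (at t)"
proof (cases t "0::real" rule: linorder_cases)
  case less
  then have "(exp_bump n has_real_derivative 0) (at t)"
    by (subst has_field_derivative_cong_eventually[where g="\<lambda>_. 0"])
      (auto simp: exp_bump_def eventually_at dist_real_def intro!: exI[of _ "-t"])
  then show ?thesis using less by (simp add: exp_bump_def)
next
  case greater
  have "((\<lambda>t. (1/t)^n * exp (- (1/t))) has_real_derivative exp_bump (n + 2) t - real n * exp_bump (n + 1) t) (at t)"
  proof (cases n)
    case 0
    then show ?thesis using greater
      by (auto intro!: derivative_eq_intros simp: exp_bump_def field_simps power2_eq_square)
  next
    case (Suc m)
    have "t ^ m = t * t ^ (m - Suc 0) \<or> m = 0"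
      by (cases m) auto
    then show ?thesis unfolding Suc using greater
      by (auto intro!: derivative_eq_intros simp: exp_bump_def field_simps power2_eq_square)
  qed
  then show ?thesis
    by (rule has_field_derivative_transform_within_open[of _ _ _ "{0<..}"])
      (use greater in \<open>auto simp: exp_bump_def\<close>)
next
  case equal
  \<comment> \<open>Dividing \<open>exp_bump n\<close> by its variable raises the index by one, so
    the difference quotient at 0 is \<open>exp_bump (Suc n)\<close>.\<close>
  have "((\<lambda>y. (exp_bump n y - exp_bump n 0) / (y - 0)) \<longlongrightarrow> 0) (at 0)"
    by (rule Lim_transform_eventually[OF exp_bump_tendsto_0[of "Suc n"]])
      (auto simp: eventually_at_filter exp_bump_def)
  then show ?thesis using equal
    by (simp add: has_field_derivative_iff exp_bump_def)
qed

lemma Ck_on_exp_bump: "Ck_on k UNIV (exp_bump n)"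
proof (induction k arbitrary: n)
  case 0
  then show ?case
    using exp_bump_has_derivative by (auto intro!: DERIV_continuous_on)
next
  case (Suc k)
  show ?case
  proof (rule Ck_onI)
    show "(exp_bump n has_derivative (\<lambda>v. (exp_bump (n + 2) x + (- real n) * exp_bump (n + 1) x) * v)) (at x)" for x
      using exp_bump_has_derivative[of n x] by (simp add: has_field_derivative_def)
    fix v
    show "Ck_on k UNIV (\<lambda>x. (exp_bump (n + 2) x + (- real n) * exp_bump (n + 1) x) * v)"
      by (intro bounded_bilinear.Ck_on_bilinear[OF bounded_bilinear_mult] Ck_on_add Suc Ck_on_const) auto
  qed auto
qed

text \<open>Both iterated derivatives are limits of the same second difference quotient.\<close>

lemma second_derivative_symmetric_real:
  fixes f :: "'a::euclidean_space \<Rightarrow> real"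
  assumes S: "open S" "Ck_on 2 S f" "x \<in> S"
  shows "frechet_derivative (\<lambda>y. frechet_derivative f (at y) u) (at x) w =
         frechet_derivative (\<lambda>y. frechet_derivative f (at y) w) (at x) u"
proof -
  let ?d = "\<lambda>y u. frechet_derivative f (at y) u"
  let ?dd = "\<lambda>u w y. frechet_derivative (\<lambda>y. ?d y u) (at y) w"
  have Ck: "Ck_on (Suc (Suc 0)) S f" using S by (simp add: numeral_2_eq_2)
  then have Ck': "Ck_on (Suc 0) S (\<lambda>y. ?d y u)" for u by simp
  have df: "(f has_derivative ?d y) (at y)" if "y \<in> S" for y
    by (rule Ck_on_Suc_derivative[OF S(1) Ck that])
  have ddf: "((\<lambda>y. ?d y u) has_derivative (\<lambda>w. ?dd u w y)) (at y)" if "y \<in> S" for y u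
    by (rule Ck_on_Suc_derivative[OF S(1) Ck' that])
  have cont: "isCont (?dd u w) x" for u w
    using Ck' S(1,3) by (auto simp: continuous_on_eq_continuous_at)
  \<comment> \<open>The mean value theorem in direction \<open>u\<close>, applied to the increment
    \<open>G\<close> along \<open>h *\<^sub>R w\<close>, and then once more in direction
    \<open>w\<close>.\<close>
  have key: "\<exists>a b. 0 < a \<and> a < h \<and> 0 < b \<and> b < h \<and>
      f (x + h *\<^sub>R u + h *\<^sub>R w) - f (x + h *\<^sub>R u) - f (x + h *\<^sub>R w) + f x =
      h * h * ?dd u w (x + a *\<^sub>R u + b *\<^sub>R w)"
    if h: "h > 0" and B: "\<And>a b. 0 \<le> a \<Longrightarrow> a \<le> h \<Longrightarrow> 0 \<le> b \<Longrightarrow> b \<le> h \<Longrightarrow> x + a *\<^sub>R u + b *\<^sub>R w \<in> S" for h u w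
  proof -
    define G where "G = (\<lambda>a. f (x + a *\<^sub>R u + h *\<^sub>R w) - f (x + a *\<^sub>R u))"
    have dG: "(G has_real_derivative ?d (x + a *\<^sub>R u + h *\<^sub>R w) u - ?d (x + a *\<^sub>R u) u) (at a)"
      if a: "0 \<le> a" "a \<le> h" for a
    proof -
      have 1: "((\<lambda>a. f (x + a *\<^sub>R u + b *\<^sub>R w)) has_real_derivative ?d (x + a *\<^sub>R u + b *\<^sub>R w) u) (at a)"
        if "0 \<le> b" "b \<le> h" for b
      proof -
        have "((\<lambda>a. x + a *\<^sub>R u + b *\<^sub>R w) has_derivative (\<lambda>r. r *\<^sub>R u)) (at a)"
          by (auto intro!: derivative_eq_intros)
        from has_derivative_compose[OF this df[OF B[OF a that]]]
        have "((\<lambda>a. f (x + a *\<^sub>R u + b *\<^sub>R w)) has_derivative (\<lambda>r. ?d (x + a *\<^sub>R u + b *\<^sub>R w) (r *\<^sub>R u))) (at a)" .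
        moreover have "?d (x + a *\<^sub>R u + b *\<^sub>R w) (r *\<^sub>R u) = ?d (x + a *\<^sub>R u + b *\<^sub>R w) u * r" for r
          using linear_scale[OF has_derivative_linear[OF df[OF B[OF a that]]]] by simp
        ultimately show ?thesis by (simp add: has_field_derivative_def)
      qed
      show ?thesis
        unfolding G_def using 1[of h] 1[of 0] h by (intro DERIV_diff) auto
    qed
    obtain a where a: "0 < a" "a < h" "G h - G 0 = (h - 0) * (?d (x + a *\<^sub>R u + h *\<^sub>R w) u - ?d (x + a *\<^sub>R u) u)"
      using MVT2[OF h dG] by auto
    have dH: "((\<lambda>b. ?d (x + a *\<^sub>R u + b *\<^sub>R w) u) has_real_derivative ?dd u w (x + a *\<^sub>R u + b *\<^sub>R w)) (at b)"
      if b: "0 \<le> b" "b \<le> h" for b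
    proof -
      have aS: "x + a *\<^sub>R u + b *\<^sub>R w \<in> S" using a b by (intro B) auto
      have "((\<lambda>b. x + a *\<^sub>R u + b *\<^sub>R w) has_derivative (\<lambda>r. r *\<^sub>R w)) (at b)"
        by (auto intro!: derivative_eq_intros)
      from has_derivative_compose[OF this ddf[OF aS]]
      have "((\<lambda>b. ?d (x + a *\<^sub>R u + b *\<^sub>R w) u) has_derivative (\<lambda>r. ?dd u (r *\<^sub>R w) (x + a *\<^sub>R u + b *\<^sub>R w))) (at b)" .
      moreover have "?dd u (r *\<^sub>R w) (x + a *\<^sub>R u + b *\<^sub>R w) = ?dd u w (x + a *\<^sub>R u + b *\<^sub>R w) * r" for r
        using linear_scale[OF has_derivative_linear[OF ddf[OF aS]]] by simp
      ultimately show ?thesis by (simp add: has_field_derivative_def)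
    qed
    obtain b where b: "0 < b" "b < h" "?d (x + a *\<^sub>R u + h *\<^sub>R w) u - ?d (x + a *\<^sub>R u + 0 *\<^sub>R w) u = (h - 0) * ?dd u w (x + a *\<^sub>R u + b *\<^sub>R w)"
      using MVT2[OF h dH] by auto
    show ?thesis
      using a b unfolding G_def by (intro exI[of _ a] exI[of _ b]) (auto simp: algebra_simps)
  qed
  obtain r where r: "r > 0" "ball x r \<subseteq> S" using S openE by blast
  define m where "m = norm u + norm w + 1"
  have m: "m > 0" unfolding m_def by (smt (verit) norm_ge_zero)
  have near: "dist (x + a *\<^sub>R u + b *\<^sub>R w) x \<le> h * m" if "0 \<le> a" "a \<le> h" "0 \<le> b" "b \<le> h" for a b h
  proof -
    have "norm (a *\<^sub>R u + b *\<^sub>R w) \<le> a * norm u + b * norm w"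
      using norm_triangle_ineq[of "a *\<^sub>R u" "b *\<^sub>R w"] that by simp
    also have "\<dots> \<le> h * norm u + h * norm w" using that by (intro add_mono mult_right_mono) auto
    also have "\<dots> \<le> h * m" unfolding m_def using that by (simp add: algebra_simps)
    finally show ?thesis by (simp add: dist_norm algebra_simps)
  qed
  have "\<bar>?dd u w x - ?dd w u x\<bar> \<le> e" if e: "e > 0" for e
  proof -
    obtain d1 where d1: "d1 > 0" "\<And>y. dist y x < d1 \<Longrightarrow> dist (?dd u w y) (?dd u w x) < e/2"
      using cont[of u w] e unfolding continuous_at_eps_delta by (meson half_gt_zero)
    obtain d2 where d2: "d2 > 0" "\<And>y. dist y x < d2 \<Longrightarrow> dist (?dd w u y) (?dd w u x) < e/2"
      using cont[of w u] e unfolding continuous_at_eps_delta by (meson half_gt_zero)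
    \<comment> \<open>\<open>m\<close> bounds the displacement per unit of \<open>h\<close>, so this
      \<open>h\<close> keeps the parallelogram inside the ball of radius \<open>r\<close> and inside
      both continuity neighbourhoods; the 2 makes the inequalities strict.\<close>
    define h where "h = min r (min d1 d2) / (2 * m)"
    have h: "h > 0" using r d1 d2 m by (simp add: h_def)
    have hm: "h * m < r" "h * m < d1" "h * m < d2" using r d1 d2 m by (auto simp: h_def min_def)
    have S1: "x + a *\<^sub>R u + b *\<^sub>R w \<in> S" if "0 \<le> a" "a \<le> h" "0 \<le> b" "b \<le> h" for a b
      using near[OF that] hm r by (auto simp: subset_iff dist_commute)
    then have S2: "x + b *\<^sub>R w + a *\<^sub>R u \<in> S" if "0 \<le> b" "b \<le> h" "0 \<le> a" "a \<le> h" for a b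
      using that by (simp add: add.assoc add.commute[of "b *\<^sub>R w"])
    obtain a b where ab: "0 < a" "a < h" "0 < b" "b < h"
      "f (x + h *\<^sub>R u + h *\<^sub>R w) - f (x + h *\<^sub>R u) - f (x + h *\<^sub>R w) + f x = h * h * ?dd u w (x + a *\<^sub>R u + b *\<^sub>R w)"
      using key[OF h S1] by auto
    obtain b' a' where ab': "0 < b'" "b' < h" "0 < a'" "a' < h"
      "f (x + h *\<^sub>R w + h *\<^sub>R u) - f (x + h *\<^sub>R w) - f (x + h *\<^sub>R u) + f x = h * h * ?dd w u (x + b' *\<^sub>R w + a' *\<^sub>R u)"
      using key[OF h S2] by auto
    have sw: "x + s *\<^sub>R w + t *\<^sub>R u = x + t *\<^sub>R u + s *\<^sub>R w" for s t by simp
    have "h * h * ?dd u w (x + a *\<^sub>R u + b *\<^sub>R w) = h * h * ?dd w u (x + a' *\<^sub>R u + b' *\<^sub>R w)"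
      using ab(5) ab'(5) unfolding sw by linarith
    then have "?dd u w (x + a *\<^sub>R u + b *\<^sub>R w) = ?dd w u (x + a' *\<^sub>R u + b' *\<^sub>R w)" using h by simp
    moreover have "dist (?dd u w (x + a *\<^sub>R u + b *\<^sub>R w)) (?dd u w x) < e/2"
      using near[of a h b] ab hm by (intro d1) auto
    moreover have "dist (?dd w u (x + a' *\<^sub>R u + b' *\<^sub>R w)) (?dd w u x) < e/2"
      using near[of a' h b'] ab' hm by (intro d2) auto
    ultimately show ?thesis unfolding dist_real_def by linarith
  qed
  then have "\<bar>?dd u w x - ?dd w u x\<bar> \<le> 0"
    using field_le_epsilon[of "\<bar>?dd u w x - ?dd w u x\<bar>" 0] by simp
  then show ?thesis by simp
qed

section \<open>Smoothness by local extension\<close>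

lemma smooth_on_cong: "(\<And>x. x \<in> S \<Longrightarrow> f x = g x) \<Longrightarrow> smooth_on S f \<longleftrightarrow> smooth_on S g"
  unfolding smooth_on_def by simp

lemma smooth_on_subset: "smooth_on S f \<Longrightarrow> T \<subseteq> S \<Longrightarrow> smooth_on T f"
  unfolding smooth_on_def
proof
  fix x assume *: "\<forall>x\<in>S. \<exists>U h. open U \<and> x \<in> U \<and> (\<forall>k. Ck_on k U h) \<and> (\<forall>y\<in>S \<inter> U. h y = f y)"
    "T \<subseteq> S" "x \<in> T"
  then have "x \<in> S" by auto
  from bspec[OF *(1) this] obtain U h where
    "open U" "x \<in> U" "\<forall>k. Ck_on k U h" "\<forall>y\<in>S \<inter> U. h y = f y"
    by (elim exE conjE)
  with *(2) show "\<exists>U h. open U \<and> x \<in> U \<and> (\<forall>k. Ck_on k U h) \<and> (\<forall>y\<in>T \<inter> U. h y = f y)"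
    by (intro exI[of _ U] exI[of _ h]) auto
qed

lemma smooth_onE:
  assumes "smooth_on S f" "x \<in> S"
  obtains U h where "open U" "x \<in> U" "\<And>k. Ck_on k U h" "\<And>y. y \<in> S \<Longrightarrow> y \<in> U \<Longrightarrow> h y = f y"
proof -
  from bspec[OF assms(1)[unfolded smooth_on_def] assms(2)] obtain U h where
    "open U" "x \<in> U" "\<forall>k. Ck_on k U h" "\<forall>y\<in>S \<inter> U. h y = f y"
    by (elim exE conjE)
  then show thesis by (intro that[of U h]) auto
qed

lemma smooth_onI:
  assumes "\<And>x. x \<in> S \<Longrightarrow> \<exists>U h. open U \<and> x \<in> U \<and> (\<forall>k. Ck_on k U h) \<and> (\<forall>y\<in>S \<inter> U. h y = f y)"
  shows "smooth_on S f"
  using assms unfolding smooth_on_def by (rule ballI)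

lemma smooth_on_local:
  assumes "\<And>x. x \<in> S \<Longrightarrow> \<exists>U. open U \<and> x \<in> U \<and> smooth_on (S \<inter> U) f"
  shows "smooth_on S f"
proof (rule smooth_onI)
  fix x assume x: "x \<in> S"
  with assms obtain U where U: "open U" "x \<in> U" "smooth_on (S \<inter> U) f" by blast
  obtain V h where V: "open V" "x \<in> V" "\<And>k. Ck_on k V h" "\<And>y. y \<in> S \<inter> U \<Longrightarrow> y \<in> V \<Longrightarrow> h y = f y"
    using smooth_onE[OF U(3), of x] x U by blast
  have "\<forall>k. Ck_on k (U \<inter> V) h" using Ck_on_subset[OF V(3)] by simp
  then show "\<exists>U h. open U \<and> x \<in> U \<and> (\<forall>k. Ck_on k U h) \<and> (\<forall>y\<in>S \<inter> U. h y = f y)"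
    using U V by (intro exI[of _ "U \<inter> V"] exI[of _ h]) auto
qed

lemma smooth_on_openI: "open S \<Longrightarrow> (\<And>k. Ck_on k S f) \<Longrightarrow> smooth_on S f"
  by (rule smooth_onI) blast

lemma smooth_on_const: "smooth_on S (\<lambda>x. c)"
  using smooth_on_subset[OF smooth_on_openI[OF open_UNIV Ck_on_const]] by blast

lemma smooth_on_bounded_linear: "bounded_linear f \<Longrightarrow> smooth_on S f"
  using smooth_on_subset[OF smooth_on_openI[OF open_UNIV Ck_on_bounded_linear]] by blast

lemma (in bounded_bilinear) smooth_on_bilinear:
  assumes "smooth_on S f" "smooth_on S g"
  shows "smooth_on S (\<lambda>x. prod (f x) (g x))"
proof (rule smooth_onI)
  fix x assume x: "x \<in> S"
  obtain U h where U: "open U" "x \<in> U" "\<And>k. Ck_on k U h" "\<And>y. y \<in> S \<Longrightarrow> y \<in> U \<Longrightarrow> h y = f y"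
    by (rule smooth_onE[OF assms(1) x]) (rule that)
  obtain V k where V: "open V" "x \<in> V" "\<And>j. Ck_on j V k" "\<And>y. y \<in> S \<Longrightarrow> y \<in> V \<Longrightarrow> k y = g y"
    by (rule smooth_onE[OF assms(2) x]) (rule that)
  have "Ck_on j (U \<inter> V) (\<lambda>y. prod (h y) (k y))" for j
    by (rule Ck_on_bilinear) (use U V in \<open>auto intro: Ck_on_subset\<close>)
  then show "\<exists>U h. open U \<and> x \<in> U \<and> (\<forall>k. Ck_on k U h) \<and> (\<forall>y\<in>S \<inter> U. h y = prod (f y) (g y))"
    using U V by (intro exI[of _ "U \<inter> V"] exI[of _ "\<lambda>y. prod (h y) (k y)"]) auto
qed

lemma smooth_on_add:
  assumes "smooth_on S f" "smooth_on S g"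
  shows "smooth_on S (\<lambda>x. f x + g x)"
proof (rule smooth_onI)
  fix x assume x: "x \<in> S"
  obtain U h where U: "open U" "x \<in> U" "\<And>k. Ck_on k U h" "\<And>y. y \<in> S \<Longrightarrow> y \<in> U \<Longrightarrow> h y = f y"
    by (rule smooth_onE[OF assms(1) x]) (rule that)
  obtain V k where V: "open V" "x \<in> V" "\<And>j. Ck_on j V k" "\<And>y. y \<in> S \<Longrightarrow> y \<in> V \<Longrightarrow> k y = g y"
    by (rule smooth_onE[OF assms(2) x]) (rule that)
  have "Ck_on j (U \<inter> V) (\<lambda>y. h y + k y)" for j
    by (rule Ck_on_add) (use U V in \<open>auto intro: Ck_on_subset\<close>)
  then show "\<exists>U h. open U \<and> x \<in> U \<and> (\<forall>k. Ck_on k U h) \<and> (\<forall>y\<in>S \<inter> U. h y = f y + g y)"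
    using U V by (intro exI[of _ "U \<inter> V"] exI[of _ "\<lambda>y. h y + k y"]) auto
qed

lemma smooth_on_sum:
  "(\<And>i. i \<in> I \<Longrightarrow> smooth_on S (f i)) \<Longrightarrow> smooth_on S (\<lambda>x. \<Sum>i\<in>I. f i x)"
  by (induction I rule: infinite_finite_induct) (auto intro: smooth_on_add smooth_on_const)

lemma smooth_on_compose:
  fixes g :: "'a::euclidean_space \<Rightarrow> 'b::euclidean_space" and f :: "'b \<Rightarrow> 'c::real_normed_vector"
  assumes "smooth_on T f" "smooth_on S g" "g ` S \<subseteq> T"
  shows "smooth_on S (\<lambda>x. f (g x))"
proof (rule smooth_onI)
  fix x assume x: "x \<in> S"
  obtain U h where U: "open U" "x \<in> U" "\<And>k. Ck_on k U h" "\<And>y. y \<in> S \<Longrightarrow> y \<in> U \<Longrightarrow> h y = g y"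
    by (rule smooth_onE[OF assms(2) x]) (rule that)
  obtain V k where V: "open V" "g x \<in> V" "\<And>j. Ck_on j V k" "\<And>y. y \<in> T \<Longrightarrow> y \<in> V \<Longrightarrow> k y = f y"
    by (rule smooth_onE[OF assms(1), of "g x"]) (use x assms(3) in auto)
  have "continuous_on U h" using U(3)[of 0] by simp
  then have O: "open (U \<inter> h -` V)" using U(1) V(1) by (simp add: continuous_on_open_vimage Int_commute)
  have "Ck_on j (U \<inter> h -` V) (\<lambda>y. k (h y))" for j
    by (rule Ck_on_compose[OF O V(1)]) (use U V in \<open>auto intro: Ck_on_subset\<close>)
  then show "\<exists>U h. open U \<and> x \<in> U \<and> (\<forall>k. Ck_on k U h) \<and> (\<forall>y\<in>S \<inter> U. h y = f (g y))"
    using U V O x assms(3) by (intro exI[of _ "U \<inter> h -` V"] exI[of _ "\<lambda>y. k (h y)"]) auto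
qed

lemma smooth_on_compose_linear:
  fixes g :: "'a::euclidean_space \<Rightarrow> 'b::euclidean_space" and f :: "'b \<Rightarrow> 'c::real_normed_vector"
  assumes "linear f" "smooth_on S g"
  shows "smooth_on S (\<lambda>x. f (g x))"
  by (rule smooth_on_compose[of UNIV])
    (use assms in \<open>auto intro: smooth_on_bounded_linear simp: linear_conv_bounded_linear\<close>)

lemma smooth_on_inverse: "smooth_on S f \<Longrightarrow> (\<And>x. x \<in> S \<Longrightarrow> f x > (0::real)) \<Longrightarrow> smooth_on S (\<lambda>x. inverse (f x))"
  by (rule smooth_on_compose[OF smooth_on_openI[OF open_greaterThan Ck_on_inverse]]) auto

lemma smooth_on_imp_continuous_on: 
  assumes "smooth_on S f" shows "continuous_on S f"
proof (rule continuous_on_eq_continuous_within[THEN iffD2], rule)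
  fix x assume x: "x \<in> S"
  obtain U h where U: "open U" "x \<in> U" "\<And>k. Ck_on k U h" "\<And>y. y \<in> S \<Longrightarrow> y \<in> U \<Longrightarrow> h y = f y"
    by (rule smooth_onE[OF assms x]) (rule that)
  have "isCont h x" using U(1,2) U(3)[of 0] by (auto simp: continuous_on_eq_continuous_at)
  then have "continuous (at x within S) h" by (rule continuous_at_imp_continuous_at_within)
  then have "(h \<longlongrightarrow> h x) (at x within S)" by (simp add: continuous_within)
  moreover have "\<forall>\<^sub>F y in at x within S. h y = f y"
    using U by (auto simp: eventually_at_topological)
  ultimately have "(f \<longlongrightarrow> h x) (at x within S)" by (rule Lim_transform_eventually)
  then show "continuous (at x within S) f" using U(2,4) x by (simp add: continuous_within)
qed

section \<open>Derivatives on relatively open subsets of the half-space\<close>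

abbreviation half_open :: "(real^4) set \<Rightarrow> bool" where
  "half_open S \<equiv> openin (top_of_set half_space) S"

lemma half_open_Int: "half_open S \<Longrightarrow> open U \<Longrightarrow> half_open (S \<inter> U)"
  by (simp add: openin_Int_open)

text \<open>At a boundary point only one-sided increments are available, but
  \<open>frechet_derivative_unique_within\<close> merely asks for small multiples of each basis
  vector that stay in the set.\<close>

lemma half_open_derivative_unique:
  assumes S: "half_open S" "x \<in> S"
    and "(f has_derivative f') (at x within S)" "(f has_derivative f'') (at x within S)"
  shows "f' = f''"
proof (rule frechet_derivative_unique_within[OF assms(3,4)])
  fix i :: "real^4" and e :: real
  assume i: "i \<in> Basis" and e: "e > 0"
  obtain O' where O: "open O'" "S = half_space \<inter> O'" using S(1) unfolding openin_open by blast
  obtain r where r: "r > 0" "ball x r \<subseteq> O'" using O S(2) openE by blast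
  define d where "d = min e r / 2"
  have d: "0 < d" "d < e" "d < r" using e r by (auto simp: d_def min_def)
  \<comment> \<open>No standard basis vector has a negative 0-th coordinate, so positive steps along
    it never leave the half-space.\<close>
  have "i $ 0 \<ge> 0" using i by (auto simp: Basis_vec_def axis_def)
  then have "x + d *\<^sub>R i \<in> half_space" using S(2) O d by (auto simp: half_space_def)
  moreover have "x + d *\<^sub>R i \<in> ball x r" using d i by (simp add: dist_norm)
  ultimately show "\<exists>d. 0 < \<bar>d\<bar> \<and> \<bar>d\<bar> < e \<and> x + d *\<^sub>R i \<in> S"
    using d O r by (intro exI[of _ d]) auto
qed

lemma half_open_frechet_derivative:
  assumes "half_open S" "x \<in> S" "(f has_derivative f') (at x within S)"
  shows "frechet_derivative f (at x within S) = f'"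
proof (rule half_open_derivative_unique[OF assms(1,2) _ assms(3)])
  show "(f has_derivative frechet_derivative f (at x within S)) (at x within S)"
    using differentiableI[OF assms(3)] by (simp add: frechet_derivative_works)
qed

lemma has_derivative_transform_nbhd:
  assumes "(f has_derivative D) (at x within S)" "open U" "x \<in> U" "x \<in> S"
    and "\<And>y. y \<in> S \<Longrightarrow> y \<in> U \<Longrightarrow> f y = g y"
  shows "(g has_derivative D) (at x within S)"
  by (rule has_derivative_transform_eventually[OF assms(1)])
    (use assms in \<open>auto simp: eventually_at_topological\<close>)

text \<open>By uniqueness, the one-sided derivative is that of any smooth extension. This carries
  the calculus of open sets, in particular the symmetry of second derivatives, over to boundary
  points.\<close>

lemma smooth_on_extension:
  assumes "smooth_on S f" "half_open S" "x \<in> S"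
  obtains U h where "open U" "x \<in> U" "\<And>k. Ck_on k U h" "\<And>y. y \<in> S \<inter> U \<Longrightarrow> h y = f y"
    "\<And>y. y \<in> S \<inter> U \<Longrightarrow> (f has_derivative frechet_derivative h (at y)) (at y within S)"
    "\<And>y. y \<in> S \<inter> U \<Longrightarrow> frechet_derivative f (at y within S) = frechet_derivative h (at y)"
proof -
  obtain U h where U: "open U" "x \<in> U" "\<And>k. Ck_on k U h" "\<And>y. y \<in> S \<Longrightarrow> y \<in> U \<Longrightarrow> h y = f y"
    by (rule smooth_onE[OF assms(1,3)]) (rule that)
  have "(f has_derivative frechet_derivative h (at y)) (at y within S)" if y: "y \<in> S \<inter> U" for y
  proof -
    have "(h has_derivative frechet_derivative h (at y)) (at y)"
      by (rule Ck_on_Suc_derivative[OF U(1) U(3)]) (use y in simp)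
    then have "(h has_derivative frechet_derivative h (at y)) (at y within S)"
      by (rule has_derivative_at_withinI)
    then show ?thesis
      by (rule has_derivative_transform_nbhd[OF _ U(1)]) (use y U(4) in simp_all)
  qed
  note D = this
  have "frechet_derivative f (at y within S) = frechet_derivative h (at y)" if "y \<in> S \<inter> U" for y
    by (rule half_open_frechet_derivative[OF assms(2) _ D[OF that]]) (use that in simp)
  moreover have "h y = f y" if "y \<in> S \<inter> U" for y
    using U(4) that by simp
  ultimately show thesis by (intro that[OF U(1-3) _ D])
qed

lemma smooth_on_derivative_extension:
  assumes "smooth_on S f" "half_open S" "x \<in> S"
  obtains U h where "open U" "x \<in> U" "\<And>k. Ck_on k U h"
    "\<And>y. y \<in> S \<inter> U \<Longrightarrow> frechet_derivative f (at y within S) = frechet_derivative h (at y)"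
proof (rule smooth_on_extension[OF assms])
  fix U h
  assume "open U" "x \<in> U" "\<And>k. Ck_on k U h"
    "\<And>y. y \<in> S \<inter> U \<Longrightarrow> frechet_derivative f (at y within S) = frechet_derivative h (at y)"
  then show thesis by (rule that)
qed

lemma smooth_on_has_derivative:
  assumes "smooth_on S f" "half_open S" "x \<in> S"
  shows "(f has_derivative frechet_derivative f (at x within S)) (at x within S)"
proof (rule smooth_on_extension[OF assms])
  fix U h
  assume "x \<in> U" "\<And>y. y \<in> S \<inter> U \<Longrightarrow> (f has_derivative frechet_derivative h (at y)) (at y within S)"
    "\<And>y. y \<in> S \<inter> U \<Longrightarrow> frechet_derivative f (at y within S) = frechet_derivative h (at y)"
  then show ?thesis using assms(3) by simp
qed

lemma smooth_on_frechet_derivative: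
  assumes "smooth_on S f" "half_open S"
  shows "smooth_on S (\<lambda>x. frechet_derivative f (at x within S) v)"
proof (rule smooth_onI)
  fix x assume "x \<in> S"
  obtain U h where U: "open U" "x \<in> U" "\<And>k. Ck_on k U h"
    "\<And>y. y \<in> S \<inter> U \<Longrightarrow> frechet_derivative f (at y within S) = frechet_derivative h (at y)"
    by (rule smooth_on_derivative_extension[OF assms \<open>x \<in> S\<close>]) (rule that)
  have "Ck_on k U (\<lambda>y. frechet_derivative h (at y) v)" for k
    using U(3)[of "Suc k"] by simp
  then show "\<exists>U h. open U \<and> x \<in> U \<and> (\<forall>k. Ck_on k U h) \<and> (\<forall>y\<in>S \<inter> U. h y = frechet_derivative f (at y within S) v)"
    using U by (intro exI[of _ U] exI[of _ "\<lambda>y. frechet_derivative h (at y) v"]) auto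
qed

lemma linear_Basis_expand:
  fixes f :: "'a::euclidean_space \<Rightarrow> 'b::real_vector"
  assumes "linear f" shows "f w = (\<Sum>b\<in>Basis. (w \<bullet> b) *\<^sub>R f b)"
  using linear_sum[OF assms, of "\<lambda>b. (w \<bullet> b) *\<^sub>R b" Basis]
  by (simp add: linear_scale[OF assms] euclidean_representation)

lemma smooth_on_derivative_along:
  assumes "smooth_on S f" "half_open S" "smooth_on S W"
  shows "smooth_on S (\<lambda>x. frechet_derivative f (at x within S) (W x))"
proof -
  have "smooth_on S (\<lambda>x. \<Sum>b\<in>Basis. (W x \<bullet> b) *\<^sub>R frechet_derivative f (at x within S) b)"
    by (intro smooth_on_sum bounded_bilinear.smooth_on_bilinear[OF bounded_bilinear_scaleR]
        bounded_bilinear.smooth_on_bilinear[OF bounded_bilinear_inner] smooth_on_const assms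
        smooth_on_frechet_derivative)
  moreover have "frechet_derivative f (at x within S) (W x) =
      (\<Sum>b\<in>Basis. (W x \<bullet> b) *\<^sub>R frechet_derivative f (at x within S) b)" if "x \<in> S" for x
    by (rule linear_Basis_expand[OF has_derivative_linear[OF smooth_on_has_derivative[OF assms(1,2) that]]])
  ultimately show ?thesis by (simp cong: smooth_on_cong)
qed

lemma second_derivative_symmetric:
  fixes f :: "'a::euclidean_space \<Rightarrow> 'b::euclidean_space"
  assumes S: "open S" "\<And>k. Ck_on k S f" "x \<in> S"
  shows "frechet_derivative (\<lambda>y. frechet_derivative f (at y) u) (at x) w =
         frechet_derivative (\<lambda>y. frechet_derivative f (at y) w) (at x) u"
proof (rule euclidean_eqI)
  fix b :: 'b assume "b \<in> Basis"
  let ?f = "\<lambda>y. f y \<bullet> b"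
  have df: "(f has_derivative frechet_derivative f (at y)) (at y)" if "y \<in> S" for y
    by (rule Ck_on_Suc_derivative[OF S(1,2) that])
  have Ck': "Ck_on k S (\<lambda>y. frechet_derivative f (at y) u)" for k u
    using S(2)[of "Suc k"] by simp
  have ddf: "((\<lambda>y. frechet_derivative f (at y) u) has_derivative frechet_derivative (\<lambda>y. frechet_derivative f (at y) u) (at x)) (at x)" for u
    by (rule Ck_on_Suc_derivative[OF S(1) Ck' S(3)])
  have 1: "frechet_derivative ?f (at y) u = frechet_derivative f (at y) u \<bullet> b" if "y \<in> S" for y u
    using frechet_derivative_at[OF has_derivative_inner_left[OF df[OF that], of b]] by metis
  have 2: "frechet_derivative (\<lambda>y. frechet_derivative ?f (at y) u) (at x) w =
    frechet_derivative (\<lambda>y. frechet_derivative f (at y) u) (at x) w \<bullet> b" for u w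
  proof -
    have "((\<lambda>y. frechet_derivative f (at y) u \<bullet> b) has_derivative
        (\<lambda>w. frechet_derivative (\<lambda>y. frechet_derivative f (at y) u) (at x) w \<bullet> b)) (at x)"
      by (rule has_derivative_inner_left[OF ddf])
    then have "((\<lambda>y. frechet_derivative ?f (at y) u) has_derivative
        (\<lambda>w. frechet_derivative (\<lambda>y. frechet_derivative f (at y) u) (at x) w \<bullet> b)) (at x)"
      by (rule has_derivative_transform_within_open[OF _ S(1,3)]) (simp add: 1)
    then show ?thesis using frechet_derivative_at by metis
  qed
  have "Ck_on 2 S ?f"
    by (intro bounded_bilinear.Ck_on_bilinear[OF bounded_bilinear_inner] S Ck_on_const)
  from second_derivative_symmetric_real[OF S(1) this S(3), of u w]
  show "frechet_derivative (\<lambda>y. frechet_derivative f (at y) u) (at x) w \<bullet> b =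
         frechet_derivative (\<lambda>y. frechet_derivative f (at y) w) (at x) u \<bullet> b"
    unfolding 2 .
qed

abbreviation deriv_in :: "(real^4) set \<Rightarrow> (real^4 \<Rightarrow> 'b::real_normed_vector) \<Rightarrow> real^4 \<Rightarrow> real^4 \<Rightarrow> 'b" where
  "deriv_in S f x v \<equiv> frechet_derivative f (at x within S) v"

text \<open>The product rule yields second derivatives of \<open>f\<close> on (V, W) and on (W, V).
  These cancel by symmetry, and the derivatives of \<open>V\<close> and \<open>W\<close> form the
  coordinate Lie bracket.\<close>

lemma derivative_commutator:
  fixes f :: "real^4 \<Rightarrow> 'b::euclidean_space"
  assumes S: "half_open S" "x \<in> S" and f: "smooth_on S f" and V: "smooth_on S V" and W: "smooth_on S W"
  shows "deriv_in S (\<lambda>y. deriv_in S f y (W y)) x (V x) - deriv_in S (\<lambda>y. deriv_in S f y (V y)) x (W x) = deriv_in S f x (deriv_in S W x (V x) - deriv_in S V x (W x))"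
proof -
  obtain U h where U: "open U" "x \<in> U" "\<And>k. Ck_on k U h"
    "\<And>y. y \<in> S \<inter> U \<Longrightarrow> frechet_derivative f (at y within S) = frechet_derivative h (at y)"
    by (rule smooth_on_derivative_extension[OF f S]) (rule that)
  let ?D = "\<lambda>y v. frechet_derivative h (at y) v"
  let ?DD = "\<lambda>u v. frechet_derivative (\<lambda>y. ?D y u) (at x) v"
  have dh: "(h has_derivative ?D y) (at y)" if "y \<in> U" for y
    by (rule Ck_on_Suc_derivative[OF U(1) U(3) that])
  have Ck': "Ck_on k U (\<lambda>y. ?D y u)" for k u
    using U(3)[of "Suc k"] by simp
  have ddh: "((\<lambda>y. ?D y u) has_derivative ?DD u) (at x)" for u
    by (rule Ck_on_Suc_derivative[OF U(1) Ck' U(2)])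
  \<comment> \<open>Linearity of \<open>?DD\<close> in the direction differentiated last is
    automatic; symmetry transfers it to the other one.\<close>
  have DDl: "?DD w v = (\<Sum>b\<in>Basis. (w \<bullet> b) *\<^sub>R ?DD b v)" for v w
  proof -
    have "?DD w v = ?DD v w" by (rule second_derivative_symmetric[OF U(1,3,2)])
    also have "\<dots> = (\<Sum>b\<in>Basis. (w \<bullet> b) *\<^sub>R ?DD v b)"
      by (rule linear_Basis_expand[OF has_derivative_linear[OF ddh]])
    also have "\<dots> = (\<Sum>b\<in>Basis. (w \<bullet> b) *\<^sub>R ?DD b v)"
      by (intro sum.cong refl arg_cong[where f="scaleR _"] second_derivative_symmetric[OF U(1,3,2)])
    finally show ?thesis .
  qed
  have main: "deriv_in S (\<lambda>y. deriv_in S f y (W y)) x v = deriv_in S f x (deriv_in S W x v) + ?DD (W x) v" if W: "smooth_on S W" for W v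
  proof -
    have dW: "(W has_derivative deriv_in S W x) (at x within S)"
      by (rule smooth_on_has_derivative[OF W S])
    have "((\<lambda>y. \<Sum>b\<in>Basis. (W y \<bullet> b) *\<^sub>R ?D y b) has_derivative
       (\<lambda>v. \<Sum>b\<in>Basis. (W x \<bullet> b) *\<^sub>R ?DD b v + (deriv_in S W x v \<bullet> b) *\<^sub>R ?D x b)) (at x within S)"
      by (intro has_derivative_sum has_derivative_scaleR has_derivative_inner_left dW has_derivative_at_withinI[OF ddh])
    then have "((\<lambda>y. deriv_in S f y (W y)) has_derivative
       (\<lambda>v. \<Sum>b\<in>Basis. (W x \<bullet> b) *\<^sub>R ?DD b v + (deriv_in S W x v \<bullet> b) *\<^sub>R ?D x b)) (at x within S)"
      by (rule has_derivative_transform_nbhd[OF _ U(1,2) S(2)])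
       (simp add: U(4) linear_Basis_expand[OF has_derivative_linear[OF dh], symmetric])
    then have "deriv_in S (\<lambda>y. deriv_in S f y (W y)) x v = (\<Sum>b\<in>Basis. (W x \<bullet> b) *\<^sub>R ?DD b v + (deriv_in S W x v \<bullet> b) *\<^sub>R ?D x b)"
      by (simp add: half_open_frechet_derivative[OF S])
    also have "\<dots> = ?DD (W x) v + ?D x (deriv_in S W x v)"
      by (simp only: sum.distrib DDl[of "W x"]
          linear_Basis_expand[OF has_derivative_linear[OF dh[OF U(2)]], of "deriv_in S W x v"])
    finally show ?thesis using U(2,4) S(2) by simp
  qed
  have "linear (deriv_in S f x)" using has_derivative_linear[OF dh[OF U(2)]] U(2,4) S(2) by simp
  moreover have "?DD (W x) (V x) = ?DD (V x) (W x)"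
    by (rule second_derivative_symmetric[OF U(1,3,2)])
  ultimately show ?thesis
    by (simp add: main[OF V] main[OF W] linear_diff)
qed

lemma deriv_in_cong:
  assumes "x \<in> S" "\<And>y. y \<in> S \<Longrightarrow> f y = g y"
  shows "deriv_in S f x = deriv_in S g x"
proof -
  have "(f has_derivative D) (at x within S) \<longleftrightarrow> (g has_derivative D) (at x within S)" for D
    using has_derivative_transform[OF assms(1), of f g D] has_derivative_transform[OF assms(1), of g f D] assms(2)
    by auto
  then show ?thesis by (simp add: frechet_derivative_def)
qed

section \<open>Charts and tangential derivatives\<close>

locale atlas =
  fixes M :: "'m::t2_space chart set"
  assumes oriented_atlas: "oriented_atlas M"
begin

lemma chart_cover: "\<exists>U \<phi>. (U, \<phi>) \<in> M \<and> p \<in> U"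
proof -
  have "p \<in> (\<Union>(U, \<phi>)\<in>M. U)" using oriented_atlas by (simp add: oriented_atlas_def)
  then show ?thesis by auto
qed

lemma
  assumes "(U, \<phi>) \<in> M"
  shows chart_open: "open U"
    and chart_half_open_image: "half_open (\<phi> ` U)"
    and chart_homeomorphism: "homeomorphism U (\<phi> ` U) \<phi> (inv_into U \<phi>)"
  using oriented_atlas assms unfolding oriented_atlas_def by (auto dest!: bspec)

lemma
  assumes "(U, \<phi>) \<in> M"
  shows chart_inj: "inj_on \<phi> U" and chart_continuous: "continuous_on U \<phi>"
    and chart_inv: "p \<in> U \<Longrightarrow> inv_into U \<phi> (\<phi> p) = p"
    and chart_inv_continuous: "continuous_on (\<phi> ` U) (inv_into U \<phi>)"
proof -
  have h: "homeomorphism U (\<phi> ` U) \<phi> (inv_into U \<phi>)" by (rule chart_homeomorphism[OF assms])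
  show "continuous_on U \<phi>" "p \<in> U \<Longrightarrow> inv_into U \<phi> (\<phi> p) = p" "continuous_on (\<phi> ` U) (inv_into U \<phi>)"
    using h by (auto simp: homeomorphism_def)
  show "inj_on \<phi> U" using h by (intro inj_on_inverseI[where g="inv_into U \<phi>"]) (auto simp: homeomorphism_def)
qed

lemma chart_transition:
  assumes "(U, \<phi>) \<in> M" "(U', \<phi>') \<in> M"
  shows "smooth_on (\<phi> ` (U \<inter> U')) (\<phi>' \<circ> inv_into U \<phi>)"
proof -
  have "\<forall>(U, \<phi>)\<in>M. \<forall>(U', \<phi>')\<in>M. smooth_on (\<phi> ` (U \<inter> U')) (\<phi>' \<circ> inv_into U \<phi>)"
    using oriented_atlas unfolding oriented_atlas_def by fast
  from bspec[OF this assms(1)] show ?thesis using assms(2) by fast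
qed

lemma chart_image_open:
  assumes "(U, \<phi>) \<in> M" "open W"
  obtains O' where "open O'" "\<phi> ` (U \<inter> W) = \<phi> ` U \<inter> O'"
proof -
  have "openin (top_of_set (\<phi> ` U)) (\<phi> ` (U \<inter> W))"
    by (rule homeomorphism_imp_open_map[OF chart_homeomorphism[OF assms(1)]]) (use assms(2) in \<open>auto simp: openin_open\<close>)
  then show thesis using that by (auto simp: openin_open)
qed

lemma chart_half_open:
  assumes "(U, \<phi>) \<in> M" "open W"
  shows "half_open (\<phi> ` (U \<inter> W))"
  using chart_image_open[OF assms] chart_half_open_image[OF assms(1)] half_open_Int by metis

lemma smooth_fun_chart: "smooth_fun M W f \<Longrightarrow> (U, \<phi>) \<in> M \<Longrightarrow> smooth_on (\<phi> ` (U \<inter> W)) (f \<circ> inv_into U \<phi>)"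
  unfolding smooth_fun_def by auto

text \<open>\<open>smooth_fun\<close> quantifies over all charts; the smooth transition maps reduce
  it to one chart around each point.\<close>

lemma smooth_fun_chartI:
  assumes "\<And>p. p \<in> W \<Longrightarrow> \<exists>U \<phi> W'. (U, \<phi>) \<in> M \<and> p \<in> U \<and> open W' \<and> p \<in> W' \<and>
    smooth_on (\<phi> ` (U \<inter> (W \<inter> W'))) (f \<circ> inv_into U \<phi>)"
  shows "smooth_fun M W f"
  unfolding smooth_fun_def
proof (clarify)
  fix U2 \<psi> assume c2: "(U2, \<psi>) \<in> M"
  show "smooth_on (\<psi> ` (U2 \<inter> W)) (f \<circ> inv_into U2 \<psi>)"
  proof (rule smooth_on_local)
    fix y assume "y \<in> \<psi> ` (U2 \<inter> W)"
    then obtain p where p: "p \<in> U2" "p \<in> W" "y = \<psi> p" by auto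
    from assms[OF p(2)] obtain U \<phi> W' where c: "(U, \<phi>) \<in> M" "p \<in> U" "open W'" "p \<in> W'"
      "smooth_on (\<phi> ` (U \<inter> (W \<inter> W'))) (f \<circ> inv_into U \<phi>)" by (elim exE conjE)
    have "open (U \<inter> W')" using c chart_open[OF c(1)] by auto
    from chart_image_open[OF c2 this] obtain O' where O': "open O'" "\<psi> ` (U2 \<inter> (U \<inter> W')) = \<psi> ` U2 \<inter> O'" by blast
    have eq: "\<psi> ` (U2 \<inter> W) \<inter> O' = \<psi> ` (W \<inter> (U2 \<inter> (U \<inter> W')))"
    proof -
      have "\<psi> ` (U2 \<inter> W) \<inter> O' = \<psi> ` (U2 \<inter> W) \<inter> \<psi> ` (U2 \<inter> (U \<inter> W'))" unfolding O'(2) by auto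
      also have "\<dots> = \<psi> ` ((U2 \<inter> W) \<inter> (U2 \<inter> (U \<inter> W')))"
        by (rule inj_on_image_Int[symmetric, OF chart_inj[OF c2]]) auto
      finally show ?thesis by (simp add: Int_ac)
    qed
    have "smooth_on (\<psi> ` (W \<inter> (U2 \<inter> (U \<inter> W')))) (\<lambda>z. (f \<circ> inv_into U \<phi>) ((\<phi> \<circ> inv_into U2 \<psi>) z))"
      by (rule smooth_on_compose[OF c(5) smooth_on_subset[OF chart_transition[OF c2 c(1)]]])
        (auto simp: chart_inv[OF c2])
    then have "smooth_on (\<psi> ` (W \<inter> (U2 \<inter> (U \<inter> W')))) (f \<circ> inv_into U2 \<psi>)"
      by (rule smooth_on_cong[THEN iffD1, rotated]) (auto simp: chart_inv[OF c2] chart_inv[OF c(1)])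
    then show "\<exists>U. open U \<and> y \<in> U \<and> smooth_on (\<psi> ` (U2 \<inter> W) \<inter> U) (f \<circ> inv_into U2 \<psi>)"
      using O' p c(2,4) by (intro exI[of _ O']) (auto simp: eq)
  qed
qed

lemma smooth_fun_local:
  assumes "\<And>p. p \<in> W \<Longrightarrow> \<exists>W'. open W' \<and> p \<in> W' \<and> smooth_fun M (W \<inter> W') f"
  shows "smooth_fun M W f"
proof (rule smooth_fun_chartI)
  fix p assume "p \<in> W"
  with assms obtain W' where W': "open W'" "p \<in> W'" "smooth_fun M (W \<inter> W') f" by blast
  obtain U \<phi> where c: "(U, \<phi>) \<in> M" "p \<in> U" using chart_cover by blast
  show "\<exists>U \<phi> W'. (U, \<phi>) \<in> M \<and> p \<in> U \<and> open W' \<and> p \<in> W' \<and>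
    smooth_on (\<phi> ` (U \<inter> (W \<inter> W'))) (f \<circ> inv_into U \<phi>)"
    using c W' smooth_fun_chart[OF W'(3) c(1)] by blast
qed

lemma smooth_funI:
  "(\<And>U \<phi>. (U, \<phi>) \<in> M \<Longrightarrow> smooth_on (\<phi> ` (U \<inter> W)) (\<lambda>y. f (inv_into U \<phi> y))) \<Longrightarrow> smooth_fun M W f"
  unfolding smooth_fun_def comp_def by (auto split: prod.splits)

lemma smooth_funD:
  "smooth_fun M W f \<Longrightarrow> (U, \<phi>) \<in> M \<Longrightarrow> smooth_on (\<phi> ` (U \<inter> W)) (\<lambda>y. f (inv_into U \<phi> y))"
  using smooth_fun_chart unfolding comp_def .

lemma smooth_fun_cong:
  assumes "smooth_fun M W f" "\<And>p. p \<in> W \<Longrightarrow> f p = g p"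
  shows "smooth_fun M W g"
proof (rule smooth_funI)
  fix U \<phi> assume c: "(U, \<phi>) \<in> M"
  show "smooth_on (\<phi> ` (U \<inter> W)) (\<lambda>y. g (inv_into U \<phi> y))"
    by (rule smooth_on_cong[THEN iffD1, OF _ smooth_funD[OF assms(1) c]]) (auto simp: chart_inv[OF c] assms(2))
qed

lemma smooth_fun_subset: "smooth_fun M W f \<Longrightarrow> W' \<subseteq> W \<Longrightarrow> smooth_fun M W' f"
  by (rule smooth_funI, rule smooth_on_subset[OF smooth_funD[of W]]) auto

lemma smooth_fun_const: "smooth_fun M W (\<lambda>p. c)"
  by (intro smooth_funI smooth_on_const)

lemma smooth_fun_add: "smooth_fun M W f \<Longrightarrow> smooth_fun M W h \<Longrightarrow> smooth_fun M W (\<lambda>p. f p + h p)"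
  by (rule smooth_funI, rule smooth_on_add) (erule (1) smooth_funD)+

lemma smooth_fun_bilinear:
  "bounded_bilinear B \<Longrightarrow> smooth_fun M W f \<Longrightarrow> smooth_fun M W h \<Longrightarrow> smooth_fun M W (\<lambda>p. B (f p) (h p))"
  by (rule smooth_funI, erule bounded_bilinear.smooth_on_bilinear) (erule (1) smooth_funD)+

lemmas smooth_fun_scaleR = smooth_fun_bilinear[OF bounded_bilinear_scaleR]
  and smooth_fun_mult = smooth_fun_bilinear[OF bounded_bilinear_mult]
  and smooth_fun_inner = smooth_fun_bilinear[OF bounded_bilinear_inner]

lemma smooth_fun_sum:
  "(\<And>i. i \<in> I \<Longrightarrow> smooth_fun M W (f i)) \<Longrightarrow> smooth_fun M W (\<lambda>x. \<Sum>i\<in>I. f i x)"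
  by (induction I rule: infinite_finite_induct) (auto intro: smooth_fun_add smooth_fun_const)

lemma smooth_fun_linear:
  fixes L :: "'a::euclidean_space \<Rightarrow> 'b::euclidean_space"
  shows "linear L \<Longrightarrow> smooth_fun M W f \<Longrightarrow> smooth_fun M W (\<lambda>p. L (f p))"
  by (rule smooth_funI, erule smooth_on_compose_linear, erule (1) smooth_funD)

lemma smooth_fun_minus: "smooth_fun M W f \<Longrightarrow> smooth_fun M W (\<lambda>p. - f p)"
  using smooth_fun_scaleR[OF smooth_fun_const[of W "-1"]] by simp

lemma smooth_fun_diff: "smooth_fun M W f \<Longrightarrow> smooth_fun M W h \<Longrightarrow> smooth_fun M W (\<lambda>p. f p - h p)"
  using smooth_fun_add[OF _ smooth_fun_minus] by fastforce

lemma smooth_fun_inverse: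
  "smooth_fun M W f \<Longrightarrow> (\<And>p. p \<in> W \<Longrightarrow> f p > (0::real)) \<Longrightarrow> smooth_fun M W (\<lambda>p. inverse (f p))"
  by (rule smooth_funI, rule smooth_on_inverse, erule (1) smooth_funD) (auto simp: chart_inv)

lemma smooth_fun_compose:
  fixes h :: "'a::euclidean_space \<Rightarrow> 'b::real_normed_vector"
  assumes "smooth_on UNIV h" "smooth_fun M W f"
  shows "smooth_fun M W (\<lambda>p. h (f p))"
  by (rule smooth_funI, rule smooth_on_compose[OF assms(1)], rule smooth_funD[OF assms(2)]) auto

lemma smooth_fun_component:
  fixes f :: "'m \<Rightarrow> 'b::euclidean_space"
  assumes "\<And>b. b \<in> Basis \<Longrightarrow> smooth_fun M W (\<lambda>p. f p \<bullet> b)"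
  shows "smooth_fun M W f"
proof -
  have "smooth_fun M W (\<lambda>p. \<Sum>b\<in>Basis. (f p \<bullet> b) *\<^sub>R b)"
    by (intro smooth_fun_sum smooth_fun_scaleR assms smooth_fun_const)
  then show ?thesis by (simp add: euclidean_representation)
qed

lemma smooth_fun_of_chart: "(U, \<phi>) \<in> M \<Longrightarrow> smooth_fun M U \<phi>"
  using chart_transition by (intro smooth_funI) (simp add: comp_def Int_commute)

lemma smooth_fun_continuous:
  assumes "smooth_fun M W f" "open W"
  shows "continuous_on W f"
proof (rule continuous_at_imp_continuous_on, rule)
  fix p assume p: "p \<in> W"
  obtain U \<phi> where c: "(U, \<phi>) \<in> M" "p \<in> U" using chart_cover by blast
  have "continuous_on (U \<inter> W) (\<lambda>q. (f \<circ> inv_into U \<phi>) (\<phi> q))"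
    by (rule continuous_on_compose2[OF smooth_on_imp_continuous_on[OF smooth_fun_chart[OF assms(1) c(1)]]])
      (auto intro: continuous_on_subset[OF chart_continuous[OF c(1)]])
  then have "continuous_on (U \<inter> W) f"
    by (rule continuous_on_eq) (auto simp: chart_inv[OF c(1)])
  then show "isCont f p"
    using p c assms(2) chart_open[OF c(1)] by (simp add: continuous_on_eq_continuous_at[OF open_Int])
qed

section \<open>Tangential derivatives and the chain rule\<close>

lemma chart_at: "chart_at M p \<in> M" "p \<in> fst (chart_at M p)"
proof -
  have "\<exists>c. c \<in> M \<and> p \<in> fst c" using chart_cover[of p] by force
  then have "chart_at M p \<in> M \<and> p \<in> fst (chart_at M p)" unfolding chart_at_def by (rule someI_ex)
  then show "chart_at M p \<in> M" "p \<in> fst (chart_at M p)" by auto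
qed

lemma chart_at_obtain:
  obtains U \<phi> where "chart_at M p = (U, \<phi>)" "(U, \<phi>) \<in> M" "p \<in> U"
  using chart_at[of p] by (metis prod.collapse)

text \<open>\<open>tderiv\<close> picks a derivative by choice; the relation behind it makes the
  rules for \<open>has_derivative\<close> available and is turned into an equation by
  \<open>has_tderiv_imp_tderiv\<close>.\<close>

definition has_tderiv :: "('m \<Rightarrow> 'b::real_normed_vector) \<Rightarrow> (real^4 \<Rightarrow> 'b) \<Rightarrow> 'm \<Rightarrow> bool" where
  "has_tderiv f D p \<longleftrightarrow>
     (let (U, \<phi>) = chart_at M p in ((\<lambda>y. f (inv_into U \<phi> y)) has_derivative D) (at (\<phi> p) within \<phi> ` U))"

lemma has_tderiv_imp_tderiv:
  assumes "has_tderiv f D p" shows "tderiv M f p = D"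
proof -
  obtain U \<phi> where c: "chart_at M p = (U, \<phi>)" "(U, \<phi>) \<in> M" "p \<in> U" by (rule chart_at_obtain)
  show ?thesis
    using half_open_frechet_derivative[OF chart_half_open_image[OF c(2)], of "\<phi> p" "\<lambda>y. f (inv_into U \<phi> y)" D] assms c
    by (auto simp: has_tderiv_def tderiv_def comp_def)
qed

lemma at_chart_nbhd:
  assumes c: "(U, \<phi>) \<in> M" "p \<in> U" and W: "open W" "p \<in> W"
  shows "at (\<phi> p) within \<phi> ` (U \<inter> W) = at (\<phi> p) within \<phi> ` U"
proof -
  obtain O' where O': "open O'" "\<phi> ` (U \<inter> W) = \<phi> ` U \<inter> O'" by (rule chart_image_open[OF c(1) W(1)])
  have "\<phi> p \<in> \<phi> ` (U \<inter> W)" using c W by blast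
  then have "\<phi> p \<in> O'" unfolding O'(2) by simp
  then show ?thesis unfolding O'(2) using O'(1) by (intro at_within_nhd[of _ O']) auto
qed

lemma has_tderiv_iff:
  assumes c: "chart_at M p = (U, \<phi>)" and W: "open W" "p \<in> W"
  shows "has_tderiv f D p \<longleftrightarrow>
    ((\<lambda>y. f (inv_into U \<phi> y)) has_derivative D) (at (\<phi> p) within \<phi> ` (U \<inter> W))"
proof -
  have "(U, \<phi>) \<in> M" "p \<in> U" using chart_at[of p] c by auto
  from at_chart_nbhd[OF this W] show ?thesis by (simp add: has_tderiv_def c)
qed

lemma has_tderiv_cong:
  assumes "open W" "p \<in> W" "\<And>q. q \<in> W \<Longrightarrow> f q = g q"
  shows "has_tderiv f D p \<longleftrightarrow> has_tderiv g D p"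
proof -
  obtain U \<phi> where c: "chart_at M p = (U, \<phi>)" "(U, \<phi>) \<in> M" "p \<in> U" by (rule chart_at_obtain)
  have *: "((\<lambda>y. h (inv_into U \<phi> y)) has_derivative D) (at (\<phi> p) within \<phi> ` (U \<inter> W))"
    if "((\<lambda>y. f (inv_into U \<phi> y)) has_derivative D) (at (\<phi> p) within \<phi> ` (U \<inter> W))"
       "\<And>q. q \<in> W \<Longrightarrow> f q = h q" for f h
    by (rule has_derivative_transform[OF _ _ that(1)]) (use that(2) c assms chart_inv[OF c(2)] in auto)
  show ?thesis
    unfolding has_tderiv_iff[OF c(1) assms(1,2)] using *[of f g] *[of g f] assms(3) by auto
qed

text \<open>Both sides choose from the same predicate, which settles non-differentiable functions as
  well.\<close>

lemma tderiv_cong: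
  fixes f g :: "'m \<Rightarrow> 'b::real_normed_vector"
  assumes "open W" "p \<in> W" "\<And>q. q \<in> W \<Longrightarrow> f q = g q"
  shows "tderiv M f p = tderiv M g p"
proof -
  have "tderiv M f p = (SOME D. has_tderiv f D p)" for f :: "'m \<Rightarrow> 'b"
    by (auto simp: tderiv_def has_tderiv_def frechet_derivative_def comp_def split: prod.split)
  then show ?thesis using has_tderiv_cong[OF assms] by simp
qed

lemma smooth_fun_has_tderiv:
  assumes "smooth_fun M W f" "open W" "p \<in> W"
  shows "has_tderiv f (tderiv M f p) p"
proof -
  obtain U \<phi> where c: "chart_at M p = (U, \<phi>)" "(U, \<phi>) \<in> M" "p \<in> U" by (rule chart_at_obtain)
  have "has_tderiv f (deriv_in (\<phi> ` (U \<inter> W)) (\<lambda>y. f (inv_into U \<phi> y)) (\<phi> p)) p"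
    unfolding has_tderiv_iff[OF c(1) assms(2,3)]
    using smooth_on_has_derivative[OF smooth_funD[OF assms(1) c(2)] chart_half_open[OF c(2) assms(2)]] assms(3) c(3)
    by simp
  with has_tderiv_imp_tderiv[OF this] show ?thesis by simp
qed

lemma has_tderiv_linear: "has_tderiv f D p \<Longrightarrow> linear D"
  by (auto simp: has_tderiv_def has_derivative_linear split: prod.splits)

lemma has_tderiv_const: "has_tderiv (\<lambda>q. c) (\<lambda>v. 0) p"
  by (auto simp: has_tderiv_def split: prod.splits)

lemma has_tderiv_add: "has_tderiv f D p \<Longrightarrow> has_tderiv g E p \<Longrightarrow> has_tderiv (\<lambda>q. f q + g q) (\<lambda>v. D v + E v) p"
  by (auto simp: has_tderiv_def intro: has_derivative_add split: prod.splits)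

lemma has_tderiv_bounded_linear:
  "bounded_linear L \<Longrightarrow> has_tderiv f D p \<Longrightarrow> has_tderiv (\<lambda>q. L (f q)) (\<lambda>v. L (D v)) p"
  by (auto simp: has_tderiv_def intro: bounded_linear.has_derivative split: prod.splits)

lemma has_tderiv_bilinear:
  assumes B: "bounded_bilinear B" and "has_tderiv f D p" "has_tderiv g E p"
  shows "has_tderiv (\<lambda>q. B (f q) (g q)) (\<lambda>v. B (f p) (E v) + B (D v) (g p)) p"
proof -
  obtain U \<phi> where c: "chart_at M p = (U, \<phi>)" "(U, \<phi>) \<in> M" "p \<in> U" by (rule chart_at_obtain)
  show ?thesis
    using bounded_bilinear.FDERIV[OF B, of "\<lambda>y. f (inv_into U \<phi> y)" D "\<phi> p" "\<phi> ` U" "\<lambda>y. g (inv_into U \<phi> y)" E] assms(2,3)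
    by (simp add: has_tderiv_def c chart_inv[OF c(2,3)])
qed

lemma tderiv_const: "tderiv M (\<lambda>q. c) p v = 0"
  by (simp add: has_tderiv_imp_tderiv[OF has_tderiv_const])

lemma tderiv_linear: "smooth_fun M W f \<Longrightarrow> open W \<Longrightarrow> p \<in> W \<Longrightarrow> linear (tderiv M f p)"
  by (rule has_tderiv_linear[OF smooth_fun_has_tderiv])

lemma tderiv_chart_eq:
  assumes c: "chart_at M p = (U, \<phi>)" and W: "open W" "p \<in> W"
  shows "tderiv M f p v = deriv_in (\<phi> ` (U \<inter> W)) (\<lambda>y. f (inv_into U \<phi> y)) (\<phi> p) v"
proof -
  have "(U, \<phi>) \<in> M" "p \<in> U" using chart_at[of p] c by auto
  then show ?thesis using c at_chart_nbhd[OF _ _ W] by (simp add: tderiv_def comp_def)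
qed

lemma tderiv_chart_at:
  assumes "chart_at M p = (U, \<phi>)" shows "tderiv M \<phi> p v = v"
proof -
  have c: "(U, \<phi>) \<in> M" "p \<in> U" using chart_at[of p] assms by auto
  have "((\<lambda>y. \<phi> (inv_into U \<phi> y)) has_derivative (\<lambda>v. v)) (at (\<phi> p) within \<phi> ` U)"
    by (rule has_derivative_transform[OF _ _ has_derivative_ident]) (use c in \<open>auto simp: chart_inv[OF c(1)]\<close>)
  then have "has_tderiv \<phi> (\<lambda>v. v) p" by (simp add: has_tderiv_def assms)
  then show ?thesis by (simp add: has_tderiv_imp_tderiv)
qed

text \<open>Components of tangent vectors refer to \<open>chart_at M p\<close>, which may jump with
  \<open>p\<close>. Smoothness statements must therefore be moved to one fixed chart, where
  \<open>tderiv M \<phi> p v\<close> is the component vector.\<close>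

lemma tderiv_chain:
  assumes c: "(U, \<phi>) \<in> M" "p \<in> U" and f: "smooth_fun M W f" "open W" "p \<in> W"
  shows "tderiv M f p v = deriv_in (\<phi> ` (U \<inter> W)) (\<lambda>y. f (inv_into U \<phi> y)) (\<phi> p) (tderiv M \<phi> p v)"
proof -
  obtain U0 \<phi>0 where c0: "chart_at M p = (U0, \<phi>0)" "(U0, \<phi>0) \<in> M" "p \<in> U0" by (rule chart_at_obtain)
  let ?W = "U \<inter> W" and ?x = "\<phi>0 p"
  let ?F = "\<lambda>y. f (inv_into U \<phi> y)" and ?t = "\<lambda>y. \<phi> (inv_into U0 \<phi>0 y)"
  have oW: "open ?W" "p \<in> ?W" using f c chart_open[OF c(1)] by auto
  have t: "(?t has_derivative tderiv M \<phi> p) (at ?x within \<phi>0 ` (U0 \<inter> ?W))"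
    using smooth_fun_has_tderiv[OF smooth_fun_of_chart[OF c(1)] chart_open[OF c(1)] c(2)]
    unfolding has_tderiv_iff[OF c0(1) oW] .
  have tx: "?t ?x = \<phi> p" by (simp add: chart_inv[OF c0(2,3)])
  have "(?F has_derivative deriv_in (\<phi> ` (U \<inter> W)) ?F (\<phi> p)) (at (\<phi> p) within \<phi> ` (U \<inter> W))"
    using smooth_on_has_derivative[OF smooth_funD[OF f(1) c(1)] chart_half_open[OF c(1) f(2)]] f c by simp
  then have F: "(?F has_derivative deriv_in (\<phi> ` (U \<inter> W)) ?F (\<phi> p)) (at (?t ?x) within ?t ` (\<phi>0 ` (U0 \<inter> ?W)))"
    unfolding tx by (rule has_derivative_subset) (auto simp: chart_inv[OF c0(2)])
  have "((\<lambda>y. ?F (?t y)) has_derivative (\<lambda>v. deriv_in (\<phi> ` (U \<inter> W)) ?F (\<phi> p) (tderiv M \<phi> p v))) (at ?x within \<phi>0 ` (U0 \<inter> ?W))"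
    using diff_chain_within[OF t F] by (simp add: comp_def)
  then have "((\<lambda>y. f (inv_into U0 \<phi>0 y)) has_derivative (\<lambda>v. deriv_in (\<phi> ` (U \<inter> W)) ?F (\<phi> p) (tderiv M \<phi> p v))) (at ?x within \<phi>0 ` (U0 \<inter> ?W))"
    by (rule has_derivative_transform[rotated 2]) (use c0 oW in \<open>auto simp: chart_inv[OF c0(2)] chart_inv[OF c(1)]\<close>)
  then have "has_tderiv f (\<lambda>v. deriv_in (\<phi> ` (U \<inter> W)) ?F (\<phi> p) (tderiv M \<phi> p v)) p"
    unfolding has_tderiv_iff[OF c0(1) oW] .
  then show ?thesis by (simp add: has_tderiv_imp_tderiv)
qed

lemma tderiv_chart_linear: "(U, \<phi>) \<in> M \<Longrightarrow> p \<in> U \<Longrightarrow> linear (tderiv M \<phi> p)"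
  by (rule tderiv_linear[OF smooth_fun_of_chart]) (auto intro: chart_open)

text \<open>The chart chosen at \<open>p\<close> has the identity as its derivative, and by the
  chain rule this identity factors through \<open>tderiv M \<phi> p\<close>, which is therefore
  injective.\<close>

lemma tderiv_chart_bij:
  assumes c: "(U, \<phi>) \<in> M" "p \<in> U"
  shows "bij (tderiv M \<phi> p)"
proof -
  obtain U0 \<phi>0 where c0: "chart_at M p = (U0, \<phi>0)" "(U0, \<phi>0) \<in> M" "p \<in> U0" by (rule chart_at_obtain)
  have "inj (tderiv M \<phi> p)"
  proof (rule injI)
    fix v w assume "tderiv M \<phi> p v = tderiv M \<phi> p w"
    then have "tderiv M \<phi>0 p v = tderiv M \<phi>0 p w"
      by (simp add: tderiv_chain[OF c smooth_fun_of_chart[OF c0(2)] chart_open[OF c0(2)] c0(3)])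
    then show "v = w" by (simp add: tderiv_chart_at[OF c0(1)])
  qed
  then show ?thesis
    using linear_injective_imp_surjective[OF tderiv_chart_linear[OF c]] by (simp add: bij_def)
qed

lemma smooth_field_chart:
  "smooth_section M (tangent_bundle M) V \<Longrightarrow> (U, \<phi>) \<in> M \<Longrightarrow> smooth_fun M U (\<lambda>p. tderiv M \<phi> p (V p))"
  unfolding smooth_section_def tangent_bundle_def by blast

lemma smooth_fieldI:
  "(\<And>U \<phi>. (U, \<phi>) \<in> M \<Longrightarrow> smooth_fun M U (\<lambda>p. tderiv M \<phi> p (V p))) \<Longrightarrow> smooth_section M (tangent_bundle M) V"
  unfolding smooth_section_def tangent_bundle_def by auto

lemma smooth_tderiv:
  assumes f: "smooth_fun M W f" "open W" and V: "smooth_section M (tangent_bundle M) V"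
  shows "smooth_fun M W (\<lambda>q. tderiv M f q (V q))"
proof (rule smooth_fun_chartI)
  fix p assume p: "p \<in> W"
  obtain U \<phi> where c: "(U, \<phi>) \<in> M" "p \<in> U" using chart_cover by blast
  let ?S = "\<phi> ` (U \<inter> W)"
  have "smooth_on ?S (\<lambda>y. tderiv M \<phi> (inv_into U \<phi> y) (V (inv_into U \<phi> y)))"
    by (rule smooth_on_subset[OF smooth_funD[OF smooth_field_chart[OF V c(1)] c(1)]]) auto
  then have "smooth_on ?S (\<lambda>y. deriv_in ?S (\<lambda>y. f (inv_into U \<phi> y)) y (tderiv M \<phi> (inv_into U \<phi> y) (V (inv_into U \<phi> y))))"
    by (rule smooth_on_derivative_along[OF smooth_funD[OF f(1) c(1)] chart_half_open[OF c(1) f(2)]])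
  then have "smooth_on ?S ((\<lambda>q. tderiv M f q (V q)) \<circ> inv_into U \<phi>)"
    by (rule smooth_on_cong[THEN iffD1, rotated]) (auto simp: chart_inv[OF c(1)] tderiv_chain[OF c(1) _ f])
  then show "\<exists>U \<phi> W'. (U, \<phi>) \<in> M \<and> p \<in> U \<and> open W' \<and> p \<in> W' \<and>
    smooth_on (\<phi> ` (U \<inter> (W \<inter> W'))) ((\<lambda>q. tderiv M f q (V q)) \<circ> inv_into U \<phi>)"
    using c p by (intro exI[of _ U] exI[of _ \<phi>] exI[of _ UNIV]) simp
qed

text \<open>In the chart chosen at \<open>p\<close> vectors coincide with their components, and the
  Euclidean \<open>derivative_commutator\<close> applies. The identity also frees
  \<open>lie_bracket\<close> from the chart used to define it.\<close>

lemma tderiv_commutator: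
  fixes f :: "'m \<Rightarrow> 'b::euclidean_space"
  assumes f: "smooth_fun M W f" "open W" "p \<in> W"
    and V: "smooth_section M (tangent_bundle M) V" and X: "smooth_section M (tangent_bundle M) X"
  shows "tderiv M (\<lambda>q. tderiv M f q (X q)) p (V p) - tderiv M (\<lambda>q. tderiv M f q (V q)) p (X p) =
    tderiv M f p (lie_bracket M V X p)"
proof -
  obtain U \<phi> where c: "chart_at M p = (U, \<phi>)" "(U, \<phi>) \<in> M" "p \<in> U" by (rule chart_at_obtain)
  let ?S = "\<phi> ` (U \<inter> W)" and ?i = "inv_into U \<phi>"
  let ?f = "\<lambda>y. f (?i y)"
  let ?r = "\<lambda>V y. tderiv M \<phi> (?i y) (V (?i y))"
  have S: "half_open ?S" "\<phi> p \<in> ?S" using chart_half_open[OF c(2) f(2)] c f by auto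
  have rs: "smooth_on ?S (?r Y)" if "smooth_section M (tangent_bundle M) Y" for Y
    by (rule smooth_on_subset[OF smooth_funD[OF smooth_field_chart[OF that c(2)] c(2)]]) auto
  have 1: "tderiv M (\<lambda>q. tderiv M f q (Y q)) p v = deriv_in ?S (\<lambda>y. deriv_in ?S ?f y (?r Y y)) (\<phi> p) v" for Y v
  proof -
    have e: "tderiv M f (?i y) (Y (?i y)) = deriv_in ?S ?f y (?r Y y)" if "y \<in> ?S" for y
      using that by (auto simp: chart_inv[OF c(2)] tderiv_chain[OF c(2) _ f(1,2)])
    show ?thesis unfolding tderiv_chart_eq[OF c(1) f(2,3)]
      by (rule fun_cong[OF deriv_in_cong[OF S(2) e]])
  qed
  have 2: "lie_bracket M V X p = deriv_in ?S (?r X) (\<phi> p) (?r V (\<phi> p)) - deriv_in ?S (?r V) (\<phi> p) (?r X (\<phi> p))"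
    by (simp add: lie_bracket_def c tderiv_chart_eq[OF c(1) f(2,3), of "\<lambda>q. tderiv M \<phi> q (V q)" for V]
        chart_inv[OF c(2,3)] tderiv_chart_at[OF c(1)])
  have 3: "?r Y (\<phi> p) = Y p" for Y by (simp add: chart_inv[OF c(2,3)] tderiv_chart_at[OF c(1)])
  show ?thesis
    using derivative_commutator[OF S smooth_funD[OF f(1) c(2)] rs[OF V] rs[OF X]]
    unfolding 1 2 tderiv_chart_eq[OF c(1) f(2,3), of f] 3 by simp
qed

text \<open>The components of the bracket in any chart are the commutator applied to the chart map,
  so no change of coordinates of the bracket itself has to be computed.\<close>

lemma smooth_lie_bracket:
  assumes "smooth_section M (tangent_bundle M) V" "smooth_section M (tangent_bundle M) W"
  shows "smooth_section M (tangent_bundle M) (lie_bracket M V W)"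
proof (rule smooth_fieldI)
  fix U \<phi> assume c: "(U, \<phi>) \<in> M"
  note s = smooth_fun_of_chart[OF c] and o = chart_open[OF c]
  have "smooth_fun M U (\<lambda>p. tderiv M (\<lambda>q. tderiv M \<phi> q (W q)) p (V p) - tderiv M (\<lambda>q. tderiv M \<phi> q (V q)) p (W p))"
    by (intro smooth_fun_diff smooth_tderiv s o assms)
  then show "smooth_fun M U (\<lambda>p. tderiv M \<phi> p (lie_bracket M V W p))"
    by (rule smooth_fun_cong) (rule tderiv_commutator[OF s o _ assms])
qed

end

section \<open>The 0-tangent bundle\<close>

lemma linear_inv_bij:
  assumes "linear f" "bij f" shows "linear (inv f)"
proof (rule linearI)
  note s = surj_f_inv_f[OF bij_is_surj[OF assms(2)]]
  show "inv f (u + v) = inv f u + inv f v" for u v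
    by (rule inv_f_eq[OF bij_is_inj[OF assms(2)]]) (simp add: linear_add[OF assms(1)] s)
  show "inv f (r *\<^sub>R u) = r *\<^sub>R inv f u" for r u
    by (rule inv_f_eq[OF bij_is_inj[OF assms(2)]]) (simp add: linear_scale[OF assms(1)] s)
qed

lemma adjoint_inner: "linear (f :: 'v::euclidean_space \<Rightarrow> 'v) \<Longrightarrow> adjoint f y \<bullet> z = y \<bullet> f z"
  by (metis adjoint_works inner_commute)

locale zero_manifold = atlas M for M :: "'m::t2_space chart set" +
  fixes x :: "'m \<Rightarrow> real"
  assumes bdf: "bdf M x"
begin

lemma bdf_smooth: "smooth_fun M UNIV x"
  using bdf by (simp add: bdf_def)

lemma bdf_zero_iff: "x p = 0 \<longleftrightarrow> p \<in> bdry M"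
  using bdf by (auto simp: bdf_def)

lemma bdf_pos: "p \<notin> bdry M \<Longrightarrow> x p > 0"
  using bdf bdf_zero_iff[of p] by (auto simp: bdf_def less_le)

lemma open_interior: "open (- bdry M)"
proof -
  have "closed (x -` {0})"
    using smooth_fun_continuous[OF bdf_smooth open_UNIV] by (intro continuous_closed_vimage) (auto simp: continuous_on_eq_continuous_at)
  moreover have "x -` {0} = bdry M" using bdf_zero_iff by auto
  ultimately show ?thesis by auto
qed

abbreviation smooth_int :: "('m \<Rightarrow> 'b::real_normed_vector) \<Rightarrow> bool" where
  "smooth_int f \<equiv> smooth_fun M (- bdry M) f"

lemma zderiv_bdry: "p \<in> bdry M \<Longrightarrow> zderiv M x V f p = 0"
  using bdf_zero_iff by (simp add: zderiv_def)

lemma zderiv_cong: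
  assumes "open W" "p \<in> W" "\<And>q. q \<in> W \<Longrightarrow> f q = g q"
  shows "zderiv M x V f p = zderiv M x V g p"
  by (simp add: zderiv_def tderiv_cong[OF assms])

lemma zderiv_const: "zderiv M x V (\<lambda>q. c) p = 0"
  by (simp add: zderiv_def tderiv_const)

lemma zderiv_add_local:
  assumes "smooth_fun M W f" "smooth_fun M W g" "open W" "p \<in> W"
  shows "zderiv M x V (\<lambda>q. f q + g q) p = zderiv M x V f p + zderiv M x V g p"
  unfolding zderiv_def
  by (simp add: has_tderiv_imp_tderiv[OF has_tderiv_add[OF smooth_fun_has_tderiv[OF assms(1,3,4)]
      smooth_fun_has_tderiv[OF assms(2,3,4)]]] scaleR_add_right)

text \<open>On the boundary the factor \<open>x p\<close> kills every term. This is why interior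
  smoothness is all the regularity asked of scalar functions in the curvature arguments.\<close>

lemma zderiv_add:
  assumes "smooth_int f" "smooth_int g"
  shows "zderiv M x V (\<lambda>q. f q + g q) p = zderiv M x V f p + zderiv M x V g p"
proof (cases "p \<in> bdry M")
  case False
  then show ?thesis using zderiv_add_local[OF assms open_interior] by auto
qed (simp add: zderiv_bdry)

lemma zderiv_minus_local:
  assumes "smooth_fun M W f" "open W" "p \<in> W"
  shows "zderiv M x V (\<lambda>q. - f q) p = - zderiv M x V f p"
  unfolding zderiv_def
  by (simp add: has_tderiv_imp_tderiv[OF has_tderiv_bounded_linear[OF
      bounded_linear_minus[OF bounded_linear_ident] smooth_fun_has_tderiv[OF assms]]])

lemma zderiv_diff_local:
  assumes "smooth_fun M W f" "smooth_fun M W g" "open W" "p \<in> W"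
  shows "zderiv M x V (\<lambda>q. f q - g q) p = zderiv M x V f p - zderiv M x V g p"
  using zderiv_add_local[OF assms(1) smooth_fun_minus[OF assms(2)] assms(3,4)] zderiv_minus_local[OF assms(2-4)] by simp

lemma zderiv_smooth_local:
  assumes "smooth_fun M W f" "open W" "zero_field M V"
  shows "smooth_fun M W (zderiv M x V f)"
  unfolding zderiv_def[abs_def]
  by (intro smooth_fun_scaleR smooth_tderiv assms smooth_fun_subset[OF bdf_smooth]) auto

text \<open>The derivative of the factor \<open>x\<close> in the inner operator produces the two
  dx-terms of \<open>zero_bracket\<close>: the latter represents the commutator of the vector fields
  x V and x Y.\<close>

lemma zderiv_commutator_local:
  fixes f :: "'m \<Rightarrow> 'b::euclidean_space"
  assumes f: "smooth_fun M W f" "open W" "p \<in> W" and V: "zero_field M V" and Y: "zero_field M Y"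
  shows "zderiv M x V (zderiv M x Y f) p - zderiv M x Y (zderiv M x V f) p = zderiv M x (zero_bracket M x V Y) f p"
proof -
  have xd: "has_tderiv x (tderiv M x p) p" by (rule smooth_fun_has_tderiv[OF bdf_smooth]) auto
  have 1: "tderiv M (zderiv M x Y f) p v = x p *\<^sub>R tderiv M (\<lambda>q. tderiv M f q (Y q)) p v + tderiv M x p v *\<^sub>R tderiv M f p (Y p)"
    if Y: "zero_field M Y" for Y v
    unfolding zderiv_def[abs_def]
    by (simp add: has_tderiv_imp_tderiv[OF has_tderiv_bilinear[OF bounded_bilinear_scaleR xd
        smooth_fun_has_tderiv[OF smooth_tderiv[OF f(1,2) Y] f(2,3)]]])
  have l: "linear (tderiv M f p)" by (rule tderiv_linear[OF f])
  have lb: "tderiv M (\<lambda>q. tderiv M f q (Y q)) p (V p) = tderiv M (\<lambda>q. tderiv M f q (V q)) p (Y p) + tderiv M f p (lie_bracket M V Y p)"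
    using tderiv_commutator[OF f V Y] by (simp add: algebra_simps)
  have "zderiv M x V (zderiv M x Y f) p - zderiv M x Y (zderiv M x V f) p =
    x p *\<^sub>R (x p *\<^sub>R tderiv M f p (lie_bracket M V Y p) +
      tderiv M x p (V p) *\<^sub>R tderiv M f p (Y p) - tderiv M x p (Y p) *\<^sub>R tderiv M f p (V p))"
    unfolding zderiv_def[of M x V "zderiv M x Y f"] zderiv_def[of M x Y "zderiv M x V f"] 1[OF Y] 1[OF V] lb
    by (simp add: algebra_simps)
  also have "\<dots> = zderiv M x (zero_bracket M x V Y) f p"
    by (simp add: zderiv_def zero_bracket_def linear_add[OF l] linear_diff[OF l] linear_scale[OF l] algebra_simps)
  finally show ?thesis .
qed

lemma zderiv_commutator:
  fixes f :: "'m \<Rightarrow> 'b::euclidean_space"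
  assumes "smooth_int f" "zero_field M V" "zero_field M Y"
  shows "zderiv M x V (zderiv M x Y f) p - zderiv M x Y (zderiv M x V f) p = zderiv M x (zero_bracket M x V Y) f p"
proof (cases "p \<in> bdry M")
  case False
  then show ?thesis using zderiv_commutator_local[OF assms(1) open_interior _ assms(2,3)] by auto
qed (simp add: zderiv_bdry)

lemma zero_field_add: "zero_field M V \<Longrightarrow> zero_field M Y \<Longrightarrow> zero_field M (\<lambda>p. V p + Y p)"
  by (rule smooth_fieldI, rule smooth_fun_cong[OF smooth_fun_add[OF smooth_field_chart smooth_field_chart]])
    (auto simp: linear_add[OF tderiv_chart_linear])

lemma zero_field_scaleR: "smooth_fun M UNIV f \<Longrightarrow> zero_field M V \<Longrightarrow> zero_field M (\<lambda>p. f p *\<^sub>R V p)"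
  by (rule smooth_fieldI, rule smooth_fun_cong[OF smooth_fun_scaleR[OF smooth_fun_subset smooth_field_chart]])
    (auto simp: linear_scale[OF tderiv_chart_linear])

lemma zero_field_bracket:
  assumes V: "zero_field M V" and Y: "zero_field M Y"
  shows "zero_field M (zero_bracket M x V Y)"
proof -
  have d: "smooth_fun M UNIV (\<lambda>p. tderiv M x p (V p))" if "zero_field M V" for V
    by (rule smooth_tderiv[OF bdf_smooth open_UNIV that])
  have "zero_field M (\<lambda>p. (tderiv M x p (V p) *\<^sub>R Y p + (- tderiv M x p (Y p)) *\<^sub>R V p) + x p *\<^sub>R lie_bracket M V Y p)"
    by (intro zero_field_add zero_field_scaleR d V Y bdf_smooth smooth_lie_bracket smooth_fun_minus)
  then show ?thesis by (simp add: zero_bracket_def[abs_def])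
qed

text \<open>Commutators of operators satisfy the Jacobi identity. It is applied to the chart map,
  whose derivative at \<open>p\<close> is the identity, and the remaining factor \<open>x p\<close>
  is positive in the interior.\<close>

lemma zero_bracket_jacobi:
  assumes p: "p \<notin> bdry M" and XYZ: "zero_field M X" "zero_field M Y" "zero_field M Z"
  shows "zero_bracket M x X (zero_bracket M x Y Z) p + zero_bracket M x Y (zero_bracket M x Z X) p
    + zero_bracket M x Z (zero_bracket M x X Y) p = 0" (is "?J = 0")
proof -
  obtain U \<phi> where c: "chart_at M p = (U, \<phi>)" "(U, \<phi>) \<in> M" "p \<in> U" by (rule chart_at_obtain)
  note s = smooth_fun_of_chart[OF c(2)] and o = chart_open[OF c(2)]
  let ?z = "zderiv M x"
  have 1: "?z (zero_bracket M x A (zero_bracket M x B C)) \<phi> p =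
     ?z A (?z B (?z C \<phi>)) p - ?z A (?z C (?z B \<phi>)) p - ?z B (?z C (?z A \<phi>)) p + ?z C (?z B (?z A \<phi>)) p"
    if f: "zero_field M A" "zero_field M B" "zero_field M C" for A B C
  proof -
    note sm = zderiv_smooth_local[OF _ o]
    have "?z (zero_bracket M x A (zero_bracket M x B C)) \<phi> p =
      ?z A (?z (zero_bracket M x B C) \<phi>) p - ?z (zero_bracket M x B C) (?z A \<phi>) p"
      by (rule zderiv_commutator_local[OF s o c(3) f(1) zero_field_bracket[OF f(2,3)], symmetric])
    also have "?z A (?z (zero_bracket M x B C) \<phi>) p = ?z A (\<lambda>q. ?z B (?z C \<phi>) q - ?z C (?z B \<phi>) q) p"
      by (rule zderiv_cong[OF o c(3)]) (rule zderiv_commutator_local[OF s o _ f(2,3), symmetric])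
    also have "\<dots> = ?z A (?z B (?z C \<phi>)) p - ?z A (?z C (?z B \<phi>)) p"
      by (rule zderiv_diff_local[OF _ _ o c(3)]) (intro sm s f)+
    also have "?z (zero_bracket M x B C) (?z A \<phi>) p = ?z B (?z C (?z A \<phi>)) p - ?z C (?z B (?z A \<phi>)) p"
      by (rule zderiv_commutator_local[OF sm[OF s f(1)] o c(3) f(2,3), symmetric])
    finally show ?thesis by simp
  qed
  have l: "linear (tderiv M \<phi> p)" by (rule tderiv_chart_linear[OF c(2,3)])
  have "x p *\<^sub>R tderiv M \<phi> p ?J = 0"
    using 1[OF XYZ] 1[OF XYZ(2,3,1)] 1[OF XYZ(3,1,2)]
    by (simp add: zderiv_def[of M x "zero_bracket M x A B" for A B] linear_add[OF l] scaleR_add_right)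
  then show ?thesis using bdf_pos[OF p] by (simp add: tderiv_chart_at[OF c(1)])
qed

section \<open>Vector bundles and polyhomogeneous sections\<close>

text \<open>The closed set \<open>C\<close> records the support: outside it, whatever is cut off by
  the function can be extended by zero.\<close>

lemma bump_function:
  assumes "open W" "p \<in> W"
  obtains \<eta> :: "'m \<Rightarrow> real" and C where "smooth_fun M UNIV \<eta>" "\<eta> p = 1" "\<And>q. \<eta> q \<ge> 0"
    "closed C" "C \<subseteq> W" "\<And>q. q \<notin> C \<Longrightarrow> \<eta> q = 0"
proof -
  obtain U \<phi> where c: "(U, \<phi>) \<in> M" "p \<in> U" using chart_cover by blast
  have "half_open (\<phi> ` (U \<inter> W))" by (rule chart_half_open[OF c(1) assms(1)])
  then obtain O' where O': "open O'" "\<phi> ` (U \<inter> W) = half_space \<inter> O'" unfolding openin_open by auto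
  have "\<phi> p \<in> \<phi> ` (U \<inter> W)" using assms(2) c(2) by blast
  then have "\<phi> p \<in> O'" unfolding O'(2) by auto
  then obtain r where r: "r > 0" "cball (\<phi> p) r \<subseteq> O'" using O'(1) open_contains_cball by blast
  define B where "B = half_space \<inter> cball (\<phi> p) r"
  have "closed half_space" unfolding half_space_def
    by (intro closed_Collect_le continuous_intros)
  then have B: "compact B" unfolding B_def by (simp add: closed_Int_compact)
  have BU: "B \<subseteq> \<phi> ` (U \<inter> W)" unfolding B_def O'(2) using r by auto
  define C where "C = inv_into U \<phi> ` B"
  have "continuous_on B (inv_into U \<phi>)"
    by (rule continuous_on_subset[OF chart_inv_continuous[OF c(1)]]) (use BU in auto)
  \<comment> \<open>Compactness of the half-ball and the Hausdorff property make \<open>C\<close>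
    closed in the whole manifold, not merely in \<open>U\<close>.\<close>
  then have C: "closed C" unfolding C_def using B by (intro compact_imp_closed compact_continuous_image)
  have CW: "C \<subseteq> U \<inter> W" unfolding C_def using BU chart_inv[OF c(1)] by auto
  have C_iff: "q \<in> C" if "q \<in> U" "dist (\<phi> p) (\<phi> q) \<le> r" for q
  proof -
    have "\<phi> q \<in> half_space"
      using chart_half_open_image[OF c(1)] that(1) unfolding openin_open by auto
    then have "\<phi> q \<in> B" using that by (simp add: B_def)
    then show ?thesis unfolding C_def using chart_inv[OF c(1) that(1)] by (metis imageI)
  qed
  \<comment> \<open>The argument of \<open>exp_bump 0\<close> is 1 - |y - \<phi> p|^2 / r^2:
    positive exactly inside the ball of radius r, and 1 at its centre, where \<open>exp 1\<close>
    normalises the value to 1.\<close>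
  define h where "h = (\<lambda>y. exp 1 * exp_bump 0 (1 + (- inverse (r\<^sup>2)) * ((y - \<phi> p) \<bullet> (y - \<phi> p))))"
  define \<eta> where "\<eta> = (\<lambda>q. if q \<in> U then h (\<phi> q) else 0)"
  have h0: "h y = 0" if "\<not> dist (\<phi> p) y \<le> r" for y
  proof -
    have "r\<^sup>2 \<le> (norm (y - \<phi> p))\<^sup>2" using that r by (intro power_mono) (auto simp: dist_norm norm_minus_commute)
    then have "1 \<le> inverse (r\<^sup>2) * ((y - \<phi> p) \<bullet> (y - \<phi> p))"
      using r by (simp add: power2_norm_eq_inner divide_inverse[symmetric] mult.commute[of "inverse _"])
    then show ?thesis by (simp add: h_def exp_bump_def)
  qed
  have \<eta>0: "\<eta> q = 0" if "q \<notin> C" for q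
    using C_iff[of q] h0[of "\<phi> q"] that by (auto simp: \<eta>_def)
  have id: "smooth_on UNIV (\<lambda>y::real^4. y - \<phi> p)"
    using smooth_on_add[OF smooth_on_bounded_linear[OF bounded_linear_ident] smooth_on_const[of _ "- \<phi> p"]] by simp
  have "smooth_on UNIV h" unfolding h_def
    by (intro bounded_bilinear.smooth_on_bilinear[OF bounded_bilinear_mult] smooth_on_const
        smooth_on_compose[OF smooth_on_openI[OF open_UNIV Ck_on_exp_bump]] smooth_on_add
        bounded_bilinear.smooth_on_bilinear[OF bounded_bilinear_inner] id) auto
  then have sU: "smooth_fun M U (\<lambda>q. h (\<phi> q))"
    by (rule smooth_fun_compose[OF _ smooth_fun_of_chart[OF c(1)]])
  have "smooth_fun M UNIV \<eta>"
  proof (rule smooth_fun_local)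
    fix q
    show "\<exists>W'. open W' \<and> q \<in> W' \<and> smooth_fun M (UNIV \<inter> W') \<eta>"
    proof (cases "q \<in> U")
      case True
      have "smooth_fun M U \<eta>" by (rule smooth_fun_cong[OF sU]) (simp add: \<eta>_def)
      then show ?thesis using True chart_open[OF c(1)] by (intro exI[of _ U]) simp
    next
      case False
      have "smooth_fun M (- C) \<eta>" by (rule smooth_fun_cong[OF smooth_fun_const[of _ 0]]) (simp add: \<eta>0)
      then show ?thesis using False CW C by (intro exI[of _ "- C"]) auto
    qed
  qed
  moreover have "\<eta> p = 1" using c(2) by (simp add: \<eta>_def h_def exp_bump_def exp_minus)
  moreover have "\<eta> q \<ge> 0" for q by (simp add: \<eta>_def h_def exp_bump_def)
  ultimately show thesis using that[of \<eta> C] C CW \<eta>0 by blast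
qed

section \<open>Local trivialisations and extension of sections\<close>

lemma
  assumes "vector_bundle M E" "(U, T) \<in> E"
  shows bundle_open: "open U"
    and bundle_linear: "p \<in> U \<Longrightarrow> linear (T p)"
    and bundle_bij: "p \<in> U \<Longrightarrow> bij (T p)"
  using assms unfolding vector_bundle_def by fast+

lemma bundle_transition:
  assumes "vector_bundle M E" "(U, T) \<in> E" "(U', T') \<in> E"
  shows "smooth_fun M (U \<inter> U') (\<lambda>p. T' p (inv (T p) v))"
proof -
  have "\<forall>(U, T)\<in>E. \<forall>(U', T')\<in>E. \<forall>v. smooth_fun M (U \<inter> U') (\<lambda>p. T' p (inv (T p) v))"
    using assms(1) unfolding vector_bundle_def by fast
  from bspec[OF this assms(2)] assms(3) show ?thesis by fast
qed

lemma bundle_cover: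
  assumes "vector_bundle M E" obtains U T where "(U, T) \<in> E" "p \<in> U"
proof -
  have "p \<in> (\<Union>(U, T)\<in>E. U)" using assms by (simp add: vector_bundle_def)
  then show thesis using that by auto
qed

lemma bundle_inv:
  assumes "vector_bundle M E" "(U, T) \<in> E" "p \<in> U"
  shows "inv (T p) (T p u) = u" "T p (inv (T p) u) = u" "linear (inv (T p))"
  using bundle_bij[OF assms] bundle_linear[OF assms]
  by (auto simp: bij_is_inj bij_is_surj surj_f_inv_f intro: linear_inv_bij)

lemma smooth_section_triv: "smooth_section M E s \<Longrightarrow> (U, T) \<in> E \<Longrightarrow> smooth_fun M U (\<lambda>p. T p (s p))"
  unfolding smooth_section_def by fast

lemma smooth_sectionI: "(\<And>U T. (U, T) \<in> E \<Longrightarrow> smooth_fun M U (\<lambda>p. T p (s p))) \<Longrightarrow> smooth_section M E s"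
  unfolding smooth_section_def by fast

text \<open>Near a point outside \<open>U\<close> the complement of \<open>C\<close> is a
  neighbourhood on which the section vanishes; inside \<open>U\<close> its components are transition
  functions times the cutoff.\<close>

lemma smooth_section_cutoff:
  assumes E: "vector_bundle M E" "(U, T) \<in> E"
    and \<eta>: "smooth_fun M UNIV \<eta>" "closed C" "C \<subseteq> U" "\<And>q. q \<notin> C \<Longrightarrow> \<eta> q = 0"
  shows "smooth_section M E (\<lambda>q. \<eta> q *\<^sub>R inv (T q) v)"
proof (rule smooth_sectionI)
  fix U' T' assume E': "(U', T') \<in> E"
  show "smooth_fun M U' (\<lambda>p. T' p (\<eta> p *\<^sub>R inv (T p) v))"
  proof (rule smooth_fun_local)
    fix p assume p: "p \<in> U'"
    show "\<exists>W'. open W' \<and> p \<in> W' \<and> smooth_fun M (U' \<inter> W') (\<lambda>p. T' p (\<eta> p *\<^sub>R inv (T p) v))"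
    proof (cases "p \<in> U")
      case True
      have "smooth_fun M (U \<inter> U') (\<lambda>p. \<eta> p *\<^sub>R T' p (inv (T p) v))"
        by (intro smooth_fun_scaleR smooth_fun_subset[OF \<eta>(1)] bundle_transition[OF E E']) auto
      then have "smooth_fun M (U' \<inter> U) (\<lambda>p. T' p (\<eta> p *\<^sub>R inv (T p) v))"
        by (rule smooth_fun_cong[OF smooth_fun_subset]) (auto simp: linear_scale[OF bundle_linear[OF E(1) E']])
      then show ?thesis using True bundle_open[OF E] by blast
    next
      case False
      have "smooth_fun M (U' \<inter> - C) (\<lambda>p. T' p (\<eta> p *\<^sub>R inv (T p) v))"
        by (rule smooth_fun_cong[OF smooth_fun_const[of _ 0]]) (simp add: \<eta>(4) linear_0[OF bundle_linear[OF E(1) E']])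
      then show ?thesis using False \<eta>(2,3) by (intro exI[of _ "- C"]) auto
    qed
  qed
qed

lemma extension_exists:
  assumes "vector_bundle M E"
  shows "\<exists>s. smooth_section M E s \<and> s p = u"
proof -
  obtain U T where E: "(U, T) \<in> E" "p \<in> U" by (rule bundle_cover[OF assms])
  obtain \<eta> :: "'m \<Rightarrow> real" and C where \<eta>: "smooth_fun M UNIV \<eta>" "\<eta> p = 1"
    "\<And>q. \<eta> q \<ge> 0" "closed C" "C \<subseteq> U" "\<And>q. q \<notin> C \<Longrightarrow> \<eta> q = 0"
    by (rule bump_function[OF bundle_open[OF assms E(1)] E(2)]) (rule that)
  show ?thesis
    using smooth_section_cutoff[OF assms E(1) \<eta>(1,4,5,6), of "T p u"] \<eta>(2) bundle_inv[OF assms E]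
    by (intro exI[of _ "\<lambda>q. \<eta> q *\<^sub>R inv (T q) (T p u)"]) simp
qed

text \<open>Ensures that the choice in \<open>extend\<close> succeeds, so that fibre elements may be
  replaced by smooth sections through them.\<close>

lemma
  assumes "vector_bundle M E"
  shows extend_smooth: "smooth_section M E (extend M E p u)" and extend_value: "extend M E p u p = u"
  using someI_ex[OF extension_exists[OF assms, of p u]] by (auto simp: extend_def)

lemma vector_bundleI:
  assumes "\<And>p. \<exists>U T. (U, T) \<in> E \<and> p \<in> U" "\<And>U T. (U, T) \<in> E \<Longrightarrow> open U"
    "\<And>U T p. (U, T) \<in> E \<Longrightarrow> p \<in> U \<Longrightarrow> linear (T p)" "\<And>U T p. (U, T) \<in> E \<Longrightarrow> p \<in> U \<Longrightarrow> bij (T p)"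
    "\<And>U T U' T' v. (U, T) \<in> E \<Longrightarrow> (U', T') \<in> E \<Longrightarrow> smooth_fun M (U \<inter> U') (\<lambda>p. T' p (inv (T p) v))"
  shows "vector_bundle M E"
proof -
  have "(\<Union>(U, T)\<in>E. U) = UNIV" using assms(1) by fastforce
  then show ?thesis using assms(2-5) unfolding vector_bundle_def by auto
qed

lemma tangent_bundle_vector_bundle: "vector_bundle M (tangent_bundle M)"
proof (rule vector_bundleI)
  fix p show "\<exists>U T. (U, T) \<in> tangent_bundle M \<and> p \<in> U"
    using chart_cover[of p] by (auto simp: tangent_bundle_def)
next
  fix U T U' T' v assume "(U, T) \<in> tangent_bundle M" "(U', T') \<in> tangent_bundle M"
  then obtain \<phi> \<phi>' where c: "(U, \<phi>) \<in> M" "T = (\<lambda>p v. tderiv M \<phi> p v)" and c': "(U', \<phi>') \<in> M" "T' = (\<lambda>p v. tderiv M \<phi>' p v)"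
    by (auto simp: tangent_bundle_def)
  let ?S = "\<phi> ` (U \<inter> U')"
  have "smooth_on ?S (\<lambda>y. deriv_in ?S (\<lambda>y. \<phi>' (inv_into U \<phi> y)) y v)"
    by (rule smooth_on_frechet_derivative[OF smooth_funD[OF smooth_fun_of_chart[OF c'(1)] c(1)]
          chart_half_open[OF c(1) chart_open[OF c'(1)]]])
  then have "smooth_on ?S ((\<lambda>p. T' p (inv (T p) v)) \<circ> inv_into U \<phi>)"
  proof (rule smooth_on_cong[THEN iffD1, rotated])
    fix y assume "y \<in> ?S"
    then obtain p where p: "p \<in> U" "p \<in> U'" "y = \<phi> p" by auto
    have "tderiv M \<phi> p (inv (tderiv M \<phi> p) v) = v"
      by (rule surj_f_inv_f[OF bij_is_surj[OF tderiv_chart_bij[OF c(1) p(1)]]])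
    then have "tderiv M \<phi>' p (inv (tderiv M \<phi> p) v) = deriv_in ?S (\<lambda>y. \<phi>' (inv_into U \<phi> y)) y v"
      using tderiv_chain[OF c(1) p(1) smooth_fun_of_chart[OF c'(1)] chart_open[OF c'(1)] p(2)] p(3) by simp
    then show "deriv_in ?S (\<lambda>y. \<phi>' (inv_into U \<phi> y)) y v = ((\<lambda>p. T' p (inv (T p) v)) \<circ> inv_into U \<phi>) y"
      using p by (simp add: c(2) c'(2) chart_inv[OF c(1)])
  qed
  then show "smooth_fun M (U \<inter> U') (\<lambda>p. T' p (inv (T p) v))"
    using c(1) by (intro smooth_fun_chartI exI[of _ U] exI[of _ \<phi>] exI[of _ UNIV]) auto
qed (auto simp: tangent_bundle_def chart_open tderiv_chart_linear tderiv_chart_bij)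

lemma dual_bundle_vector_bundle:
  assumes E: "vector_bundle M E"
  shows "vector_bundle M (dual_bundle E)"
proof -
  have lin: "linear (adjoint (inv (T p)))" and inv1: "adjoint (inv (T p)) (adjoint (T p) v) = v"
    and inv2: "adjoint (T p) (adjoint (inv (T p)) v) = v" if "(U, T) \<in> E" "p \<in> U" for U T p v
  proof -
    note l = bundle_linear[OF E that] and i = bundle_inv[OF E that]
    show "linear (adjoint (inv (T p)))" by (rule adjoint_linear[OF i(3)])
    show "adjoint (inv (T p)) (adjoint (T p) v) = v"
      by (rule vector_eq_rdot[THEN iffD1]) (simp add: adjoint_inner l i)
    show "adjoint (T p) (adjoint (inv (T p)) v) = v"
      by (rule vector_eq_rdot[THEN iffD1]) (simp add: adjoint_inner l i)
  qed
  have bij: "bij (adjoint (inv (T p)))" and inveq: "inv (adjoint (inv (T p))) = adjoint (T p)"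
    if "(U, T) \<in> E" "p \<in> U" for U T p
  proof -
    show b: "bij (adjoint (inv (T p)))"
      using inv1[OF that] inv2[OF that] by (intro o_bij[of "adjoint (T p)"]) (auto simp: fun_eq_iff)
    show "inv (adjoint (inv (T p))) = adjoint (T p)"
      using inv1[OF that] by (intro ext inv_f_eq[OF bij_is_inj[OF b]])
  qed
  show ?thesis
  proof (rule vector_bundleI)
    fix p show "\<exists>U T. (U, T) \<in> dual_bundle E \<and> p \<in> U"
    proof -
      obtain U T where "(U, T) \<in> E" "p \<in> U" by (rule bundle_cover[OF E])
      then show ?thesis by (auto simp: dual_bundle_def)
    qed
  next
    fix U T U' T' v assume "(U, T) \<in> dual_bundle E" "(U', T') \<in> dual_bundle E"
    then obtain S S' where S: "(U, S) \<in> E" "T = (\<lambda>p. adjoint (inv (S p)))" and S': "(U', S') \<in> E" "T' = (\<lambda>p. adjoint (inv (S' p)))"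
      by (auto simp: dual_bundle_def)
    show "smooth_fun M (U \<inter> U') (\<lambda>p. T' p (inv (T p) v))"
    proof (rule smooth_fun_component)
      fix b
      \<comment> \<open>Pairing with \<open>b\<close> moves both adjoints across the inner product
        and leaves a transition map of \<open>E\<close> in the opposite direction.\<close>
      have "smooth_fun M (U' \<inter> U) (\<lambda>p. v \<bullet> S p (inv (S' p) b))"
        by (intro smooth_fun_inner smooth_fun_const bundle_transition[OF E S'(1) S(1)])
      then show "smooth_fun M (U \<inter> U') (\<lambda>p. T' p (inv (T p) v) \<bullet> b)"
        by (rule smooth_fun_cong[OF smooth_fun_subset])
          (auto simp: S(2) S'(2) inveq[OF S(1)] adjoint_inner bundle_linear[OF E S(1)] bundle_inv[OF E S'(1)])
    qed
  qed (auto simp: dual_bundle_def bundle_open[OF E] lin bij)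
qed

section \<open>Polyhomogeneous and interior-smooth sections\<close>

abbreviation phg :: "('m, 'v::euclidean_space) vbundle \<Rightarrow> ('m \<Rightarrow> 'v) \<Rightarrow> bool" where
  "phg \<equiv> phg_section M x"

text \<open>The part of polyhomogeneity that is kept: unlike the expansions, it passes to pairings
  at once, and it can be upgraded to smoothness for sections supported in the interior.\<close>

definition int_section :: "('m, 'v::euclidean_space) vbundle \<Rightarrow> ('m \<Rightarrow> 'v) \<Rightarrow> bool" where
  "int_section E s \<longleftrightarrow> (\<forall>(U, T)\<in>E. smooth_fun M (U - bdry M) (\<lambda>p. T p (s p)))"

lemma int_section_triv: "int_section E s \<Longrightarrow> (U, T) \<in> E \<Longrightarrow> smooth_fun M (U - bdry M) (\<lambda>p. T p (s p))"
  unfolding int_section_def by fast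

lemma int_sectionI: "(\<And>U T. (U, T) \<in> E \<Longrightarrow> smooth_fun M (U - bdry M) (\<lambda>p. T p (s p))) \<Longrightarrow> int_section E s"
  unfolding int_section_def by fast

text \<open>The expansion has the single index (0, 0), with \<open>f\<close> itself as coefficient,
  and its remainder vanishes in the interior.\<close>

lemma smooth_imp_phg_fun:
  assumes f: "smooth_fun M U f" and U: "open U"
  shows "phg_fun M x U f"
proof -
  define I where "I = {(0::complex, 0::nat)}"
  define a where "a = (\<lambda>(i::complex \<times> nat) p. complex_of_real (f p))"
  have I: "{i \<in> I. Re (fst i) \<le> real N} = {(0, 0)}" for N by (auto simp: I_def)
  \<comment> \<open>At a boundary point \<open>0 powr 0\<close> is 0, so the remainder equals
    \<open>f\<close> there; its vanishing on the open interior is enough for the iterated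
    derivatives.\<close>
  have fold0: "foldr (\<lambda>V h q. tderiv M h q (V q)) Vs h p = 0"
    if h: "\<And>q. q \<notin> bdry M \<Longrightarrow> h q = 0" and p: "p \<notin> bdry M" for Vs and h :: "'m \<Rightarrow> complex" and p
    using p
  proof (induction Vs arbitrary: p)
    case (Cons V Vs)
    have "tderiv M (foldr (\<lambda>V h q. tderiv M h q (V q)) Vs h) p = tderiv M (\<lambda>q. 0 :: complex) p"
      by (rule tderiv_cong[OF open_interior]) (use Cons in auto)
    then show ?case by (simp add: tderiv_const)
  qed (simp add: h)
  have rem: "complex_of_real (f q) - (\<Sum>(\<gamma>, l)\<in>{i\<in>I. Re (fst i) \<le> real N}.
      a (\<gamma>, l) q * of_real (x q) powr \<gamma> * of_real (ln (x q)) ^ l) = 0" if "q \<notin> bdry M" for q and N :: nat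
    using bdf_pos[OF that] unfolding I by (simp add: a_def)
  have bound: "\<exists>C. \<forall>p\<in>K - bdry M.
      cmod (foldr (\<lambda>V h q. tderiv M h q (V q)) Vs
        (\<lambda>q. of_real (f q) - (\<Sum>(\<gamma>, l)\<in>{i\<in>I. Re (fst i) \<le> real N}.
           a (\<gamma>, l) q * of_real (x q) powr \<gamma> * of_real (ln (x q)) ^ l)) p) \<le> C * x p ^ N" for N :: nat and Vs K
  proof (intro exI ballI)
    fix p assume "p \<in> K - bdry M"
    then show "cmod (foldr (\<lambda>V h q. tderiv M h q (V q)) Vs
        (\<lambda>q. of_real (f q) - (\<Sum>(\<gamma>, l)\<in>{i\<in>I. Re (fst i) \<le> real N}.
           a (\<gamma>, l) q * of_real (x q) powr \<gamma> * of_real (ln (x q)) ^ l)) p) \<le> 0 * x p ^ N"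
      by (subst fold0[OF rem]) auto
  qed
  have "\<forall>(\<gamma>, l)\<in>I. Re \<gamma> > 0 \<or> (\<gamma> = 0 \<and> l = 0)" "\<forall>N::nat. finite {i\<in>I. Re (fst i) \<le> real N}"
    by (auto simp: I_def)
  moreover have "\<forall>i\<in>I. smooth_fun M U (a i)"
    unfolding a_def using smooth_fun_linear[OF _ f, of complex_of_real]
    by (auto simp: linear_conv_bounded_linear bounded_linear_of_real)
  ultimately show ?thesis
    unfolding phg_fun_def
    using smooth_fun_continuous[OF f U] smooth_fun_subset[OF f, of "U - bdry M"] bound
    by (intro conjI exI[of _ I] exI[of _ a] allI impI) auto
qed

lemma smooth_imp_phg_section:
  assumes "smooth_section M E s" "vector_bundle M E"
  shows "phg E s"
proof -
  have "phg_fun M x U (\<lambda>p. T p (s p) \<bullet> b)" if "(U, T) \<in> E" for U T b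
    by (intro smooth_imp_phg_fun smooth_fun_inner smooth_fun_const smooth_section_triv[OF assms(1) that]
        bundle_open[OF assms(2) that])
  then show ?thesis unfolding phg_section_def by auto
qed

lemma phg_section_imp_int:
  assumes "phg E s" shows "int_section E s"
proof (rule int_sectionI)
  fix U T assume E: "(U, T) \<in> E"
  show "smooth_fun M (U - bdry M) (\<lambda>p. T p (s p))"
  proof (rule smooth_fun_component)
    fix b :: 'a assume "b \<in> Basis"
    then show "smooth_fun M (U - bdry M) (\<lambda>p. T p (s p) \<bullet> b)"
      using bspec[OF assms[unfolded phg_section_def] E] by (auto simp: phg_fun_def)
  qed
qed

text \<open>Extension by zero across the boundary. It turns products formed in the interior into
  smooth, hence polyhomogeneous, sections.\<close>

lemma int_section_supported_smooth:
  assumes E: "vector_bundle M E" and s: "int_section E s"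
    and C: "closed C" "C \<subseteq> - bdry M" "\<And>q. q \<notin> C \<Longrightarrow> s q = 0"
  shows "smooth_section M E s"
proof (rule smooth_sectionI)
  fix U T assume T: "(U, T) \<in> E"
  show "smooth_fun M U (\<lambda>p. T p (s p))"
  proof (rule smooth_fun_local)
    fix p assume "p \<in> U"
    show "\<exists>W'. open W' \<and> p \<in> W' \<and> smooth_fun M (U \<inter> W') (\<lambda>p. T p (s p))"
    proof (cases "p \<in> bdry M")
      case True
      have "smooth_fun M (U \<inter> - C) (\<lambda>p. T p (s p))"
        by (rule smooth_fun_cong[OF smooth_fun_const[of _ 0]]) (simp add: C(3) linear_0[OF bundle_linear[OF E T]])
      then show ?thesis using True C by (intro exI[of _ "- C"]) auto
    next
      case False
      then show ?thesis using int_section_triv[OF s T] open_interior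
        by (intro exI[of _ "- bdry M"]) (auto simp: Diff_eq)
    qed
  qed
qed

text \<open>The frame consists of global smooth sections, because the hypotheses on the metric and
  on Clifford multiplication speak of global sections; it is required to span the fibres over
  \<open>W\<close>.\<close>

definition local_frame ::
  "('m, 'v::euclidean_space) vbundle \<Rightarrow> 'm set \<Rightarrow> ('v \<Rightarrow> 'm \<Rightarrow> 'v) \<Rightarrow> (('m \<Rightarrow> 'v) \<Rightarrow> 'v \<Rightarrow> 'm \<Rightarrow> real) \<Rightarrow> bool" where
  "local_frame E W f k \<longleftrightarrow> open W \<and> (\<forall>b. smooth_section M E (f b)) \<and>
    (\<forall>s b. int_section E s \<longrightarrow> smooth_fun M (W - bdry M) (k s b)) \<and>
    (\<forall>s q. q \<in> W \<longrightarrow> s q = (\<Sum>b\<in>Basis. k s b q *\<^sub>R f b q))"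

lemma
  assumes "local_frame E W f k"
  shows local_frame_open: "open W" and local_frame_smooth: "smooth_section M E (f b)"
    and local_frame_coeff: "int_section E s \<Longrightarrow> smooth_fun M (W - bdry M) (k s b)"
    and local_frame_expand: "q \<in> W \<Longrightarrow> s q = (\<Sum>b\<in>Basis. k s b q *\<^sub>R f b q)"
  using assms unfolding local_frame_def by blast+

lemma local_frame_exists:
  fixes E :: "('m, 'v::euclidean_space) vbundle"
  assumes E: "vector_bundle M E"
  shows "\<exists>W f k. p \<in> W \<and> local_frame E W f k"
proof -
  obtain U T where T: "(U, T) \<in> E" "p \<in> U" by (rule bundle_cover[OF E])
  obtain \<eta> :: "'m \<Rightarrow> real" and C where \<eta>: "smooth_fun M UNIV \<eta>" "\<eta> p = 1" "\<And>q. \<eta> q \<ge> 0"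
    "closed C" "C \<subseteq> U" "\<And>q. q \<notin> C \<Longrightarrow> \<eta> q = 0"
    by (rule bump_function[OF bundle_open[OF E T(1)] T(2)]) (rule that)
  \<comment> \<open>Where the cutoff is positive, the cut-off trivial frame still is a frame; its
    coefficients are divided by \<eta>.\<close>
  define W where "W = U \<inter> \<eta> -` {0<..}"
  define f where "f = (\<lambda>b q. \<eta> q *\<^sub>R inv (T q) b)"
  define k where "k = (\<lambda>s (b::'v) q. (T q (s q) \<bullet> b) * inverse (\<eta> q))"
  have "continuous_on UNIV \<eta>" by (rule smooth_fun_continuous[OF \<eta>(1) open_UNIV])
  then have "open W" unfolding W_def
    by (intro open_Int bundle_open[OF E T(1)] open_vimage) auto
  moreover have "p \<in> W" using T \<eta>(2) by (simp add: W_def)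
  moreover have "smooth_section M E (f b)" for b
    unfolding f_def by (rule smooth_section_cutoff[OF E T(1) \<eta>(1,4,5,6)])
  moreover have "smooth_fun M (W - bdry M) (k s b)" if "int_section E s" for s b
    unfolding k_def
    by (intro smooth_fun_mult smooth_fun_inner smooth_fun_const smooth_fun_inverse
        smooth_fun_subset[OF \<eta>(1)] smooth_fun_subset[OF int_section_triv[OF that T(1)]]) (auto simp: W_def)
  moreover have "s q = (\<Sum>b\<in>Basis. k s b q *\<^sub>R f b q)" if q: "q \<in> W" for s q
  proof -
    have U: "q \<in> U" and e: "\<eta> q > 0" using q by (auto simp: W_def)
    note i = bundle_inv[OF E T(1) U]
    have "s q = inv (T q) (T q (s q))" by (simp add: i)
    also have "\<dots> = (\<Sum>b\<in>Basis. (T q (s q) \<bullet> b) *\<^sub>R inv (T q) b)"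
      by (rule linear_Basis_expand[OF i(3)])
    finally show ?thesis using e by (simp add: k_def f_def mult.assoc)
  qed
  ultimately show ?thesis unfolding local_frame_def
    by (intro exI[of _ W] exI[of _ f] exI[of _ k]) blast
qed

text \<open>Regularity of \<open>B\<close> is known only through its values on smooth global
  sections. Expansion in two local frames of such sections passes it on to arbitrary interior-smooth
  sections.\<close>

lemma pairing_smooth_int:
  fixes E :: "('m, 'v::euclidean_space) vbundle" and F :: "('m, 'w::euclidean_space) vbundle"
    and B :: "'m \<Rightarrow> 'v \<Rightarrow> 'w \<Rightarrow> 'c::real_normed_vector"
  assumes E: "vector_bundle M E" and F: "vector_bundle M F" and B: "\<And>q. q \<in> W0 \<Longrightarrow> bilinear (B q)" and W0: "open W0"
    and sm: "\<And>s t. smooth_section M E s \<Longrightarrow> smooth_section M F t \<Longrightarrow> smooth_fun M (W0 - bdry M) (\<lambda>q. B q (s q) (t q))"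
    and s: "int_section E s" and t: "int_section F t"
  shows "smooth_fun M (W0 - bdry M) (\<lambda>q. B q (s q) (t q))"
proof (rule smooth_fun_local)
  fix p assume p: "p \<in> W0 - bdry M"
  obtain W f k where fW: "p \<in> W" "local_frame E W f k" using local_frame_exists[OF E] by blast
  obtain W' h j where hW: "p \<in> W'" "local_frame F W' h j" using local_frame_exists[OF F] by blast
  have eq: "B q (s q) (t q) = (\<Sum>b\<in>Basis. \<Sum>c\<in>Basis. k s b q *\<^sub>R j t c q *\<^sub>R B q (f b q) (h c q))"
    if q: "q \<in> (W0 - bdry M) \<inter> (W \<inter> W')" for q
  proof -
    have l: "linear (\<lambda>u. B q u w)" "linear (B q u)" for u w using B[of q] q by (auto simp: bilinear_def)
    have "B q (s q) (t q) = B q (\<Sum>b\<in>Basis. k s b q *\<^sub>R f b q) (\<Sum>b\<in>Basis. j t b q *\<^sub>R h b q)"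
      using local_frame_expand[OF fW(2), of q s] local_frame_expand[OF hW(2), of q t] q by (simp only: Int_iff)
    also have "\<dots> = (\<Sum>b\<in>Basis. \<Sum>c\<in>Basis. k s b q *\<^sub>R j t c q *\<^sub>R B q (f b q) (h c q))"
      by (simp only: linear_sum[OF l(1)] linear_scale[OF l(1)])
        (simp only: linear_sum[OF l(2)] linear_scale[OF l(2)] scaleR_sum_right)
    finally show ?thesis .
  qed
  have "smooth_fun M ((W0 - bdry M) \<inter> (W \<inter> W')) (\<lambda>q. \<Sum>b\<in>Basis. \<Sum>c\<in>Basis. k s b q *\<^sub>R j t c q *\<^sub>R B q (f b q) (h c q))"
    by (intro smooth_fun_sum smooth_fun_scaleR smooth_fun_subset[OF local_frame_coeff[OF fW(2) s]]
        smooth_fun_subset[OF local_frame_coeff[OF hW(2) t]] smooth_fun_subset[OF sm]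
        local_frame_smooth[OF fW(2)] local_frame_smooth[OF hW(2)]) auto
  then have "smooth_fun M ((W0 - bdry M) \<inter> (W \<inter> W')) (\<lambda>q. B q (s q) (t q))"
    by (rule smooth_fun_cong) (simp add: eq)
  then show "\<exists>W'. open W' \<and> p \<in> W' \<and> smooth_fun M ((W0 - bdry M) \<inter> W') (\<lambda>q. B q (s q) (t q))"
    using fW(1) hW(1) local_frame_open[OF fW(2)] local_frame_open[OF hW(2)] by (intro exI[of _ "W \<inter> W'"]) auto
qed

lemma dual_pairing_smooth_int:
  assumes E: "vector_bundle M E" and \<alpha>: "int_section (dual_bundle E) \<alpha>" and s: "int_section E s"
  shows "smooth_int (\<lambda>q. \<alpha> q \<bullet> s q)"
proof (rule smooth_fun_local)
  fix p assume "p \<in> - bdry M"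
  obtain U T where T: "(U, T) \<in> E" "p \<in> U" by (rule bundle_cover[OF E])
  have T': "(U, \<lambda>p. adjoint (inv (T p))) \<in> dual_bundle E" using T by (auto simp: dual_bundle_def)
  have "smooth_fun M (U - bdry M) (\<lambda>q. adjoint (inv (T q)) (\<alpha> q) \<bullet> T q (s q))"
    by (intro smooth_fun_inner int_section_triv[OF \<alpha> T'] int_section_triv[OF s T(1)])
  then have "smooth_fun M (- bdry M \<inter> U) (\<lambda>q. \<alpha> q \<bullet> s q)"
    by (rule smooth_fun_cong[OF smooth_fun_subset]) (auto simp: adjoint_inner bundle_inv[OF E T(1)])
  then show "\<exists>W'. open W' \<and> p \<in> W' \<and> smooth_fun M (- bdry M \<inter> W') (\<lambda>q. \<alpha> q \<bullet> s q)"
    using T bundle_open[OF E T(1)] by blast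
qed

section \<open>Curvature of 0-connections\<close>

lemma
  assumes "zero_connection M x E A" "zero_field M V" "phg E s"
  shows connection_phg: "phg E (A V s)"
    and connection_scale_field: "smooth_fun M UNIV f \<Longrightarrow> A (\<lambda>p. f p *\<^sub>R V p) s p = f p *\<^sub>R A V s p"
    and connection_add: "phg E t \<Longrightarrow> A V (\<lambda>p. s p + t p) p = A V s p + A V t p"
    and connection_leibniz: "phg_fun M x UNIV h \<Longrightarrow> A V (\<lambda>p. h p *\<^sub>R s p) p = zderiv M x V h p *\<^sub>R s p + h p *\<^sub>R A V s p"
  using assms unfolding zero_connection_def by (simp_all add: fun_eq_iff)

lemma connection_minus_field:
  assumes "zero_connection M x E A" "zero_field M V" "phg E s"
  shows "A (\<lambda>p. - V p) s p = - A V s p"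
  using connection_scale_field[OF assms smooth_fun_const[of _ "-1"]] by simp

text \<open>Curvature on sections, before these are frozen to extensions of fibre elements.
  Compatibility identities hold at this level; dependence on the value at a point is then deduced
  from skewness.\<close>

definition curv_op ::
  "(('m \<Rightarrow> real^4) \<Rightarrow> ('m \<Rightarrow> 'v) \<Rightarrow> 'm \<Rightarrow> 'v::euclidean_space) \<Rightarrow> ('m \<Rightarrow> real^4) \<Rightarrow> ('m \<Rightarrow> real^4) \<Rightarrow> ('m \<Rightarrow> 'v) \<Rightarrow> 'm \<Rightarrow> 'v"
  where "curv_op A V W s p = A V (A W s) p - A W (A V s) p - A (zero_bracket M x V W) s p"

lemma curvature_curv_op:
  "curvature M x E A p v w u =
    curv_op A (extend M (zero_tangent_bundle M) p v) (extend M (zero_tangent_bundle M) p w) (extend M E p u) p"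
  by (simp add: curvature_def curv_op_def Let_def)

text \<open>Both sides of the commutator identity for the scalar B(s, t) are expanded by the product
  rule. One statement serves the metric, the pairing of covectors with vectors, \<open>herm\<close>
  and \<open>cvol\<close>.\<close>

lemma pairing_curvature:
  fixes B :: "'m \<Rightarrow> 'v::euclidean_space \<Rightarrow> 'w::euclidean_space \<Rightarrow> 'c::euclidean_space"
  assumes A: "zero_connection M x E A" and A': "zero_connection M x E' A'"
    and B: "\<And>q. bilinear (B q)"
    and sm: "\<And>s t. phg E s \<Longrightarrow> phg E' t \<Longrightarrow> smooth_int (\<lambda>q. B q (s q) (t q))"
    and compat: "\<And>V s t p. zero_field M V \<Longrightarrow> phg E s \<Longrightarrow> phg E' t \<Longrightarrow>
      zderiv M x V (\<lambda>q. B q (s q) (t q)) p = B p (A V s p) (t p) + B p (s p) (A' V t p)"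
    and V: "zero_field M V" and W: "zero_field M W"
    and s: "phg E s" and t: "phg E' t"
  shows "B p (curv_op A V W s p) (t p) + B p (s p) (curv_op A' V W t p) = 0"
proof -
  let ?f = "\<lambda>q. B q (s q) (t q)"
  note ph = connection_phg[OF A] and ph' = connection_phg[OF A']
  \<comment> \<open>The two mixed terms are exchanged by swapping \<open>V\<close> and
    \<open>W\<close> and hence drop out of the commutator.\<close>
  have 1: "zderiv M x V (zderiv M x W ?f) p =
     (B p (A V (A W s) p) (t p) + B p (A W s p) (A' V t p)) + (B p (A V s p) (A' W t p) + B p (s p) (A' V (A' W t) p))"
    if V: "zero_field M V" and W: "zero_field M W" for V W
  proof -
    have "zderiv M x W ?f = (\<lambda>q. B q (A W s q) (t q) + B q (s q) (A' W t q))"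
      by (rule ext) (rule compat[OF W s t])
    then have "zderiv M x V (zderiv M x W ?f) p =
      zderiv M x V (\<lambda>q. B q (A W s q) (t q)) p + zderiv M x V (\<lambda>q. B q (s q) (A' W t q)) p"
      using zderiv_add[OF sm[OF ph[OF W s] t] sm[OF s ph'[OF W t]]] by simp
    then show ?thesis
      by (simp only: compat[OF V ph[OF W s] t] compat[OF V s ph'[OF W t]])
  qed
  have 2: "zderiv M x V (zderiv M x W ?f) p - zderiv M x W (zderiv M x V ?f) p =
      B p (A (zero_bracket M x V W) s p) (t p) + B p (s p) (A' (zero_bracket M x V W) t p)"
    by (simp only: zderiv_commutator[OF sm[OF s t] V W] compat[OF zero_field_bracket[OF V W] s t])
  show ?thesis
    using 2 unfolding 1[OF V W] 1[OF W V] curv_op_def bilinear_lsub[OF B] bilinear_rsub[OF B]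
    by (simp add: algebra_simps)
qed

lemma zero_bracket_swap: "zero_bracket M x V W p = - zero_bracket M x W V p"
proof -
  have "lie_bracket M V W p = - lie_bracket M W V p"
    by (simp add: lie_bracket_def split: prod.split)
  then show ?thesis unfolding zero_bracket_def by simp
qed

lemma curv_op_swap:
  assumes "zero_connection M x E A" "zero_field M V" "zero_field M W" "phg E s"
  shows "curv_op A V W s p = - curv_op A W V s p"
proof -
  have e: "zero_bracket M x V W = (\<lambda>p. - zero_bracket M x W V p)"
    by (rule ext) (rule zero_bracket_swap)
  have "A (zero_bracket M x V W) s p = - A (zero_bracket M x W V) s p"
    unfolding e by (rule connection_minus_field[OF assms(1) zero_field_bracket[OF assms(3,2)] assms(4)])
  then show ?thesis by (simp add: curv_op_def)
qed

text \<open>Vanishing torsion rewrites the inner derivatives so that the cyclic sum becomes the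
  Jacobi sum of \<open>zero_bracket\<close>.\<close>

lemma curv_op_bianchi:
  assumes LC: "levi_civita M x g nab" and p: "p \<notin> bdry M"
    and XYZ: "zero_field M X" "zero_field M Y" "zero_field M Z"
  shows "curv_op nab X Y Z p + curv_op nab Y Z X p + curv_op nab Z X Y p = 0"
proof -
  let ?b = "zero_bracket M x"
  have nab: "zero_connection M x (zero_tangent_bundle M) nab" using LC by (simp add: levi_civita_def)
  note phg = smooth_imp_phg_section[OF _ tangent_bundle_vector_bundle]
  have tf: "nab V W q = nab W V q + ?b V W q" if "zero_field M V" "zero_field M W" for V W q
  proof -
    have "(\<lambda>p. nab V W p - nab W V p) = ?b V W" using LC that unfolding levi_civita_def by blast
    from fun_cong[OF this, of q] show ?thesis by (simp add: algebra_simps)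
  qed
  have 1: "nab X (nab Y Z) p = nab X (nab Z Y) p + nab X (?b Y Z) p"
    if f: "zero_field M X" "zero_field M Y" "zero_field M Z" for X Y Z
  proof -
    have "nab Y Z = (\<lambda>q. nab Z Y q + ?b Y Z q)" by (rule ext) (rule tf[OF f(2,3)])
    then show ?thesis
      by (simp only:) (rule connection_add[OF nab f(1) connection_phg[OF nab f(3) phg[OF f(2)]] phg[OF zero_field_bracket[OF f(2,3)]]])
  qed
  have 2: "curv_op nab X Y Z p = nab X (nab Z Y) p - nab Y (nab X Z) p + nab X (?b Y Z) p - nab Z (?b X Y) p - ?b (?b X Y) Z p"
    if f: "zero_field M X" "zero_field M Y" "zero_field M Z" for X Y Z
    unfolding curv_op_def 1[OF f] tf[OF zero_field_bracket[OF f(1,2)] f(3), of p] by simp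
  have s: "curv_op nab X Y Z p + curv_op nab Y Z X p + curv_op nab Z X Y p =
     ?b X (?b Y Z) p + ?b Y (?b Z X) p + ?b Z (?b X Y) p"
    unfolding 2[OF XYZ] 2[OF XYZ(2,3,1)] 2[OF XYZ(3,1,2)]
      zero_bracket_swap[of "?b X Y" Z] zero_bracket_swap[of "?b Y Z" X] zero_bracket_swap[of "?b Z X" Y]
    by simp
  then show ?thesis using zero_bracket_jacobi[OF p XYZ] by simp
qed

end

section \<open>Oriented orthonormal coframes and the Hodge star\<close>

lemma four_eq_zero: "(4::4) = 0"
  by simp

lemma UNIV_4': "(UNIV :: 4 set) = {0, 1, 2, 3}"
  unfolding UNIV_4 four_eq_zero by auto

lemma sum_4': "sum f (UNIV :: 4 set) = f 0 + f 1 + f 2 + f 3"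
  unfolding sum_4 four_eq_zero by (simp add: ac_simps)

lemma forall_4': "(\<forall>i::4. P i) \<longleftrightarrow> P 0 \<and> P 1 \<and> P 2 \<and> P 3"
  unfolding forall_4 four_eq_zero by auto

lemma det_4:
  "det (A::'a::comm_ring_1^4^4) =
     A$0$0 * (A$1$1 * (A$2$2 * A$3$3 - A$2$3 * A$3$2) - A$1$2 * (A$2$1 * A$3$3 - A$2$3 * A$3$1) + A$1$3 * (A$2$1 * A$3$2 - A$2$2 * A$3$1))
   - A$0$1 * (A$1$0 * (A$2$2 * A$3$3 - A$2$3 * A$3$2) - A$1$2 * (A$2$0 * A$3$3 - A$2$3 * A$3$0) + A$1$3 * (A$2$0 * A$3$2 - A$2$2 * A$3$0))
   + A$0$2 * (A$1$0 * (A$2$1 * A$3$3 - A$2$3 * A$3$1) - A$1$1 * (A$2$0 * A$3$3 - A$2$3 * A$3$0) + A$1$3 * (A$2$0 * A$3$1 - A$2$1 * A$3$0))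
   - A$0$3 * (A$1$0 * (A$2$1 * A$3$2 - A$2$2 * A$3$1) - A$1$1 * (A$2$0 * A$3$2 - A$2$2 * A$3$0) + A$1$2 * (A$2$0 * A$3$1 - A$2$1 * A$3$0))"
proof -
  have f: "finite {1::4, 2, 3}" "0 \<notin> {1::4, 2, 3}" by auto
  have f1: "finite {2::4, 3}" "1 \<notin> {2::4, 3}" by auto
  have f2: "finite {3::4}" "2 \<notin> {3::4}" by auto
  show ?thesis
    unfolding det_def UNIV_4'
    unfolding sum_over_permutations_insert[OF f]
    unfolding sum_over_permutations_insert[OF f1]
    unfolding sum_over_permutations_insert[OF f2]
    unfolding permutes_sing
    by (simp add: sign_swap_id permutation_swap_id permutation_compose sign_compose sign_id swap_id_eq algebra_simps)
qed

section \<open>Linear algebra of a single tangent fibre\<close>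

locale inner_product4 =
  fixes G :: "real^4 \<Rightarrow> real^4 \<Rightarrow> real"
  assumes G_bilinear: "bilinear G" and G_sym: "G v w = G w v" and G_pos: "v \<noteq> 0 \<Longrightarrow> G v v > 0"
begin

lemmas G_simps = bilinear_ladd[OF G_bilinear] bilinear_radd[OF G_bilinear] bilinear_lsub[OF G_bilinear]
  bilinear_rsub[OF G_bilinear] bilinear_lmul[OF G_bilinear] bilinear_rmul[OF G_bilinear]
  bilinear_lneg[OF G_bilinear] bilinear_rneg[OF G_bilinear] bilinear_lzero[OF G_bilinear] bilinear_rzero[OF G_bilinear]

lemma G_linear: "linear (G v)" "linear (\<lambda>v. G v w)"
  using G_bilinear by (auto simp: bilinear_def)

lemma G_eq_zeroD: "(\<And>w. G v w = 0) \<Longrightarrow> v = 0"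
  using G_pos[of v] by force

lemma G_eqI: "(\<And>w. G v w = G v' w) \<Longrightarrow> v = v'"
  using G_eq_zeroD[of "v - v'"] by (simp add: G_simps)

text \<open>Positivity makes v -> G(v, -) injective, hence onto in finite dimension.\<close>

lemma sharp_exists: "\<exists>v. \<forall>w. G v w = \<alpha> \<bullet> w"
proof -
  define L where "L = (\<lambda>v. (\<chi> i. G v (axis i 1)) :: real^4)"
  have L: "L v \<bullet> w = G v w" for v w
  proof -
    have "G v w = G v (\<Sum>i\<in>UNIV. (w $ i) *\<^sub>R axis i 1)"
      by (simp add: basis_expansion scalar_mult_eq_scaleR[symmetric])
    then show ?thesis by (simp add: L_def inner_vec_def linear_sum[OF G_linear(1)] linear_scale[OF G_linear(1)] mult.commute)
  qed
  have lin: "linear L" by (rule linearI) (auto simp: L_def vec_eq_iff G_simps)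
  have "inj L"
  proof (rule injI)
    fix u v assume "L u = L v"
    then have "G u w = G v w" for w by (metis L)
    then show "u = v" by (rule G_eqI)
  qed
  then have "surj L" using linear_injective_imp_surjective[OF lin] by simp
  then obtain v where "\<alpha> = L v" by (rule surjE)
  then show ?thesis using L by auto
qed

lemma G_sharp: "G (sharp G \<alpha>) w = \<alpha> \<bullet> w"
proof -
  have "\<exists>!v. \<forall>w. G v w = \<alpha> \<bullet> w"
    using sharp_exists[of \<alpha>] by (auto intro: G_eqI)
  from theI'[OF this] show ?thesis by (simp add: sharp_def)
qed

lemma sharp_eqI: "(\<And>w. G v w = \<alpha> \<bullet> w) \<Longrightarrow> sharp G \<alpha> = v"
  by (rule G_eqI) (simp add: G_sharp)

end

locale frame4 = inner_product4 +
  fixes e :: "4 \<Rightarrow> real^4"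
  assumes coframe: "oriented_orthonormal_coframe G e"
begin

text \<open>Defined as the metric dual; orthonormality of the coframe makes it the dual basis as
  well (\<open>e_f\<close>), so components can be read off either way.\<close>

definition f :: "4 \<Rightarrow> real^4" where "f i = sharp G (e i)"

lemma G_f: "G (f i) w = e i \<bullet> w"
  by (simp add: f_def G_sharp)

lemma G_f': "G w (f i) = e i \<bullet> w"
  by (subst G_sym) (rule G_f)

lemma e_f: "e i \<bullet> f j = (if i = j then 1 else 0)"
  using coframe by (simp add: oriented_orthonormal_coframe_def dual_metric_def f_def)

text \<open>With the covectors and the vectors as rows of \<open>E\<close> and \<open>F\<close>,
  duality is \<open>E ** transpose F = mat 1\<close>; a one-sided inverse of a square matrix is
  two-sided, and the reversed product is the completeness relation.\<close>

lemma vector_expand: "v = (\<Sum>i\<in>UNIV. (e i \<bullet> v) *\<^sub>R f i)"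
  and covector_expand: "\<alpha> = (\<Sum>i\<in>UNIV. (\<alpha> \<bullet> f i) *\<^sub>R e i)"
  and det_f: "det (\<chi> i. e i) * det (\<chi> i. f i) = 1"
proof -
  define E F where "E = (\<chi> i. e i)" and "F = (\<chi> i. f i)"
  have EF: "E ** transpose F = mat 1"
    using e_f unfolding inner_vec_def inner_real_def
    by (simp only: E_def F_def matrix_matrix_mult_def transpose_def mat_def vec_eq_iff vec_lambda_beta) simp
  then have FE: "transpose F ** E = mat 1" by (rule matrix_left_right_inverse[THEN iffD1])
  have "v = (transpose F ** E) *v v" by (simp add: FE)
  also have "\<dots> = transpose F *v (E *v v)" by (simp add: matrix_vector_mul_assoc)
  also have "\<dots> = (\<Sum>i\<in>UNIV. (e i \<bullet> v) *\<^sub>R f i)"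
    by (simp add: E_def F_def matrix_vector_mult_def transpose_def vec_eq_iff inner_vec_def mult.commute)
  finally show "v = (\<Sum>i\<in>UNIV. (e i \<bullet> v) *\<^sub>R f i)" .
  have EF': "transpose E ** F = mat 1"
    using arg_cong[OF FE, of transpose] by (simp add: matrix_transpose_mul transpose_mat)
  have "\<alpha> = (transpose E ** F) *v \<alpha>" by (simp add: EF')
  also have "\<dots> = transpose E *v (F *v \<alpha>)" by (simp add: matrix_vector_mul_assoc)
  also have "\<dots> = (\<Sum>i\<in>UNIV. (\<alpha> \<bullet> f i) *\<^sub>R e i)"
    by (simp add: E_def F_def matrix_vector_mult_def transpose_def vec_eq_iff inner_vec_def mult.commute)
  finally show "\<alpha> = (\<Sum>i\<in>UNIV. (\<alpha> \<bullet> f i) *\<^sub>R e i)" .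
  show "det (\<chi> i. e i) * det (\<chi> i. f i) = 1"
    using arg_cong[OF EF, of det] by (simp add: det_mul E_def F_def)
qed

text \<open>The frame matrix satisfies F g F^T = 1, so sqrt (det g) is 1 / |det F|; the orientation
  of the coframe removes the absolute value, and the factor cancels.\<close>

lemma volume_form_frame:
  "volume_form G a b c d =
    det (\<chi> i j. e j \<bullet> (if i = 0 then a else if i = 1 then b else if i = 2 then c else d) :: real^4^4)"
proof -
  let ?r = "\<lambda>i::4. if i = 0 then a else if i = 1 then b else if i = 2 then c else d"
  define F :: "real^4^4" where "F = (\<chi> i. f i)"
  define g where "g = (\<chi> i j. G (axis i 1) (axis j 1) :: real^4^4)"
  define A where "A = (\<chi> i j. e j \<bullet> ?r i :: real^4^4)"
  have r: "?r i = (\<Sum>j\<in>UNIV. (e j \<bullet> ?r i) *\<^sub>R f j)" for i by (rule vector_expand)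
  have "(\<chi> i. ?r i) = A ** F"
    unfolding vec_eq_iff
  proof (intro allI)
    fix i k
    show "(\<chi> i. ?r i) $ i $ k = (A ** F) $ i $ k"
      using arg_cong[OF r[of i], of "\<lambda>v. v $ k"]
      by (simp only: A_def F_def matrix_matrix_mult_def vec_lambda_beta sum_component vector_scaleR_component real_scaleR_def)
  qed
  then have 1: "det (\<chi> i. ?r i) = det A * det F" by (simp add: det_mul)
  have G_coord: "G u v = (\<Sum>k\<in>UNIV. \<Sum>l\<in>UNIV. u $ k * v $ l * G (axis k 1) (axis l 1))" for u v
  proof -
    have "G u v = G (\<Sum>k\<in>UNIV. (u $ k) *\<^sub>R axis k 1) (\<Sum>l\<in>UNIV. (v $ l) *\<^sub>R axis l 1)"
      by (simp add: basis_expansion scalar_mult_eq_scaleR[symmetric])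
    also have "\<dots> = (\<Sum>k\<in>UNIV. u $ k * G (axis k 1) (\<Sum>l\<in>UNIV. (v $ l) *\<^sub>R axis l 1))"
      by (simp only: linear_sum[OF G_linear(2)] linear_scale[OF G_linear(2)] real_scaleR_def)
    also have "\<dots> = (\<Sum>k\<in>UNIV. \<Sum>l\<in>UNIV. u $ k * v $ l * G (axis k 1) (axis l 1))"
      by (simp only: linear_sum[OF G_linear(1)] linear_scale[OF G_linear(1)] real_scaleR_def sum_distrib_left mult.assoc)
    finally show ?thesis .
  qed
  have "F ** g ** transpose F = mat 1"
    unfolding vec_eq_iff
  proof (intro allI)
    fix i j
    have "(F ** g ** transpose F) $ i $ j = (\<Sum>l\<in>UNIV. \<Sum>k\<in>UNIV. f i $ k * G (axis k 1) (axis l 1) * f j $ l)"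
      by (simp add: matrix_matrix_mult_def F_def g_def transpose_def sum_distrib_right)
    also have "\<dots> = G (f i) (f j)"
      unfolding G_coord[of "f i" "f j"] by (subst sum.swap) (simp add: mult_ac)
    also have "\<dots> = mat 1 $ i $ j" by (simp add: G_f e_f mat_def)
    finally show "(F ** g ** transpose F) $ i $ j = mat 1 $ i $ j" .
  qed
  then have "det F * det g * det F = 1"
    using arg_cong[of _ _ det] by (metis det_I det_mul det_transpose)
  moreover have F: "det F > 0"
    using det_f coframe unfolding F_def oriented_orthonormal_coframe_def by (metis zero_less_mult_pos zero_less_one)
  ultimately have "det g = (inverse (det F))\<^sup>2"
    by (simp add: power2_eq_square field_simps)
  then have "sqrt (det g) = inverse (det F)" using F by (simp add: real_sqrt_abs)
  then show ?thesis
    using 1 F unfolding volume_form_def g_def[symmetric] A_def[symmetric] by simp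
qed

text \<open>Contraction with the inverse metric does not depend on the basis: the coordinate basis
  paired with its metric dual gives the same sum as the orthonormal frame in both slots.\<close>

lemma sum_sharp_axis:
  fixes T :: "real^4 \<Rightarrow> real^4 \<Rightarrow> 'a::real_vector"
  assumes "bilinear T"
  shows "(\<Sum>i\<in>UNIV. T (sharp G (axis i 1)) (axis i 1)) = (\<Sum>a\<in>UNIV. T (f a) (f a))"
proof -
  have s: "sharp G (axis i 1) = (\<Sum>a\<in>UNIV. (f a $ i) *\<^sub>R f a)" for i
  proof (rule sharp_eqI)
    fix w
    have "G (\<Sum>a\<in>UNIV. (f a $ i) *\<^sub>R f a) w = (\<Sum>a\<in>UNIV. f a $ i * (e a \<bullet> w))"
      by (simp only: linear_sum[OF G_linear(2)] linear_scale[OF G_linear(2)] G_f real_scaleR_def)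
    also have "\<dots> = (\<Sum>a\<in>UNIV. (e a \<bullet> w) *\<^sub>R f a) $ i" by (simp add: mult.commute)
    also have "\<dots> = axis i 1 \<bullet> w" using vector_expand[of w] by (simp add: inner_axis')
    finally show "G (\<Sum>a\<in>UNIV. (f a $ i) *\<^sub>R f a) w = axis i 1 \<bullet> w" .
  qed
  have l: "linear (T v)" "linear (\<lambda>v. T v w)" for v w using assms by (auto simp: bilinear_def)
  have "(\<Sum>i\<in>UNIV. T (sharp G (axis i 1)) (axis i 1)) = (\<Sum>i\<in>UNIV. \<Sum>a\<in>UNIV. (f a $ i) *\<^sub>R T (f a) (axis i 1))"
    by (simp only: s linear_sum[OF l(2)] linear_scale[OF l(2)])
  also have "\<dots> = (\<Sum>a\<in>UNIV. T (f a) (\<Sum>i\<in>UNIV. (f a $ i) *\<^sub>R axis i 1))"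
    by (subst sum.swap) (simp only: linear_sum[OF l(1)] linear_scale[OF l(1)])
  also have "\<dots> = (\<Sum>a\<in>UNIV. T (f a) (f a))"
    by (simp add: basis_expansion scalar_mult_eq_scaleR[symmetric])
  finally show ?thesis .
qed

lemma volume_form_linear:
  "linear (\<lambda>a. volume_form G a b c d)" "linear (\<lambda>b. volume_form G a b c d)"
  by (rule linearI; simp add: volume_form_frame det_4 inner_add_right algebra_simps)+

text \<open>One application of \<open>sum_sharp_axis\<close> for each contracted index.\<close>

lemma hodge_star_frame:
  fixes \<beta> :: "real^4 \<Rightarrow> real^4 \<Rightarrow> 'a::real_vector"
  assumes "bilinear \<beta>"
  shows "hodge_star G \<beta> v w =
    (1/2) *\<^sub>R (\<Sum>i\<in>UNIV. \<Sum>j\<in>UNIV. volume_form G (f i) (f j) v w *\<^sub>R \<beta> (f i) (f j))"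
proof -
  have l: "linear (\<beta> y)" "linear (\<lambda>y. \<beta> y z)" for y z using assms by (auto simp: bilinear_def)
  let ?s = "\<lambda>i. sharp G (axis i 1)"
  have b1: "bilinear (\<lambda>y z. volume_form G u y v w *\<^sub>R \<beta> u' z)" for u u'
    unfolding bilinear_def
    by (auto intro!: linearI simp: linear_add[OF volume_form_linear(2)] linear_scale[OF volume_form_linear(2)]
        linear_add[OF l(1)] linear_scale[OF l(1)] scaleR_add_left scaleR_add_right)
  have b2: "bilinear (\<lambda>y z. volume_form G y u v w *\<^sub>R \<beta> z u')" for u u'
    unfolding bilinear_def
    by (auto intro!: linearI simp: linear_add[OF volume_form_linear(1)] linear_scale[OF volume_form_linear(1)]
        linear_add[OF l(2)] linear_scale[OF l(2)] scaleR_add_left scaleR_add_right)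
  have "(\<Sum>i\<in>UNIV. \<Sum>j\<in>UNIV. volume_form G (?s i) (?s j) v w *\<^sub>R \<beta> (axis i 1) (axis j 1)) =
     (\<Sum>i\<in>UNIV. \<Sum>j\<in>UNIV. volume_form G (?s i) (f j) v w *\<^sub>R \<beta> (axis i 1) (f j))"
    by (rule sum.cong[OF refl]) (rule sum_sharp_axis[OF b1])
  also have "\<dots> = (\<Sum>j\<in>UNIV. \<Sum>i\<in>UNIV. volume_form G (?s i) (f j) v w *\<^sub>R \<beta> (axis i 1) (f j))"
    by (rule sum.swap)
  also have "\<dots> = (\<Sum>j\<in>UNIV. \<Sum>i\<in>UNIV. volume_form G (f i) (f j) v w *\<^sub>R \<beta> (f i) (f j))"
    by (rule sum.cong[OF refl]) (rule sum_sharp_axis[OF b2])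
  also have "\<dots> = (\<Sum>i\<in>UNIV. \<Sum>j\<in>UNIV. volume_form G (f i) (f j) v w *\<^sub>R \<beta> (f i) (f j))"
    by (rule sum.swap)
  finally show ?thesis by (simp add: hodge_star_def)
qed

text \<open>The three equations say that \<beta> is a combination of e^01 + e^23, e^02 + e^31 and
  e^03 + e^12, each of which the star fixes.\<close>

lemma self_dual_of_frame:
  fixes \<beta> :: "real^4 \<Rightarrow> real^4 \<Rightarrow> 'a::real_vector"
  assumes b: "bilinear \<beta>" and anti: "\<And>v w. \<beta> v w = - \<beta> w v"
    and sd: "\<beta> (f 2) (f 3) = \<beta> (f 0) (f 1)" "\<beta> (f 3) (f 1) = \<beta> (f 0) (f 2)" "\<beta> (f 1) (f 2) = \<beta> (f 0) (f 3)"
  shows "hodge_star G \<beta> v w = \<beta> v w"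
proof -
  have l: "linear (\<beta> y)" "linear (\<lambda>y. \<beta> y z)" for y z using b by (auto simp: bilinear_def)
  have z: "\<beta> y y = 0" for y
  proof -
    have "\<beta> y y + \<beta> y y = 0" using anti[of y y] by (simp add: eq_neg_iff_add_eq_0)
    then have "2 *\<^sub>R \<beta> y y = 0" by (simp only: scaleR_2)
    then show ?thesis by simp
  qed
  have t: "\<beta> (f 1) (f 0) = - \<beta> (f 0) (f 1)" "\<beta> (f 2) (f 0) = - \<beta> (f 0) (f 2)" "\<beta> (f 3) (f 0) = - \<beta> (f 0) (f 3)"
    "\<beta> (f 2) (f 1) = - \<beta> (f 0) (f 3)" "\<beta> (f 1) (f 3) = - \<beta> (f 0) (f 2)" "\<beta> (f 3) (f 2) = - \<beta> (f 0) (f 1)"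
    using anti sd by metis+
  define V W where "V = (\<lambda>i. e i \<bullet> v)" and "W = (\<lambda>i. e i \<bullet> w)"
  have v: "v = (\<Sum>i\<in>UNIV. V i *\<^sub>R f i)" and w: "w = (\<Sum>i\<in>UNIV. W i *\<^sub>R f i)"
    unfolding V_def W_def by (rule vector_expand)+
  have "\<beta> v w = (\<Sum>i\<in>UNIV. V i *\<^sub>R (\<Sum>j\<in>UNIV. W j *\<^sub>R \<beta> (f i) (f j)))"
    by (subst v, subst w) (simp only: linear_sum[OF l(2)] linear_scale[OF l(2)], simp only: linear_sum[OF l(1)] linear_scale[OF l(1)])
  also have "\<dots> = (V 0 * W 1 - V 1 * W 0 + V 2 * W 3 - V 3 * W 2) *\<^sub>R \<beta> (f 0) (f 1)
     + (V 0 * W 2 - V 2 * W 0 + V 3 * W 1 - V 1 * W 3) *\<^sub>R \<beta> (f 0) (f 2)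
     + (V 0 * W 3 - V 3 * W 0 + V 1 * W 2 - V 2 * W 1) *\<^sub>R \<beta> (f 0) (f 3)"
    by (simp add: sum_4' z t sd algebra_simps)
  also have "\<dots> = hodge_star G \<beta> v w"
    unfolding hodge_star_frame[OF b]
    by (simp add: sum_4' z t sd volume_form_frame det_4 e_f V_def[symmetric] W_def[symmetric] algebra_simps)
      (simp add: scaleR_add_left[symmetric])
  finally show ?thesis ..
qed

lemma volume_form_linear_last: "linear (\<lambda>d. volume_form G a b c d)"
  by (rule linearI; simp add: volume_form_frame det_4 inner_add_right algebra_simps)

text \<open>Brings the Ricci trace, defined by a coordinate matrix, into the orthonormal
  frame.\<close>

lemma trace_frame:
  assumes "linear L"
  shows "trace (matrix L) = (\<Sum>i\<in>UNIV. G (L (sharp G (e i))) (sharp G (e i)))"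
proof -
  have "bilinear (\<lambda>y z. G (L z) y)"
    unfolding bilinear_def
    by (auto intro!: linearI simp: G_simps linear_add[OF assms] linear_scale[OF assms])
  from sum_sharp_axis[OF this]
  have "(\<Sum>i\<in>UNIV. G (L (axis i 1)) (sharp G (axis i 1))) = (\<Sum>i\<in>UNIV. G (L (f i)) (f i))" .
  moreover have "G (L (axis i 1)) (sharp G (axis i 1)) = L (axis i 1) $ i" for i
    by (subst G_sym) (simp add: G_sharp inner_axis')
  ultimately show ?thesis by (simp add: trace_def matrix_def f_def)
qed

end

section \<open>The Lie algebra su(2) and the half-spin representation\<close>

text \<open>Coordinates on su(2). The matrices \<open>sigma 1\<close>, \<open>sigma 2\<close>,
  \<open>sigma 3\<close> are quaternion units with
  \<open>sigma 1 ** sigma 2 = sigma 3\<close>.\<close>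

definition pauli_combination :: "real \<Rightarrow> real \<Rightarrow> real \<Rightarrow> complex^2^2" where
  "pauli_combination a b c = a *\<^sub>R sigma 1 + b *\<^sub>R sigma 2 + c *\<^sub>R sigma 3"

lemma sigma_entries:
  "sigma 1 $ 1 $ 1 = \<i>" "sigma 1 $ 1 $ 2 = 0" "sigma 1 $ 2 $ 1 = 0" "sigma 1 $ 2 $ 2 = - \<i>"
  "sigma 2 $ 1 $ 1 = 0" "sigma 2 $ 1 $ 2 = 1" "sigma 2 $ 2 $ 1 = -1" "sigma 2 $ 2 $ 2 = 0"
  "sigma 3 $ 1 $ 1 = 0" "sigma 3 $ 1 $ 2 = \<i>" "sigma 3 $ 2 $ 1 = \<i>" "sigma 3 $ 2 $ 2 = 0"
  by (simp_all add: sigma_def vector_def)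

lemma complex_matrix_eqI:
  fixes A B :: "complex^2^2"
  assumes "A $ 1 $ 1 = B $ 1 $ 1" "A $ 1 $ 2 = B $ 1 $ 2" "A $ 2 $ 1 = B $ 2 $ 1" "A $ 2 $ 2 = B $ 2 $ 2"
  shows "A = B"
  using assms by (simp add: vec_eq_iff forall_2)

lemma pauli_combination_entries:
  "pauli_combination a b c $ 1 $ 1 = Complex 0 a" "pauli_combination a b c $ 1 $ 2 = Complex b c"
  "pauli_combination a b c $ 2 $ 1 = Complex (-b) c" "pauli_combination a b c $ 2 $ 2 = Complex 0 (-a)"
  by (simp_all add: pauli_combination_def sigma_entries complex_eq_iff)

lemma pauli_combination_su2: "pauli_combination a b c \<in> su2"
  by (auto simp: su2_def ctranspose_def trace_def sum_2 pauli_combination_entries complex_eq_iff intro!: complex_matrix_eqI)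

lemma su2_entries:
  assumes "\<rho> \<in> su2"
  shows "\<rho> $ 2 $ 2 = - \<rho> $ 1 $ 1" "\<rho> $ 2 $ 1 = - cnj (\<rho> $ 1 $ 2)" "Re (\<rho> $ 1 $ 1) = 0"
proof -
  have c: "ctranspose \<rho> = - \<rho>" and t: "trace \<rho> = 0" using assms by (auto simp: su2_def)
  show "\<rho> $ 2 $ 2 = - \<rho> $ 1 $ 1" using t by (simp add: trace_def sum_2 eq_neg_iff_add_eq_0 add.commute)
  have "ctranspose \<rho> $ i $ j = - \<rho> $ i $ j" for i j unfolding c by simp
  then have h: "cnj (\<rho> $ j $ i) = - \<rho> $ i $ j" for i j by (simp add: ctranspose_def)
  show "\<rho> $ 2 $ 1 = - cnj (\<rho> $ 1 $ 2)" using h[of 1 2] by simp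
  show "Re (\<rho> $ 1 $ 1) = 0" using arg_cong[OF h[of 1 1], of Re] by simp
qed

lemma su2_pauli:
  assumes "\<rho> \<in> su2"
  shows "\<rho> = pauli_combination (Im (\<rho> $ 1 $ 1)) (Re (\<rho> $ 1 $ 2)) (Im (\<rho> $ 1 $ 2))"
  by (rule complex_matrix_eqI) (simp_all add: pauli_combination_entries su2_entries[OF assms] complex_eq_iff)

lemma pauli_combination_inject:
  "pauli_combination a b c = pauli_combination a' b' c' \<longleftrightarrow> a = a' \<and> b = b' \<and> c = c'"
proof
  assume h: "pauli_combination a b c = pauli_combination a' b' c'"
  then show "a = a' \<and> b = b' \<and> c = c'"
    using pauli_combination_entries(1)[of a b c] pauli_combination_entries(1)[of a' b' c']
      pauli_combination_entries(2)[of a b c] pauli_combination_entries(2)[of a' b' c'] by simp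
qed auto

text \<open>Twice the cross product of the coefficient vectors; the 2 is what the halves in the
  residue absorb.\<close>

lemma pauli_commutator:
  "pauli_combination a b c ** pauli_combination a' b' c' - pauli_combination a' b' c' ** pauli_combination a b c =
    pauli_combination (2 * (b * c' - c * b')) (2 * (c * a' - a * c')) (2 * (a * b' - b * a'))"
  by (rule complex_matrix_eqI)
    (simp_all add: matrix_matrix_mult_def sum_2 pauli_combination_entries complex_eq_iff algebra_simps)

text \<open>The block of \<open>standard_clifford\<close> from S_+ to S_-; minus the identity is the
  lower left block of the matrix of e^0.\<close>

definition spin_matrix :: "4 \<Rightarrow> complex^2^2" where
  "spin_matrix i = (if i = 0 then - mat 1 else sigma i)"

text \<open>The relation for \<open>i = 0\<close> determines \<open>N\<close>; those for \<open>i = 1\<close> and \<open>i = 2\<close> then determine \<open>\<rho>\<close>.\<close>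

lemma spin_lift_unique:
  fixes \<rho> N :: "complex^2^2" and d :: "4 \<Rightarrow> 4 \<Rightarrow> real"
  assumes \<rho>: "\<rho> \<in> su2" and d: "\<And>i j. d i j = - d j i"
    and rel: "\<And>i. N ** spin_matrix i = (\<Sum>j\<in>UNIV. d i j *\<^sub>R spin_matrix j) + spin_matrix i ** \<rho>"
  shows "\<rho> = pauli_combination ((d 0 1 + d 2 3) / 2) ((d 0 2 + d 3 1) / 2) ((d 0 3 + d 1 2) / 2)"
proof -
  have d0: "d i i = 0" for i using d[of i i] by simp
  note r = su2_entries[OF \<rho>]
  have ent: "(N ** spin_matrix i) $ k $ l = ((\<Sum>j\<in>UNIV. d i j *\<^sub>R spin_matrix j) + spin_matrix i ** \<rho>) $ k $ l" for i k l
    by (simp only: rel)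
  note s = matrix_matrix_mult_def sum_2 sum_4' spin_matrix_def sigma_entries mat_def d0
  have n12: "N $ 1 $ 2 = \<rho> $ 1 $ 2 - Complex (d 0 2) (d 0 3)" and n11: "N $ 1 $ 1 = \<rho> $ 1 $ 1 - Complex 0 (d 0 1)"
    using ent[of 0 1 2] ent[of 0 1 1] by (simp_all add: s complex_eq_iff algebra_simps)
  have "\<rho> $ 1 $ 2 = Complex ((d 0 2 + d 3 1) / 2) ((d 0 3 + d 1 2) / 2)"
    using ent[of 1 1 2] n12 d[of 3 1] by (simp add: s complex_eq_iff algebra_simps)
  moreover have "\<rho> $ 1 $ 1 = Complex 0 ((d 0 1 + d 2 3) / 2)"
    using ent[of 2 1 2] n11 r by (simp add: s complex_eq_iff algebra_simps)
  ultimately show ?thesis by (subst su2_pauli[OF \<rho>]) simp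
qed

lemma pauli_combination_linear:
  "pauli_combination (a + a') (b + b') (c + c') = pauli_combination a b c + pauli_combination a' b' c'"
  "pauli_combination (r * a) (r * b) (r * c) = r *\<^sub>R pauli_combination a b c"
  "pauli_combination (- a) (- b) (- c) = - pauli_combination a b c"
  by (simp_all add: pauli_combination_def algebra_simps)

context frame4
begin

text \<open>Pair symmetry makes \<open>R\<close> a symmetric operator on 2-forms; its block between
  self-dual and anti-self-dual forms is the trace-free Ricci tensor, which the Einstein equation
  kills. Since \<beta> is the self-dual half in the last two arguments, it becomes self-dual in the
  first two.\<close>

lemma einstein_self_dual:
  fixes R :: "real^4 \<Rightarrow> real^4 \<Rightarrow> real^4 \<Rightarrow> real^4 \<Rightarrow> real"
  assumes lin: "\<And>w y z. linear (\<lambda>v. R v w y z)"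
    and anti: "\<And>v w y z. R v w y z = - R w v y z" and skew: "\<And>v w y z. R v w y z = - R v w z y"
    and pair: "\<And>v w y z. R v w y z = R y z v w"
    and ric: "\<And>v w. (\<Sum>i\<in>UNIV. R (f i) v w (f i)) + 3 * G v w = 0"
    and \<beta>: "\<And>v w. \<beta> v w = pauli_combination ((R v w (f 0) (f 1) + R v w (f 2) (f 3)) / 2)
      ((R v w (f 0) (f 2) + R v w (f 3) (f 1)) / 2) ((R v w (f 0) (f 3) + R v w (f 1) (f 2)) / 2)"
  shows "hodge_star G \<beta> v w = \<beta> v w"
proof (rule self_dual_of_frame)
  have lin2: "linear (\<lambda>w. R v w y z)" for v y z
    using linear_compose_neg[OF lin[of v y z]] by (simp add: anti[of v _ y z])
  have lin': "R (v + v') w y z = R v w y z + R v' w y z" "R (r *\<^sub>R v) w y z = r * R v w y z"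
    "R w (v + v') y z = R w v y z + R w v' y z" "R w (r *\<^sub>R v) y z = r * R w v y z" for v v' w y z r
    using linear_add[OF lin] linear_scale[OF lin] linear_add[OF lin2] linear_scale[OF lin2] by simp_all
  show "bilinear \<beta>"
    unfolding bilinear_def
    by (intro conjI allI linearI; unfold \<beta> lin' pauli_combination_linear[symmetric]; simp add: algebra_simps add_divide_distrib)
  show "\<beta> v w = - \<beta> w v" for v w
    unfolding \<beta> pauli_combination_linear[symmetric]
    by (simp add: anti[of v w] pauli_combination_inject field_simps)
  let ?r = "\<lambda>a b c d. R (f a) (f b) (f c) (f d)"
  have z1: "R v v y z = 0" for v y z using anti[of v v y z] by simp
  have z2: "R v w y y = 0" for v w y using skew[of v w y y] by simp
  \<comment> \<open>The rules \<open>a\<close>, \<open>s\<close> and \<open>p\<close> bring every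
    component to increasing index pairs in lexicographic order, so that the ten Ricci equations
    become linear equations between the same unknowns.\<close>
  have a: "R (f 1) (f 0) y z = - R (f 0) (f 1) y z" "R (f 2) (f 0) y z = - R (f 0) (f 2) y z"
    "R (f 3) (f 0) y z = - R (f 0) (f 3) y z" "R (f 2) (f 1) y z = - R (f 1) (f 2) y z"
    "R (f 3) (f 1) y z = - R (f 1) (f 3) y z" "R (f 3) (f 2) y z = - R (f 2) (f 3) y z" for y z
    by (rule anti)+
  have s: "R y z (f 1) (f 0) = - R y z (f 0) (f 1)" "R y z (f 2) (f 0) = - R y z (f 0) (f 2)"
    "R y z (f 3) (f 0) = - R y z (f 0) (f 3)" "R y z (f 2) (f 1) = - R y z (f 1) (f 2)"
    "R y z (f 3) (f 1) = - R y z (f 1) (f 3)" "R y z (f 3) (f 2) = - R y z (f 2) (f 3)" for y z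
    by (rule skew)+
  have p: "?r 0 2 0 1 = ?r 0 1 0 2" "?r 0 3 0 1 = ?r 0 1 0 3" "?r 1 2 0 1 = ?r 0 1 1 2" "?r 1 3 0 1 = ?r 0 1 1 3"
    "?r 2 3 0 1 = ?r 0 1 2 3" "?r 0 3 0 2 = ?r 0 2 0 3" "?r 1 2 0 2 = ?r 0 2 1 2" "?r 1 3 0 2 = ?r 0 2 1 3"
    "?r 2 3 0 2 = ?r 0 2 2 3" "?r 1 2 0 3 = ?r 0 3 1 2" "?r 1 3 0 3 = ?r 0 3 1 3" "?r 2 3 0 3 = ?r 0 3 2 3"
    "?r 1 3 1 2 = ?r 1 2 1 3" "?r 2 3 1 2 = ?r 1 2 2 3" "?r 2 3 1 3 = ?r 1 3 2 3"
    by (rule pair)+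
  note n = sum_4' z1 z2 a s p G_f e_f
  note ric' = ric[of "f 0" "f 0"] ric[of "f 1" "f 1"] ric[of "f 2" "f 2"] ric[of "f 3" "f 3"]
    ric[of "f 0" "f 1"] ric[of "f 0" "f 2"] ric[of "f 0" "f 3"] ric[of "f 1" "f 2"] ric[of "f 1" "f 3"] ric[of "f 2" "f 3"]
  \<comment> \<open>Nine equations, equivalent to the vanishing of the mixed 3 by 3 block: the
    diagonal Ricci entries give the first three, the off-diagonal ones the other six.\<close>
  have r: "?r 0 1 0 1 = ?r 2 3 2 3" "?r 0 2 0 2 = ?r 1 3 1 3" "?r 0 3 0 3 = ?r 1 2 1 2"
    "?r 0 2 1 2 = - ?r 0 3 1 3" "?r 0 1 1 2 = ?r 0 3 2 3" "?r 0 1 1 3 = - ?r 0 2 2 3"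
    "?r 0 1 0 2 = - ?r 1 3 2 3" "?r 0 1 0 3 = ?r 1 2 2 3" "?r 0 2 0 3 = - ?r 1 2 1 3"
    using ric' by (simp_all add: n)
  show "\<beta> (f 2) (f 3) = \<beta> (f 0) (f 1)" "\<beta> (f 3) (f 1) = \<beta> (f 0) (f 2)" "\<beta> (f 1) (f 2) = \<beta> (f 0) (f 3)"
    using r by (simp_all add: \<beta> n pauli_combination_inject)
qed

end

lemma herm_simps:
  "herm (u + u') w = herm u w + herm u' w" "herm w (u + u') = herm w u + herm w u'"
  "herm (k *s u) w = k * herm u w" "herm w (k *s u) = cnj k * herm w u"
  "herm (u - u') w = herm u w - herm u' w"
  by (simp_all add: herm_def sum_2 algebra_simps)

lemma herm_eqI: "(\<And>w. herm u w = herm u' w) \<Longrightarrow> u = u'"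
proof -
  assume h: "\<And>w. herm u w = herm u' w"
  have "u $ i = u' $ i" for i
    using h[of "axis i 1"] by (simp add: herm_def axis_def if_distrib sum.delta cong: if_cong)
  then show ?thesis by (simp add: vec_eq_iff)
qed

lemma bounded_bilinear_herm: "bounded_bilinear herm"
proof -
  have "bilinear herm"
    by (auto simp: bilinear_def herm_def sum_2 algebra_simps intro!: linearI)
  then show ?thesis by (simp add: bilinear_conv_bounded_bilinear)
qed

lemma bounded_bilinear_cvol: "bounded_bilinear cvol"
proof -
  have "bilinear cvol"
    by (auto simp: bilinear_def cvol_def algebra_simps intro!: linearI)
  then show ?thesis by (simp add: bilinear_conv_bounded_bilinear)
qed

lemma complex2_expand: "(u :: complex^2) = u $ 1 *s axis 1 1 + u $ 2 *s axis 2 1"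
  by (simp add: vec_eq_iff forall_2 axis_def)

text \<open>Skewness for a nondegenerate form forces linearity: moving the map to the other slot
  shows that it respects sums and complex multiples. This supplies linearity for maps built from
  arbitrary choices of extensions.\<close>

lemma skew_hermitian_matrix:
  assumes "\<And>u w. herm (L u) w + herm u (L w) = 0"
  shows "L u = matrix L *v u" and "ctranspose (matrix L) = - matrix L"
proof -
  have h: "herm (L u) w = - herm u (L w)" for u w using assms[of u w] by (simp add: eq_neg_iff_add_eq_0)
  have add: "L (u + v) = L u + L v" for u v
    by (rule herm_eqI) (simp add: h herm_simps)
  have scale: "L (k *s u) = k *s L u" for k u
    by (rule herm_eqI) (simp add: h herm_simps)
  have "L u = L (u $ 1 *s axis 1 1 + u $ 2 *s axis 2 1)" by (subst complex2_expand[of u]) (rule refl)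
  also have "\<dots> = u $ 1 *s L (axis 1 1) + u $ 2 *s L (axis 2 1)" by (simp only: add scale)
  finally show e: "L u = matrix L *v u"
    by (simp add: matrix_def matrix_vector_mult_def vec_eq_iff sum_2 mult.commute)
  have "ctranspose (matrix L) $ i $ j = - matrix L $ i $ j" for i j
  proof -
    have "herm (L (axis i 1)) (axis j 1) = matrix L $ j $ i" for i j
      by (simp add: herm_def matrix_def axis_def if_distrib sum.delta cong: if_cong)
    moreover have "herm (axis i 1) (L (axis j 1)) = cnj (matrix L $ i $ j)" for i j
      by (simp add: herm_def matrix_def axis_def if_distrib sum.delta if_distribR cong: if_cong)
    ultimately show ?thesis using h[of "axis j 1" "axis i 1"] by (simp add: ctranspose_def)
  qed
  then show "ctranspose (matrix L) = - matrix L" by (simp add: vec_eq_iff)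
qed

text \<open>On the standard basis, skewness for \<open>cvol\<close> is the vanishing of the
  trace.\<close>

lemma skew_su2_matrix:
  assumes "\<And>u w. herm (L u) w + herm u (L w) = 0" and "\<And>u w. cvol (L u) w + cvol u (L w) = 0"
  shows "matrix L \<in> su2"
proof -
  have "trace (matrix L) = 0"
    using assms(2)[of "axis 1 1" "axis 2 1"] by (simp add: trace_def sum_2 cvol_def matrix_def axis_def)
  then show ?thesis using skew_hermitian_matrix(2)[OF assms(1)] by (simp add: su2_def)
qed

lemma SU2_unitary:
  assumes "a \<in> SU2"
  shows "herm (a *v u) (a *v w) = herm u w" and "cvol (a *v u) (a *v w) = cvol u w"
proof -
  have c: "ctranspose a ** a = mat 1" and d: "det a = 1" using assms by (auto simp: SU2_def)
  have "(ctranspose a ** a) $ i $ j = mat 1 $ i $ j" for i j unfolding c ..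
  then have e: "cnj (a $ 1 $ i) * a $ 1 $ j + cnj (a $ 2 $ i) * a $ 2 $ j = (if i = j then 1 else 0)" for i j
    by (simp add: ctranspose_def matrix_matrix_mult_def sum_2 mat_def)
  have "herm (a *v u) (a *v w) =
    u $ 1 * cnj (w $ 1) * (cnj (a $ 1 $ 1) * a $ 1 $ 1 + cnj (a $ 2 $ 1) * a $ 2 $ 1) +
    u $ 2 * cnj (w $ 1) * (cnj (a $ 1 $ 1) * a $ 1 $ 2 + cnj (a $ 2 $ 1) * a $ 2 $ 2) +
    u $ 1 * cnj (w $ 2) * (cnj (a $ 1 $ 2) * a $ 1 $ 1 + cnj (a $ 2 $ 2) * a $ 2 $ 1) +
    u $ 2 * cnj (w $ 2) * (cnj (a $ 1 $ 2) * a $ 1 $ 2 + cnj (a $ 2 $ 2) * a $ 2 $ 2)"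
    by (simp add: herm_def matrix_vector_mult_def sum_2 algebra_simps)
  then show "herm (a *v u) (a *v w) = herm u w" unfolding e by (simp add: herm_def sum_2)
  have "cvol (a *v u) (a *v w) = det a * cvol u w"
    by (simp add: cvol_def matrix_vector_mult_def sum_2 det_2 algebra_simps)
  then show "cvol (a *v u) (a *v w) = cvol u w" unfolding d by simp
qed

lemma mat1_SU2: "mat 1 \<in> SU2"
proof -
  have "ctranspose (mat 1 :: complex^2^2) = mat 1"
    by (simp add: ctranspose_def mat_def vec_eq_iff forall_2)
  then show ?thesis by (simp add: SU2_def)
qed

section \<open>Levi-Civita spin connections\<close>

text \<open>The classical combination of four Bianchi identities, one for each argument held in the
  last slot.\<close>

lemma curvature_pair_symmetry:
  fixes R :: "'a \<Rightarrow> 'a \<Rightarrow> 'a \<Rightarrow> 'a \<Rightarrow> real"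
  assumes anti: "\<And>v w y z. R v w y z = - R w v y z" and skew: "\<And>v w y z. R v w y z = - R v w z y"
    and bianchi: "\<And>v w y z. R v w y z + R w y v z + R y v w z = 0"
  shows "R v w y z = R y z v w"
proof -
  have "R z w y v = R w z v y" "R v y z w = R y v w z"
    using anti[of z w y v] skew[of w z y v] anti[of v y z w] skew[of y v z w] by simp_all
  then show ?thesis
    using bianchi[of v w y z] bianchi[of w y z v] bianchi[of y z v w] bianchi[of z v w y]
      skew[of w y z v] skew[of z v w y] skew[of v w z y] skew[of y z w v] by linarith
qed

text \<open>A witness \<open>nab'\<close> of the dual connection, existentially quantified in
  \<open>levi_civita_spin_connections\<close>, is fixed as a parameter.\<close>

locale poincare_einstein_spin = zero_manifold M x for M :: "'m::t2_space chart set" and x +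
  fixes g :: "'m \<Rightarrow> real^4 \<Rightarrow> real^4 \<Rightarrow> real"
    and nab :: "('m \<Rightarrow> real^4) \<Rightarrow> ('m \<Rightarrow> real^4) \<Rightarrow> 'm \<Rightarrow> real^4"
    and Sp Sm :: "('m, complex^2) vbundle"
    and c :: "'m \<Rightarrow> real^4 \<Rightarrow> (complex^2) \<times> (complex^2) \<Rightarrow> (complex^2) \<times> (complex^2)"
    and Ap Am :: "('m \<Rightarrow> real^4) \<Rightarrow> ('m \<Rightarrow> complex^2) \<Rightarrow> 'm \<Rightarrow> complex^2"
    and nab' :: "('m \<Rightarrow> real^4) \<Rightarrow> ('m \<Rightarrow> real^4) \<Rightarrow> 'm \<Rightarrow> real^4"
  assumes metric: "conformally_compact_metric M x g" and LC: "levi_civita M x g nab"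
    and einstein: "ricci M x nab p v w + 3 * g p v w = 0"
    and spin: "zero_spin_structure M x g Sp Sm c"
    and Ap: "su2_connection M x Sp Ap" and Am: "su2_connection M x Sm Am"
    and dual: "dual_connection M x nab nab'"
    and spin_compat: "\<And>V \<alpha> s t p. zero_field M V \<Longrightarrow> phg (zero_cotangent_bundle M) \<alpha> \<Longrightarrow>
      phg Sp s \<Longrightarrow> phg Sm t \<Longrightarrow>
      (Ap V (\<lambda>q. fst (c q (\<alpha> q) (s q, t q))) p, Am V (\<lambda>q. snd (c q (\<alpha> q) (s q, t q))) p) =
        c p (nab' V \<alpha> p) (s p, t p) + c p (\<alpha> p) (Ap V s p, Am V t p)"
begin

abbreviation "TM \<equiv> zero_tangent_bundle M"
abbreviation "coTM \<equiv> zero_cotangent_bundle M"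
abbreviation "ext_field \<equiv> extend M TM"

lemma vector_bundles: "vector_bundle M TM" "vector_bundle M coTM" "vector_bundle M Sp" "vector_bundle M Sm"
  using spin tangent_bundle_vector_bundle dual_bundle_vector_bundle[OF tangent_bundle_vector_bundle]
  by (auto simp: zero_spin_structure_def su2_bundle_def)

lemma zero_connections: "zero_connection M x TM nab" "zero_connection M x coTM nab'"
    "zero_connection M x Sp Ap" "zero_connection M x Sm Am"
  using LC dual Ap Am by (auto simp: levi_civita_def dual_connection_def su2_connection_def)

lemmas smooth_phg = vector_bundles[THEN smooth_imp_phg_section[rotated]]
lemmas ext_smooth = vector_bundles[THEN extend_smooth]
lemmas ext_value = vector_bundles[THEN extend_value]

lemma ext_phg: "phg TM (extend M TM p v)" "phg coTM (extend M coTM p v)"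
    "phg Sp (extend M Sp p u)" "phg Sm (extend M Sm p u)"
  by (intro smooth_phg ext_smooth)+

lemma metric_inner: "inner_product4 (g p)"
  using metric by unfold_locales (auto simp: conformally_compact_metric_def)

lemma metric_smooth_int:
  assumes "int_section TM s" "int_section TM t"
  shows "smooth_int (\<lambda>q. g q (s q) (t q))"
proof -
  have "smooth_fun M (UNIV - bdry M) (\<lambda>q. g q (s q) (t q))"
  proof (rule pairing_smooth_int[OF vector_bundles(1,1) _ open_UNIV _ assms])
    show "bilinear (g q)" for q using metric by (auto simp: conformally_compact_metric_def)
    show "smooth_fun M (UNIV - bdry M) (\<lambda>q. g q (s q) (t q))" if "smooth_section M TM s" "smooth_section M TM t" for s t
      using metric that by (auto simp: conformally_compact_metric_def phg_fun_def)
  qed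
  then show ?thesis by (simp add: Compl_eq_Diff_UNIV)
qed

text \<open>Trivialisations act by \<open>SU2\<close>, so the pairing may be evaluated on local
  components.\<close>

lemma su2_pairing_smooth_int:
  assumes E: "su2_bundle M E" and B: "bounded_bilinear B" and inv: "\<And>a u w. a \<in> SU2 \<Longrightarrow> B (a *v u) (a *v w) = B u w"
    and s: "int_section E s" and t: "int_section E t"
  shows "smooth_int (\<lambda>q. B (s q) (t q))"
proof (rule smooth_fun_local)
  fix p
  have vb: "vector_bundle M E" using E by (simp add: su2_bundle_def)
  obtain U T where T: "(U, T) \<in> E" "p \<in> U" by (rule bundle_cover[OF vb])
  have T': "\<forall>p\<in>U. \<exists>a\<in>SU2. T p = (\<lambda>u. a *v u)" using E T unfolding su2_bundle_def by fast
  have "B (T q (s q)) (T q (t q)) = B (s q) (t q)" if "q \<in> U" for q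
    using bspec[OF T' that] inv by auto
  then have "smooth_fun M (U - bdry M) (\<lambda>q. B (s q) (t q))"
    by (intro smooth_fun_cong[OF smooth_fun_bilinear[OF B int_section_triv[OF s T(1)] int_section_triv[OF t T(1)]]]) auto
  then show "\<exists>W'. open W' \<and> p \<in> W' \<and> smooth_fun M (- bdry M \<inter> W') (\<lambda>q. B (s q) (t q))"
    using T bundle_open[OF vb T(1)] by (intro exI[of _ U]) (auto simp: Diff_eq Int_commute)
qed

lemma su2_bundles: "su2_bundle M Sp" "su2_bundle M Sm"
  using spin by (auto simp: zero_spin_structure_def)

lemmas herm_smooth_int = su2_pairing_smooth_int[OF _ bounded_bilinear_herm SU2_unitary(1)]
lemmas cvol_smooth_int = su2_pairing_smooth_int[OF _ bounded_bilinear_cvol SU2_unitary(2)]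

section \<open>Compatibility and skewness of the curvatures\<close>

lemma metric_compat:
  assumes "zero_field M V" "phg TM Y" "phg TM Z"
  shows "zderiv M x V (\<lambda>q. g q (Y q) (Z q)) p = g p (nab V Y p) (Z p) + g p (Y p) (nab V Z p)"
proof -
  have "zderiv M x V (\<lambda>q. g q (Y q) (Z q)) = (\<lambda>p. g p (nab V Y p) (Z p) + g p (Y p) (nab V Z p))"
    using LC assms unfolding levi_civita_def by blast
  from fun_cong[OF this] show ?thesis .
qed

lemma dual_compat:
  assumes "zero_field M V" "phg coTM \<alpha>" "phg TM Y"
  shows "zderiv M x V (\<lambda>q. \<alpha> q \<bullet> Y q) p = nab' V \<alpha> p \<bullet> Y p + \<alpha> p \<bullet> nab V Y p"
proof -
  have "zderiv M x V (\<lambda>q. \<alpha> q \<bullet> Y q) = (\<lambda>p. nab' V \<alpha> p \<bullet> Y p + \<alpha> p \<bullet> nab V Y p)"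
    using dual assms unfolding dual_connection_def by blast
  from fun_cong[OF this] show ?thesis .
qed

lemma su2_compat:
  assumes "su2_connection M x E A" "zero_field M V" "phg E s" "phg E t"
  shows "zderiv M x V (\<lambda>q. herm (s q) (t q)) p = herm (A V s p) (t p) + herm (s p) (A V t p)"
    and "zderiv M x V (\<lambda>q. cvol (s q) (t q)) p = cvol (A V s p) (t p) + cvol (s p) (A V t p)"
proof -
  have "zderiv M x V (\<lambda>q. herm (s q) (t q)) = (\<lambda>p. herm (A V s p) (t p) + herm (s p) (A V t p))"
    "zderiv M x V (\<lambda>q. cvol (s q) (t q)) = (\<lambda>p. cvol (A V s p) (t p) + cvol (s p) (A V t p))"
    using assms unfolding su2_connection_def by blast+
  from this[THEN fun_cong] show
    "zderiv M x V (\<lambda>q. herm (s q) (t q)) p = herm (A V s p) (t p) + herm (s p) (A V t p)"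
    "zderiv M x V (\<lambda>q. cvol (s q) (t q)) p = cvol (A V s p) (t p) + cvol (s p) (A V t p)" .
qed

lemma metric_curvature_skew:
  assumes "zero_field M V" "zero_field M W" "phg TM Y" "phg TM Z"
  shows "g p (curv_op nab V W Y p) (Z p) + g p (Y p) (curv_op nab V W Z p) = 0"
  by (rule pairing_curvature[OF zero_connections(1,1) _ _ metric_compat assms])
    (use metric in \<open>auto simp: conformally_compact_metric_def intro: metric_smooth_int phg_section_imp_int\<close>)

lemma dual_curvature:
  assumes "zero_field M V" "zero_field M W" "phg coTM \<alpha>" "phg TM Y"
  shows "curv_op nab' V W \<alpha> p \<bullet> Y p + \<alpha> p \<bullet> curv_op nab V W Y p = 0"
  by (rule pairing_curvature[OF zero_connections(2,1) _ _ dual_compat assms])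
    (auto intro: dual_pairing_smooth_int[OF vector_bundles(1)] phg_section_imp_int
      simp: bilinear_conv_bounded_bilinear bounded_bilinear_inner)

lemma su2_curvature_skew:
  assumes E: "su2_bundle M E" and A: "su2_connection M x E A"
    and f: "zero_field M V" "zero_field M W" "phg E s" "phg E t"
  shows "herm (curv_op A V W s p) (t p) + herm (s p) (curv_op A V W t p) = 0"
    and "cvol (curv_op A V W s p) (t p) + cvol (s p) (curv_op A V W t p) = 0"
proof -
  have zc: "zero_connection M x E A" using A by (simp add: su2_connection_def)
  show "herm (curv_op A V W s p) (t p) + herm (s p) (curv_op A V W t p) = 0"
    by (rule pairing_curvature[OF zc zc _ _ su2_compat(1)[OF A] f])
      (auto intro: herm_smooth_int[OF E] phg_section_imp_int simp: bilinear_conv_bounded_bilinear bounded_bilinear_herm)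
  show "cvol (curv_op A V W s p) (t p) + cvol (s p) (curv_op A V W t p) = 0"
    by (rule pairing_curvature[OF zc zc _ _ su2_compat(2)[OF A] f])
      (auto intro: cvol_smooth_int[OF E] phg_section_imp_int simp: bilinear_conv_bounded_bilinear bounded_bilinear_cvol)
qed

text \<open>Skewness replaces tensoriality: it forces \<open>Op s\<close> to depend on \<open>s p\<close> only.\<close>

lemma skew_operation_spinor:
  assumes E: "vector_bundle M E"
    and skew: "\<And>s t. phg E s \<Longrightarrow> phg E t \<Longrightarrow> herm (Op s) (t p) + herm (s p) (Op t) = 0"
    and s: "phg E s"
  shows "Op s = matrix (\<lambda>u. Op (extend M E p u)) *v s p"
proof -
  note ph = smooth_imp_phg_section[OF extend_smooth[OF E] E] and val = extend_value[OF E]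
  have "herm (Op (extend M E p u)) w + herm u (Op (extend M E p w)) = 0" for u w
    using skew[OF ph ph, of p u p w] by (simp add: val)
  from skew_hermitian_matrix(1)[OF this, of "s p"]
  have "matrix (\<lambda>u. Op (extend M E p u)) *v s p = Op (extend M E p (s p))" ..
  moreover have "Op s = Op (extend M E p (s p))"
  proof (rule herm_eqI)
    fix w
    show "herm (Op s) w = herm (Op (extend M E p (s p))) w"
      using skew[OF s ph, of p w] skew[OF ph ph, of p "s p" p w]
      by (metis val eq_neg_iff_add_eq_0)
  qed
  ultimately show ?thesis by simp
qed

lemma skew_operation_su2:
  assumes E: "vector_bundle M E"
    and "\<And>s t. phg E s \<Longrightarrow> phg E t \<Longrightarrow> herm (Op s) (t p) + herm (s p) (Op t) = 0"
    and "\<And>s t. phg E s \<Longrightarrow> phg E t \<Longrightarrow> cvol (Op s) (t p) + cvol (s p) (Op t) = 0"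
  shows "matrix (\<lambda>u. Op (extend M E p u)) \<in> su2"
proof (rule skew_su2_matrix)
  note ph = smooth_imp_phg_section[OF extend_smooth[OF E] E] and val = extend_value[OF E]
  fix u w
  show "herm (Op (extend M E p u)) w + herm u (Op (extend M E p w)) = 0"
    "cvol (Op (extend M E p u)) w + cvol u (Op (extend M E p w)) = 0"
    using assms(2,3)[OF ph ph, of p u p w] by (simp_all add: val)
qed

text \<open>The real counterpart for the metric. It is applied to curvature operators and, at
  boundary points, to \<open>nab V\<close> itself: there the derivative in the compatibility
  condition vanishes, which leaves skewness.\<close>

lemma skew_operation_tangent:
  assumes skew: "\<And>Y Z. phg TM Y \<Longrightarrow> phg TM Z \<Longrightarrow> g p (Op Y) (Z p) + g p (Y p) (Op Z) = 0"
  defines "D \<equiv> \<lambda>y. Op (ext_field p y)"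
  shows "phg TM Y \<Longrightarrow> Op Y = D (Y p)" and "linear D" and "g p (D y) z = - g p y (D z)"
proof -
  interpret inner_product4 "g p" by (rule metric_inner)
  have sk: "g p (D y) z = - g p y (D z)" for y z
    using skew[OF ext_phg(1) ext_phg(1), of p y p z] by (simp add: D_def ext_value)
  then show "g p (D y) z = - g p y (D z)" .
  show "linear D"
    by (rule linearI; rule G_eqI) (simp_all add: sk G_simps)
  show "Op Y = D (Y p)" if "phg TM Y"
  proof (rule G_eqI)
    fix w
    show "g p (Op Y) w = g p (D (Y p)) w"
      using skew[OF that ext_phg(1), of p w] by (simp add: sk) (simp add: D_def ext_value)
  qed
qed

text \<open>Only the half from S_+ to S_- is followed: the \<open>snd\<close> component of the
  compatibility condition involves it alone and relates \<open>Ap\<close> to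
  \<open>Am\<close>.\<close>

definition clifford :: "'m \<Rightarrow> real^4 \<Rightarrow> complex^2 \<Rightarrow> complex^2" where
  "clifford p \<alpha> u = snd (c p \<alpha> (u, 0))"

lemma
  shows clifford_linear_left: "linear (\<lambda>\<alpha>. clifford p \<alpha> u)" and clifford_linear_right: "linear (clifford p \<alpha>)"
    and clifford_eq: "snd (c p \<alpha> (u, w)) = clifford p \<alpha> u"
proof -
  have l1: "linear (\<lambda>\<alpha>. c p \<alpha> \<psi>)" for \<psi>
    using spin unfolding zero_spin_structure_def by blast
  have l2: "linear (c p \<alpha>)"
    using spin unfolding zero_spin_structure_def by blast
  have l3: "snd (c p \<alpha> (0, w)) = 0" for w
    using spin unfolding zero_spin_structure_def by blast
  show "linear (\<lambda>\<alpha>. clifford p \<alpha> u)"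
    unfolding clifford_def by (rule linearI) (simp_all add: linear_add[OF l1] linear_scale[OF l1])
  have add: "c p \<alpha> (u + u', w + w') = c p \<alpha> (u, w) + c p \<alpha> (u', w')" for u u' w w'
    using linear_add[OF l2, of "(u, w)" "(u', w')"] by simp
  show "linear (clifford p \<alpha>)"
  proof (rule linearI)
    show "clifford p \<alpha> (u + u') = clifford p \<alpha> u + clifford p \<alpha> u'" for u u'
      using add[of u u' 0 0] by (simp add: clifford_def)
    show "clifford p \<alpha> (r *\<^sub>R u) = r *\<^sub>R clifford p \<alpha> u" for r u
      using linear_scale[OF l2, of r "(u, 0)"] by (simp add: clifford_def)
  qed
  show "snd (c p \<alpha> (u, w)) = clifford p \<alpha> u"
    using add[of u 0 0 w] l3[of w] by (simp add: clifford_def)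
qed

lemma clifford_compat:
  assumes "zero_field M V" "phg coTM \<alpha>" "phg Sp s"
  shows "Am V (\<lambda>q. clifford q (\<alpha> q) (s q)) p = clifford p (nab' V \<alpha> p) (s p) + clifford p (\<alpha> p) (Ap V s p)"
proof -
  \<comment> \<open>A filler for the S_- slot, which the second component of \<open>c\<close> does
    not see.\<close>
  let ?t = "extend M Sm p 0"
  have "(Ap V (\<lambda>q. fst (c q (\<alpha> q) (s q, ?t q))) p, Am V (\<lambda>q. snd (c q (\<alpha> q) (s q, ?t q))) p) =
      c p (nab' V \<alpha> p) (s p, ?t p) + c p (\<alpha> p) (Ap V s p, Am V ?t p)"
    by (rule spin_compat[OF assms ext_phg(4)])
  from arg_cong[OF this, of snd] show ?thesis by (simp add: clifford_eq)
qed

lemma clifford_phg: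
  assumes "smooth_section M coTM \<alpha>" "smooth_section M Sp s"
  shows "phg Sm (\<lambda>q. clifford q (\<alpha> q) (s q))"
proof -
  let ?t = "extend M Sm undefined 0"
  have "phg Sm (\<lambda>q. snd (c q (\<alpha> q) (s q, ?t q)))"
    by (rule spin[unfolded zero_spin_structure_def, THEN conjunct2, THEN conjunct2, THEN conjunct2,
          rule_format, of \<alpha> s ?t, THEN conjunct2]) (simp add: assms ext_smooth)
  then show ?thesis by (simp add: clifford_eq)
qed

lemma clifford_int:
  assumes "int_section coTM \<alpha>" "int_section Sp s"
  shows "int_section Sm (\<lambda>q. clifford q (\<alpha> q) (s q))"
proof (rule int_sectionI)
  fix U T assume T: "(U, T) \<in> Sm"
  show "smooth_fun M (U - bdry M) (\<lambda>q. T q (clifford q (\<alpha> q) (s q)))"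
  proof (rule pairing_smooth_int[OF vector_bundles(2,3) _ bundle_open[OF vector_bundles(4) T] _ assms])
    show "bilinear (\<lambda>\<alpha> u. T q (clifford q \<alpha> u))" if "q \<in> U" for q
      unfolding bilinear_def
      using linear_compose[OF clifford_linear_left bundle_linear[OF vector_bundles(4) T that], of q]
        linear_compose[OF clifford_linear_right bundle_linear[OF vector_bundles(4) T that], of q]
      by (simp add: comp_def)
    show "smooth_fun M (U - bdry M) (\<lambda>q. T q (clifford q (\<alpha> q) (s q)))"
      if "smooth_section M coTM \<alpha>" "smooth_section M Sp s" for \<alpha> s
      by (rule int_section_triv[OF phg_section_imp_int[OF clifford_phg[OF that]] T])
  qed
qed

text \<open>Sections supported away from the boundary are used because products of polyhomogeneous
  functions are then smooth; this suffices as curvature at \<open>p\<close> only depends on values at \<open>p\<close>.\<close>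

lemma clifford_curvature:
  assumes p: "p \<notin> bdry M" and V: "zero_field M V" and W: "zero_field M W" and s: "phg Sp s"
  shows "\<exists>\<alpha>. phg coTM \<alpha> \<and> \<alpha> p = \<alpha>0 \<and> phg Sm (\<lambda>q. clifford q (\<alpha> q) (s q)) \<and>
    curv_op Am V W (\<lambda>q. clifford q (\<alpha> q) (s q)) p =
      clifford p (curv_op nab' V W \<alpha> p) (s p) + clifford p (\<alpha> p) (curv_op Ap V W s p)"
proof -
  obtain \<eta> :: "'m \<Rightarrow> real" and K where \<eta>: "smooth_fun M UNIV \<eta>" "\<eta> p = 1" "\<And>q. \<eta> q \<ge> 0"
    "closed K" "K \<subseteq> - bdry M" "\<And>q. q \<notin> K \<Longrightarrow> \<eta> q = 0"
    by (rule bump_function[OF open_interior, of p]) (use p that in auto)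
  define \<alpha> where "\<alpha> = (\<lambda>q. \<eta> q *\<^sub>R extend M coTM p \<alpha>0 q)"
  note \<eta>phg = smooth_imp_phg_fun[OF \<eta>(1) open_UNIV]
  have \<alpha>0: "\<alpha> q = 0" if "q \<notin> K" for q by (simp add: \<alpha>_def \<eta>(6) that)
  \<comment> \<open>Supports do not grow under differentiation: outside the closed set
    \<open>K\<close> both \<eta> and its derivative vanish, and with them both Leibniz
    terms.\<close>
  have n\<alpha>0: "nab' Y \<alpha> q = 0" if Y: "zero_field M Y" and q: "q \<notin> K" for Y q
  proof -
    have "zderiv M x Y \<eta> q = zderiv M x Y (\<lambda>q. 0) q"
      by (rule zderiv_cong[of "- K"]) (use \<eta> q in auto)
    then show ?thesis
      unfolding \<alpha>_def connection_leibniz[OF zero_connections(2) Y ext_phg(2) \<eta>phg]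
      using \<eta>(6)[OF q] by (simp add: zderiv_const)
  qed
  have \<alpha>int: "int_section coTM \<alpha>"
  proof (rule int_sectionI)
    fix U T assume T: "(U, T) \<in> coTM"
    have "smooth_fun M (U - bdry M) (\<lambda>q. \<eta> q *\<^sub>R T q (extend M coTM p \<alpha>0 q))"
      by (intro smooth_fun_scaleR smooth_fun_subset[OF \<eta>(1)] smooth_fun_subset[OF smooth_section_triv[OF ext_smooth(2) T]]) auto
    then show "smooth_fun M (U - bdry M) (\<lambda>q. T q (\<alpha> q))"
      by (rule smooth_fun_cong) (simp add: \<alpha>_def linear_scale[OF bundle_linear[OF vector_bundles(2) T]])
  qed
  have \<alpha>: "phg coTM \<alpha>"
    by (intro smooth_phg int_section_supported_smooth[OF vector_bundles(2) \<alpha>int \<eta>(4,5) \<alpha>0])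
  have Cphg: "phg Sm (\<lambda>q. clifford q (\<beta> q) (t q))"
    if "phg coTM \<beta>" "\<And>q. q \<notin> K \<Longrightarrow> \<beta> q = 0" "phg Sp t" for \<beta> t
    by (intro smooth_phg int_section_supported_smooth[OF vector_bundles(4) clifford_int \<eta>(4,5)] phg_section_imp_int that)
      (simp add: that(2) linear_0[OF clifford_linear_left])
  have n\<alpha>: "phg coTM (nab' Y \<alpha>)" if "zero_field M Y" for Y
    by (rule connection_phg[OF zero_connections(2) that \<alpha>])
  have As: "phg Sp (Ap Y s)" if "zero_field M Y" for Y
    by (rule connection_phg[OF zero_connections(3) that s])
  let ?\<sigma> = "\<lambda>q. clifford q (\<alpha> q) (s q)"
  have 1: "Am V (Am W ?\<sigma>) p =
     (clifford p (nab' V (nab' W \<alpha>) p) (s p) + clifford p (nab' W \<alpha> p) (Ap V s p)) +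
     (clifford p (nab' V \<alpha> p) (Ap W s p) + clifford p (\<alpha> p) (Ap V (Ap W s) p))"
    if V: "zero_field M V" and W: "zero_field M W" for V W
  proof -
    have "Am W ?\<sigma> = (\<lambda>q. clifford q (nab' W \<alpha> q) (s q) + clifford q (\<alpha> q) (Ap W s q))"
      by (rule ext) (rule clifford_compat[OF W \<alpha> s])
    then have "Am V (Am W ?\<sigma>) p = Am V (\<lambda>q. clifford q (nab' W \<alpha> q) (s q) + clifford q (\<alpha> q) (Ap W s q)) p"
      by (simp only:)
    also have "\<dots> = Am V (\<lambda>q. clifford q (nab' W \<alpha> q) (s q)) p + Am V (\<lambda>q. clifford q (\<alpha> q) (Ap W s q)) p"
      by (rule connection_add[OF zero_connections(4) V Cphg[OF n\<alpha>[OF W] n\<alpha>0[OF W] s] Cphg[OF \<alpha> \<alpha>0 As[OF W]]])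
    finally show ?thesis
      by (simp only: clifford_compat[OF V n\<alpha>[OF W] s] clifford_compat[OF V \<alpha> As[OF W]])
  qed
  have "curv_op Am V W ?\<sigma> p = clifford p (curv_op nab' V W \<alpha> p) (s p) + clifford p (\<alpha> p) (curv_op Ap V W s p)"
    unfolding curv_op_def 1[OF V W] 1[OF W V] clifford_compat[OF zero_field_bracket[OF V W] \<alpha> s]
      linear_diff[OF clifford_linear_left] linear_diff[OF clifford_linear_right]
    by (simp add: algebra_simps)
  moreover have "\<alpha> p = \<alpha>0" by (simp add: \<alpha>_def \<eta>(2) ext_value)
  ultimately show ?thesis using \<alpha> Cphg[OF \<alpha> \<alpha>0 s] by blast
qed

text \<open>The frame of S_+ is kept standard, so that matrices on S_+ need no conjugation; the
  frame \<open>b\<close> of S_- stays free, to turn the coframe at boundary points.\<close>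

lemma clifford_frame_exists:
  assumes b: "b \<in> SU2"
  shows "\<exists>e. frame4 (g p) e \<and> (\<forall>i u. clifford p (e i) u = b *v (spin_matrix i *v u))"
proof -
  have "\<forall>a\<in>SU2. \<forall>b\<in>SU2. \<exists>e. oriented_orthonormal_coframe (g p) e \<and>
     (\<forall>i \<psi>. c p (e i) (a *v fst \<psi>, b *v snd \<psi>) =
        (a *v fst (standard_clifford i \<psi>), b *v snd (standard_clifford i \<psi>)))"
    using spin unfolding zero_spin_structure_def by blast
  from bspec[OF bspec[OF this mat1_SU2] b]
  obtain e where e: "oriented_orthonormal_coframe (g p) e"
    "\<And>i \<psi>. c p (e i) (mat 1 *v fst \<psi>, b *v snd \<psi>) =
        (mat 1 *v fst (standard_clifford i \<psi>), b *v snd (standard_clifford i \<psi>))"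
    by blast
  have "clifford p (e i) u = b *v (spin_matrix i *v u)" for i u
  proof -
    have "- u = - mat 1 *v u"
      by (simp add: matrix_vector_mult_def mat_def vec_eq_iff forall_2 sum_2)
    then have "snd (standard_clifford i (u, 0)) = spin_matrix i *v u"
      by (simp add: standard_clifford_def spin_matrix_def)
    then show ?thesis
      using arg_cong[OF e(2)[of i "(u, 0)"], of snd] by (simp add: clifford_eq)
  qed
  moreover have "frame4 (g p) e"
    using metric_inner e(1) by (simp add: frame4_def frame4_axioms_def)
  ultimately show ?thesis by blast
qed

text \<open>The infinitesimal form of Spin(4) -> SO(4): \<open>N\<close> on S_- and \<rho> on S_+
  lift the skew endomorphism \<open>D\<close>, and \<beta> is the action of \<open>D\<close> on the
  covector \<alpha>. It covers the curvature at interior points and the connection at boundary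
  points.\<close>

lemma spin_lift:
  assumes F: "frame4 (g p) e" and C: "\<And>i u. clifford p (e i) u = b *v (spin_matrix i *v u)" and b: "b \<in> SU2"
    and \<rho>: "\<rho> \<in> su2" and D: "\<And>y z. g p (D y) z = - g p y (D z)"
    and rel: "\<And>\<alpha> u. \<exists>\<beta>. (\<forall>y. \<beta> \<bullet> y + \<alpha> \<bullet> D y = 0) \<and> N *v clifford p \<alpha> u = clifford p \<beta> u + clifford p \<alpha> (\<rho> *v u)"
  defines "h \<equiv> \<lambda>i. sharp (g p) (e i)"
  defines "d \<equiv> \<lambda>i j. g p (D (h i)) (h j)"
  shows "\<rho> = pauli_combination ((d 0 1 + d 2 3) / 2) ((d 0 2 + d 3 1) / 2) ((d 0 3 + d 1 2) / 2)"
proof (rule spin_lift_unique[OF \<rho>])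
  interpret frame4 "g p" e by (rule F)
  have ff: "f = h" by (simp add: fun_eq_iff f_def h_def)
  show "d i j = - d j i" for i j unfolding d_def by (subst D) (simp add: G_sym)
  \<comment> \<open>Conjugation by the unitary \<open>b\<close> passes to the frame of S_- in which
    Clifford multiplication is standard.\<close>
  show "(ctranspose b ** N ** b) ** spin_matrix i = (\<Sum>j\<in>UNIV. d i j *\<^sub>R spin_matrix j) + spin_matrix i ** \<rho>" for i
  proof (rule matrix_eq[THEN iffD2], rule)
    fix u
    obtain \<beta> where \<beta>: "\<And>y. \<beta> \<bullet> y + e i \<bullet> D y = 0" "N *v clifford p (e i) u = clifford p \<beta> u + clifford p (e i) (\<rho> *v u)"
      using rel by blast
    \<comment> \<open>Two signs cancel, that of the dual action and that of skewness.\<close>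
    have "\<beta> \<bullet> h j = d i j" for j
    proof -
      have "\<beta> \<bullet> h j = - g p (h i) (D (h j))" using \<beta>(1)[of "h j"] G_f[of i "D (h j)"] by (simp add: ff)
      then show ?thesis by (simp add: d_def D)
    qed
    then have \<beta>e: "\<beta> = (\<Sum>j\<in>UNIV. d i j *\<^sub>R e j)" using covector_expand[of \<beta>] by (simp add: ff)
    have "clifford p \<beta> u = (\<Sum>j\<in>UNIV. d i j *\<^sub>R (b *v (spin_matrix j *v u)))"
      unfolding \<beta>e by (simp only: linear_sum[OF clifford_linear_left] linear_scale[OF clifford_linear_left] C)
    also have "\<dots> = b *v (\<Sum>j\<in>UNIV. d i j *\<^sub>R (spin_matrix j *v u))"
      by (simp only: linear_sum[OF matrix_vector_mul_linear] linear_scale[OF matrix_vector_mul_linear])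
    also have "(\<Sum>j\<in>UNIV. d i j *\<^sub>R (spin_matrix j *v u)) = (\<Sum>j\<in>UNIV. d i j *\<^sub>R spin_matrix j) *v u"
      by (simp add: sum_4' matrix_vector_mult_def vec_eq_iff sum_2 algebra_simps)
    finally have "N *v (b *v (spin_matrix i *v u)) = b *v ((\<Sum>j\<in>UNIV. d i j *\<^sub>R spin_matrix j) *v u) + b *v (spin_matrix i *v (\<rho> *v u))"
      using \<beta>(2) by (simp only: C)
    then have "ctranspose b *v (N *v (b *v (spin_matrix i *v u))) =
      ctranspose b *v (b *v ((\<Sum>j\<in>UNIV. d i j *\<^sub>R spin_matrix j) *v u + spin_matrix i *v (\<rho> *v u)))"
      by (simp only: matrix_vector_right_distrib)
    moreover have "ctranspose b ** b = mat 1" using b by (simp add: SU2_def)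
    ultimately show "((ctranspose b ** N ** b) ** spin_matrix i) *v u = ((\<Sum>j\<in>UNIV. d i j *\<^sub>R spin_matrix j) + spin_matrix i ** \<rho>) *v u"
      by (simp add: matrix_vector_mul_assoc matrix_mul_assoc matrix_vector_mult_add_rdistrib)
  qed
qed

section \<open>Self-duality in the interior\<close>

abbreviation curv :: "'m \<Rightarrow> real^4 \<Rightarrow> real^4 \<Rightarrow> real^4 \<Rightarrow> real^4" where
  "curv p v w y \<equiv> curvature M x TM nab p v w y"

lemma interior_self_dual:
  assumes p: "p \<notin> bdry M"
  shows "hodge_star (g p) (curvature_form M x Sp Ap p) v w = curvature_form M x Sp Ap p v w"
proof -
  obtain e where e: "frame4 (g p) e" "\<And>i u. clifford p (e i) u = mat 1 *v (spin_matrix i *v u)"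
    using clifford_frame_exists[OF mat1_SU2] by blast
  interpret frame4 "g p" e by (rule e(1))
  define R where "R = (\<lambda>v w y z. g p (curv p v w y) z)"
  note X = ext_smooth(1)[of p]
  note sk = skew_operation_tangent[OF metric_curvature_skew[OF X X]]
  have skewD: "g p (curv p v w y) z = - g p y (curv p v w z)" for v w y z
    unfolding curvature_curv_op by (rule sk(3))
  have linD: "linear (curv p v w)" for v w
    unfolding curvature_curv_op by (rule sk(2))
  have skew: "R v w y z = - R v w z y" for v w y z
    unfolding R_def by (subst skewD) (simp add: G_sym)
  have anti: "R v w y z = - R w v y z" for v w y z
    unfolding R_def curvature_curv_op curv_op_swap[OF zero_connections(1) X X ext_phg(1), of v w]
    by (simp add: G_simps)
  have bianchi: "R v w y z + R w y v z + R y v w z = 0" for v w y z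
    using arg_cong[OF curv_op_bianchi[OF LC p X X X, of v w y], of "\<lambda>u. g p u z"]
    by (simp add: R_def curvature_curv_op G_simps)
  have pair: "R v w y z = R y z v w" for v w y z
    by (rule curvature_pair_symmetry[of R, OF anti skew bianchi])
  \<comment> \<open>Linearity in the first vector is hidden by the choice of extensions; pair
    symmetry moves it to the third slot, where skewness has already given it.\<close>
  have lin: "linear (\<lambda>v. R v w y z)" for w y z
  proof -
    have "linear (\<lambda>v. g p (curv p y z v) w)"
      using linear_compose[OF linD[of y z] G_linear(2)[of w]] by (simp add: comp_def)
    moreover have "R v w y z = g p (curv p y z v) w" for v using pair[of v w y z] by (simp add: R_def)
    ultimately show ?thesis by simp
  qed
  have linu: "linear (\<lambda>u. curv p u v w)" for v w
    by (rule linearI; rule G_eqI)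
      (simp_all add: G_simps linear_add[OF lin, unfolded R_def] linear_scale[OF lin, unfolded R_def])
  have ric: "(\<Sum>i\<in>UNIV. R (f i) v w (f i)) + 3 * g p v w = 0" for v w
    using einstein[of p v w] trace_frame[OF linu[of v w]] by (simp add: ricci_def R_def f_def)
  show ?thesis
  proof (rule einstein_self_dual[OF lin anti skew pair ric])
    fix v w
    let ?V = "ext_field p v" and ?W = "ext_field p w"
    let ?F = "curvature_form M x Sp Ap p v w"
    let ?N = "matrix (\<lambda>u. curv_op Am ?V ?W (extend M Sm p u) p)"
    have F: "?F = matrix (\<lambda>u. curv_op Ap ?V ?W (extend M Sp p u) p)"
      by (simp add: curvature_form_def curvature_curv_op[abs_def])
    have Fv: "curv_op Ap ?V ?W s p = ?F *v s p" if "phg Sp s" for s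
      unfolding F by (rule skew_operation_spinor[OF vector_bundles(3) su2_curvature_skew(1)[OF su2_bundles(1) Ap X X] that])
    have Nv: "curv_op Am ?V ?W s p = ?N *v s p" if "phg Sm s" for s
      by (rule skew_operation_spinor[OF vector_bundles(4) su2_curvature_skew(1)[OF su2_bundles(2) Am X X] that])
    have su2: "?F \<in> su2"
      unfolding F
      by (rule skew_operation_su2[OF vector_bundles(3) su2_curvature_skew[OF su2_bundles(1) Ap X X]])
    \<comment> \<open>Clifford compatibility of the curvatures: \<alpha> is extended by a covector
      field supported in the interior, and evaluation at \<open>p\<close> leaves only fibre
      data.\<close>
    have rel: "\<exists>\<beta>. (\<forall>y. \<beta> \<bullet> y + \<alpha> \<bullet> curv p v w y = 0) \<and> ?N *v clifford p \<alpha> u = clifford p \<beta> u + clifford p \<alpha> (?F *v u)" for \<alpha> u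
    proof -
      obtain a where a: "phg coTM a" "a p = \<alpha>" "phg Sm (\<lambda>q. clifford q (a q) (extend M Sp p u q))"
        "curv_op Am ?V ?W (\<lambda>q. clifford q (a q) (extend M Sp p u q)) p =
          clifford p (curv_op nab' ?V ?W a p) (extend M Sp p u p) + clifford p (a p) (curv_op Ap ?V ?W (extend M Sp p u) p)"
        using clifford_curvature[OF p X X ext_phg(3)] by blast
      have "curv_op nab' ?V ?W a p \<bullet> y + \<alpha> \<bullet> curv p v w y = 0" for y
      proof -
        have "curv_op nab' ?V ?W a p \<bullet> ext_field p y p + a p \<bullet> curv_op nab ?V ?W (ext_field p y) p = 0"
          by (rule dual_curvature[OF X X a(1) ext_phg(1)])
        then show ?thesis by (simp add: a(2) ext_value curvature_curv_op)
      qed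
      moreover have "?N *v clifford p \<alpha> u = clifford p (curv_op nab' ?V ?W a p) u + clifford p \<alpha> (?F *v u)"
        using a(4) unfolding Nv[OF a(3)] Fv[OF ext_phg(3)] by (simp add: a(2) ext_value)
      ultimately show ?thesis by blast
    qed
    from spin_lift[OF e mat1_SU2 su2 skewD rel]
    show "?F = pauli_combination ((R v w (f 0) (f 1) + R v w (f 2) (f 3)) / 2)
      ((R v w (f 0) (f 2) + R v w (f 3) (f 1)) / 2) ((R v w (f 0) (f 3) + R v w (f 1) (f 2)) / 2)"
      by (simp add: R_def f_def)
  qed
qed

section \<open>The boundary\<close>

definition dx :: "'m \<Rightarrow> real^4 \<Rightarrow> real" where "dx p v = tderiv M x p v"

definition dx_covector :: "'m \<Rightarrow> real^4" where "dx_covector p = (\<chi> i. dx p (axis i 1))"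

text \<open>At boundary points it points inward, since dx is positive on it; the outward unit normal
  is its negative once its length is known to be 1.\<close>

definition normal :: "'m \<Rightarrow> real^4" where "normal p = sharp (g p) (dx_covector p)"

lemma dx_linear: "linear (dx p)"
  unfolding dx_def[abs_def] by (rule tderiv_linear[OF bdf_smooth]) auto

lemma dx_inner: "dx_covector p \<bullet> v = dx p v"
proof -
  have "dx p v = dx p (\<Sum>i\<in>UNIV. (v $ i) *\<^sub>R axis i 1)"
    by (simp add: basis_expansion scalar_mult_eq_scaleR[symmetric])
  then show ?thesis
    by (simp add: dx_covector_def inner_vec_def linear_sum[OF dx_linear] linear_scale[OF dx_linear] mult.commute)
qed

lemma g_normal: "g p (normal p) v = dx p v"
proof -
  interpret inner_product4 "g p" by (rule metric_inner)
  show ?thesis by (simp add: normal_def G_sharp dx_inner)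
qed

lemma g_normal': "g p v (normal p) = dx p v"
  using g_normal inner_product4.G_sym[OF metric_inner] by metis

lemma bracket_bdry: "p \<in> bdry M \<Longrightarrow> zero_bracket M x V W p = dx p (V p) *\<^sub>R W p - dx p (W p) *\<^sub>R V p"
  using bdf_zero_iff[of p] by (simp add: zero_bracket_def dx_def)

text \<open>Stated for polyhomogeneous \<open>Y\<close> because the curvature applies it to
  \<open>nab W Y\<close>, whose coefficients need not be smooth.\<close>

lemma nab_bdry:
  assumes p: "p \<in> bdry M" and V: "zero_field M V" and Y: "phg TM Y"
  shows "nab V Y p = g p (V p) (Y p) *\<^sub>R normal p - dx p (Y p) *\<^sub>R V p"
proof -
  interpret inner_product4 "g p" by (rule metric_inner)
  have skew: "g p (nab V Y p) (Z p) + g p (Y p) (nab V Z p) = 0"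
    if "zero_field M V" "phg TM Y" "phg TM Z" for V Y Z
    using metric_compat[OF that, of p] by (simp add: zderiv_bdry[OF p])
  have T: "g p (nab V Y p) (Z p) = dx p (Z p) * g p (V p) (Y p) - dx p (Y p) * g p (V p) (Z p)"
    if f: "zero_field M V" "zero_field M Y" "zero_field M Z" for V Y Z
  proof -
    have t: "nab V Y p = nab Y V p + zero_bracket M x V Y p" if "zero_field M V" "zero_field M Y" for V Y
    proof -
      have "(\<lambda>p. nab V Y p - nab Y V p) = zero_bracket M x V Y" using LC that unfolding levi_civita_def by blast
      from fun_cong[OF this, of p] show ?thesis by (simp add: algebra_simps)
    qed
    have s: "g p (nab V Y p) (Z p) = - g p (nab V Z p) (Y p)" if "zero_field M V" "zero_field M Y" "zero_field M Z" for V Y Z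
      using skew[OF that(1) smooth_phg(1)[OF that(2)] smooth_phg(1)[OF that(3)]] G_sym[of "Y p" "nab V Z p"] by simp
    have tors: "g p (nab V Y p) (Z p) - g p (nab Y V p) (Z p) = dx p (V p) * g p (Y p) (Z p) - dx p (Y p) * g p (V p) (Z p)"
      if "zero_field M V" "zero_field M Y" "zero_field M Z" for V Y Z
      unfolding t[OF that(1,2)] bracket_bdry[OF p] by (simp add: G_simps)
    have "g p (nab Y V p) (Z p) = - g p (nab Y Z p) (V p)" "g p (nab Z V p) (Y p) = - g p (nab Z Y p) (V p)"
        "g p (nab V Z p) (Y p) = - g p (nab V Y p) (Z p)"
      by (rule s; rule f)+
    \<comment> \<open>The torsion identities for the three pairs of fields, with skewness in the
      last two slots, are three linear equations for three unknowns.\<close>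
    then show ?thesis
      using tors[OF f] tors[OF f(2,3,1)] tors[OF f(1,3,2)] G_sym[of "Y p" "V p"] G_sym[of "Z p" "V p"] G_sym[of "Z p" "Y p"]
      by (simp add: algebra_simps)
  qed
  \<comment> \<open>Absence of torsion speaks of smooth fields; skewness replaces \<open>Y\<close>
    by a smooth field with the same value at \<open>p\<close>.\<close>
  have "nab V Y p = nab V (ext_field p (Y p)) p"
    by (rule skew_operation_tangent(1)[where Op="\<lambda>Y. nab V Y p", OF skew[OF V] Y])
  also have "\<dots> = g p (V p) (Y p) *\<^sub>R normal p - dx p (Y p) *\<^sub>R V p"
  proof (rule G_eqI)
    fix w
    show "g p (nab V (ext_field p (Y p)) p) w = g p (g p (V p) (Y p) *\<^sub>R normal p - dx p (Y p) *\<^sub>R V p) w"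
      using T[OF V ext_smooth(1) ext_smooth(1), of p "Y p" p w] by (simp add: ext_value G_simps g_normal)
  qed
  finally show ?thesis .
qed

lemma curv_bdry:
  assumes p: "p \<in> bdry M"
  shows "curv p v w y = - (g p (normal p) (normal p) *\<^sub>R (g p w y *\<^sub>R v - g p v y *\<^sub>R w))"
proof -
  interpret inner_product4 "g p" by (rule metric_inner)
  let ?V = "ext_field p v" and ?W = "ext_field p w" and ?Y = "ext_field p y"
  note X = ext_smooth(1)[of p]
  note n = nab_bdry[OF p]
  have nphg: "phg TM (nab V ?Y)" if "zero_field M V" for V
    by (rule connection_phg[OF zero_connections(1) that ext_phg(1)])
  show ?thesis
    unfolding curvature_curv_op curv_op_def n[OF X nphg[OF X]] n[OF X ext_phg(1)] n[OF zero_field_bracket[OF X X] ext_phg(1)]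
      bracket_bdry[OF p] ext_value
    by (simp add: G_simps g_normal g_normal' linear_diff[OF dx_linear] linear_scale[OF dx_linear] G_sym[of w v] algebra_simps)
qed

text \<open>Asymptotic hyperbolicity. The trace of u -> g(v, w) u - g(u, w) v is (4 - 1) g(v, w), so
  the Einstein constant 3 matches exactly when |dx| = 1.\<close>

lemma normal_unit:
  assumes p: "p \<in> bdry M"
  shows "g p (normal p) (normal p) = 1"
proof -
  interpret inner_product4 "g p" by (rule metric_inner)
  let ?N = "g p (normal p) (normal p)" and ?v = "axis 0 1 :: real^4"
  have "trace (matrix (\<lambda>u. curv p u v w)) = - 3 * ?N * g p v w" for v w
  proof -
    have "(\<Sum>i\<in>UNIV. g p (axis i 1) w * v $ i) = g p (\<Sum>i\<in>UNIV. (v $ i) *\<^sub>R axis i 1) w"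
      by (simp add: linear_sum[OF G_linear(2)] G_simps mult.commute)
    also have "\<dots> = g p v w"
      by (simp add: basis_expansion scalar_mult_eq_scaleR[symmetric])
    finally have s: "(\<Sum>i\<in>UNIV. g p (axis i 1) w * v $ i) = g p v w" .
    have "curv p (axis i 1) v w $ i = - (?N * g p v w) + ?N * (g p (axis i 1) w * v $ i)" for i
      by (simp add: curv_bdry[OF p] algebra_simps)
    then have "trace (matrix (\<lambda>u. curv p u v w)) = (\<Sum>i\<in>(UNIV :: 4 set). - (?N * g p v w) + ?N * (g p (axis i 1) w * v $ i))"
      by (simp add: trace_def matrix_def)
    also have "\<dots> = - 4 * (?N * g p v w) + ?N * (\<Sum>i\<in>UNIV. g p (axis i 1) w * v $ i)"
      by (simp only: sum.distrib sum_distrib_left[symmetric]) simp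
    finally show ?thesis unfolding s by simp
  qed
  then have "(1 - ?N) * g p ?v ?v = 0"
    using einstein[of p ?v ?v] by (simp add: ricci_def algebra_simps)
  moreover have "g p ?v ?v \<noteq> 0" using G_pos[of ?v] by (simp add: axis_eq_0_iff)
  ultimately show ?thesis by simp
qed

text \<open>Rotating the frame of \<open>Sm\<close> by the unit quaternion of \<open>dx\<close> makes \<open>e 0 = - dx\<close>, the outward conormal.\<close>

lemma adapted_frame_exists:
  assumes p: "p \<in> bdry M"
  shows "\<exists>e b. b \<in> SU2 \<and> frame4 (g p) e \<and> (\<forall>i u. clifford p (e i) u = b *v (spin_matrix i *v u)) \<and> e 0 = - dx_covector p"
proof -
  obtain e where e: "frame4 (g p) e" "\<And>i u. clifford p (e i) u = mat 1 *v (spin_matrix i *v u)"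
    using clifford_frame_exists[OF mat1_SU2] by blast
  interpret frame4 "g p" e by (rule e(1))
  have cl: "clifford p \<alpha> u = (\<Sum>i\<in>UNIV. (\<alpha> \<bullet> f i) *\<^sub>R (spin_matrix i *v u))" for \<alpha> u
    by (subst covector_expand[of \<alpha>])
      (simp only: linear_sum[OF clifford_linear_left] linear_scale[OF clifford_linear_left] e(2) matrix_vector_mul_lid)
  \<comment> \<open>On the first basis spinor the four coefficients of a covector become, up to
    sign, the real and imaginary parts of two complex numbers, so none is lost.\<close>
  have inj: "\<alpha> = 0" if "\<And>u. clifford p \<alpha> u = 0" for \<alpha>
  proof -
    have "(\<Sum>i\<in>UNIV. (\<alpha> \<bullet> f i) *\<^sub>R (spin_matrix i *v axis 1 1)) $ k = 0" for k
      using that[of "axis 1 1"] by (simp add: cl)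
    from this[of 1] this[of 2] have "\<alpha> \<bullet> f i = 0" for i
      using exhaust_4[of i] four_eq_zero
      by (auto simp: sum_4' spin_matrix_def matrix_vector_mult_def sum_2 sigma_entries mat_def axis_def complex_eq_iff)
    then have "(\<Sum>i\<in>UNIV. (\<alpha> \<bullet> f i) *\<^sub>R e i) = 0" by simp
    with covector_expand[of \<alpha>] show ?thesis by (rule trans)
  qed
  define \<nu> where "\<nu> = (\<lambda>i. dx_covector p \<bullet> f i)"
  have \<nu>: "dx_covector p \<bullet> f i = \<nu> i" for i by (simp add: \<nu>_def)
  \<comment> \<open>Clifford multiplication by dx in the standard frames. As index 0 acts as minus
    \<open>b\<close> in the rotated frame, injectivity forces e' 0 = - dx.\<close>
  define b where "b = (\<Sum>i\<in>UNIV. \<nu> i *\<^sub>R spin_matrix i)"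
  have unit: "(\<nu> 0)\<^sup>2 + (\<nu> 1)\<^sup>2 + (\<nu> 2)\<^sup>2 + (\<nu> 3)\<^sup>2 = 1"
  proof -
    have "normal p = (\<Sum>i\<in>UNIV. \<nu> i *\<^sub>R f i)"
    proof (rule G_eqI)
      fix w
      have "dx_covector p \<bullet> w = (\<Sum>i\<in>UNIV. \<nu> i * (e i \<bullet> w))"
        by (subst covector_expand[of "dx_covector p"]) (simp only: inner_sum_left inner_scaleR_left \<nu>)
      then show "g p (normal p) w = g p (\<Sum>i\<in>UNIV. \<nu> i *\<^sub>R f i) w"
        by (simp add: g_normal dx_inner[symmetric] linear_sum[OF G_linear(2)] linear_scale[OF G_linear(2)] G_f)
    qed
    then have "dx_covector p \<bullet> (\<Sum>i\<in>UNIV. \<nu> i *\<^sub>R f i) = 1"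
      using normal_unit[OF p] g_normal[of p "normal p"] by (simp add: dx_inner[symmetric])
    then show ?thesis by (simp add: inner_add_right \<nu> sum_4' power2_eq_square)
  qed
  have b_ent: "b $ 1 $ 1 = Complex (- \<nu> 0) (\<nu> 1)" "b $ 1 $ 2 = Complex (\<nu> 2) (\<nu> 3)"
    "b $ 2 $ 1 = Complex (- \<nu> 2) (\<nu> 3)" "b $ 2 $ 2 = Complex (- \<nu> 0) (- \<nu> 1)"
    by (simp_all add: b_def sum_4' spin_matrix_def sigma_entries mat_def complex_eq_iff)
  \<comment> \<open>Both the diagonal of \<open>ctranspose b ** b\<close> and \<open>det b\<close>
    are the squared length of dx, which is 1 by \<open>unit\<close>.\<close>
  have b: "b \<in> SU2"
    unfolding SU2_def
  proof (intro CollectI conjI)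
    show "ctranspose b ** b = mat 1"
      by (rule complex_matrix_eqI; use unit in \<open>simp add: ctranspose_def matrix_matrix_mult_def sum_2 b_ent mat_def complex_eq_iff power2_eq_square algebra_simps\<close>)
    show "det b = 1"
      using unit by (simp add: det_2 b_ent complex_eq_iff power2_eq_square algebra_simps)
  qed
  obtain e' where e': "frame4 (g p) e'" "\<And>i u. clifford p (e' i) u = b *v (spin_matrix i *v u)"
    using clifford_frame_exists[OF b] by blast
  have "e' 0 + dx_covector p = 0"
  proof (rule inj)
    fix u
    have "clifford p (dx_covector p) u = b *v u"
      unfolding cl \<nu> b_def
      by (simp add: sum_4' matrix_vector_mult_def vec_eq_iff sum_2 algebra_simps)
    moreover have "clifford p (e' 0) u = - (b *v u)"
      unfolding e'(2) by (simp add: spin_matrix_def matrix_vector_mult_def mat_def vec_eq_iff sum_2 forall_2)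
    ultimately show "clifford p (e' 0 + dx_covector p) u = 0"
      by (simp add: linear_add[OF clifford_linear_left])
  qed
  then have "e' 0 = - dx_covector p" by (simp add: eq_neg_iff_add_eq_0)
  with b e' show ?thesis by (intro exI[of _ e'] exI[of _ b]) simp
qed

text \<open>At \<open>p\<close> the compatibility conditions with the fibre pairings lose their
  derivative terms, so \<open>spin_lift\<close> applies to the connections themselves, with
  \<open>nab V\<close> as the skew endomorphism.\<close>

lemma connection_bdry:
  assumes p: "p \<in> bdry M" and e: "frame4 (g p) e" "\<And>i u. clifford p (e i) u = b *v (spin_matrix i *v u)"
    and b: "b \<in> SU2" and e0: "e 0 = - dx_covector p"
    and V: "zero_field M V" and s: "phg Sp s"
  shows "Ap V s p = pauli_combination (e 1 \<bullet> V p / 2) (e 2 \<bullet> V p / 2) (e 3 \<bullet> V p / 2) *v s p"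
proof -
  interpret frame4 "g p" e by (rule e(1))
  have skew: "herm (A V s p) (t p) + herm (s p) (A V t p) = 0" "cvol (A V s p) (t p) + cvol (s p) (A V t p) = 0"
    if "su2_connection M x E A" "phg E s" "phg E t" for E A s t
    using su2_compat[OF that(1) V that(2,3), of p] by (simp_all add: zderiv_bdry[OF p])
  let ?P = "matrix (\<lambda>u. Ap V (extend M Sp p u) p)" and ?N = "matrix (\<lambda>u. Am V (extend M Sm p u) p)"
  have P: "Ap V s p = ?P *v s p" if "phg Sp s" for s
    by (rule skew_operation_spinor[OF vector_bundles(3) skew(1)[OF Ap] that])
  have N: "Am V s p = ?N *v s p" if "phg Sm s" for s
    by (rule skew_operation_spinor[OF vector_bundles(4) skew(1)[OF Am] that])
  have su2: "?P \<in> su2"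
    by (rule skew_operation_su2[OF vector_bundles(3) skew[OF Ap]])
  define D where "D = (\<lambda>y. g p (V p) y *\<^sub>R normal p - dx p y *\<^sub>R V p)"
  have D: "g p (D y) z = - g p y (D z)" for y z
    by (simp add: D_def G_simps g_normal G_sym[of y "normal p"] G_sym[of y "V p"])
  have rel: "\<exists>\<beta>. (\<forall>y. \<beta> \<bullet> y + \<alpha> \<bullet> D y = 0) \<and> ?N *v clifford p \<alpha> u = clifford p \<beta> u + clifford p \<alpha> (?P *v u)" for \<alpha> u
  proof -
    let ?a = "extend M coTM p \<alpha>" and ?s = "extend M Sp p u"
    have "nab' V ?a p \<bullet> y + \<alpha> \<bullet> D y = 0" for y
      using dual_compat[OF V ext_phg(2)[of p \<alpha>] ext_phg(1)[of p y], of p]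
      by (simp add: zderiv_bdry[OF p] ext_value nab_bdry[OF p V ext_phg(1)] D_def)
    moreover have "?N *v clifford p \<alpha> u = clifford p (nab' V ?a p) u + clifford p \<alpha> (?P *v u)"
    proof -
      \<comment> \<open>Smooth extensions suffice, since a first-order identity differentiates a
        single Clifford product of given sections.\<close>
      have 1: "Am V (\<lambda>q. clifford q (?a q) (?s q)) p = ?N *v clifford p (?a p) (?s p)"
        by (rule N[OF clifford_phg[OF ext_smooth(2,3)]])
      have 2: "Am V (\<lambda>q. clifford q (?a q) (?s q)) p = clifford p (nab' V ?a p) (?s p) + clifford p (?a p) (Ap V ?s p)"
        by (rule clifford_compat[OF V ext_phg(2,3)])
      show ?thesis using 1 2 P[OF ext_phg(3), of p u] by (simp add: ext_value)
    qed
    ultimately show ?thesis by (intro exI[of _ "nab' V ?a p"] conjI allI)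
  qed
  have dxf: "dx p (f j) = (if j = 0 then -1 else 0)" for j
    using e_f[of 0 j] by (cases "j = 0") (simp_all add: e0 dx_inner)
  have d: "g p (D (f i)) (f j) = (e i \<bullet> V p) * dx p (f j) - dx p (f i) * (e j \<bullet> V p)" for i j
    by (simp only: D_def G_simps g_normal) (simp add: G_f')
  \<comment> \<open>Only d_0k = V_k and d_k0 = - V_k survive, because dx is -1 on \<open>f 0\<close>
    and 0 on the other frame vectors; this leaves the halves of V_k.\<close>
  have "?P = pauli_combination (e 1 \<bullet> V p / 2) (e 2 \<bullet> V p / 2) (e 3 \<bullet> V p / 2)"
    using spin_lift[OF e b su2 D rel] unfolding f_def[symmetric] d by (simp add: dxf)
  then show ?thesis using P[OF s] by simp
qed

text \<open>Sections supported in the interior vanish at \<open>p\<close>, so the curvature is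
  computed directly: the commutator of the endomorphisms contributes the e^ij part and the bracket
  of x V and x W the e^0k part, with equal coefficients.\<close>

lemma boundary_self_dual:
  assumes p: "p \<in> bdry M"
  shows "hodge_star (g p) (curvature_form M x Sp Ap p) v w = curvature_form M x Sp Ap p v w"
proof -
  obtain e b where b: "b \<in> SU2" and e: "frame4 (g p) e" "\<And>i u. clifford p (e i) u = b *v (spin_matrix i *v u)"
    and e0: "e 0 = - dx_covector p"
    using adapted_frame_exists[OF p] by blast
  interpret frame4 "g p" e by (rule e(1))
  let ?P = "\<lambda>v. pauli_combination (e 1 \<bullet> v / 2) (e 2 \<bullet> v / 2) (e 3 \<bullet> v / 2)"
  note A = connection_bdry[OF p e b e0]
  have dx: "dx p v = - (e 0 \<bullet> v)" for v by (simp add: e0 dx_inner)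
  \<comment> \<open>\<open>q i j\<close> is the 2-form e^i \<and> e^j.\<close>
  define q where "q = (\<lambda>i j v w. (e i \<bullet> v) * (e j \<bullet> w) - (e j \<bullet> v) * (e i \<bullet> w))"
  have F: "curvature_form M x Sp Ap p v w =
      pauli_combination ((q 0 1 v w + q 2 3 v w) / 2) ((q 0 2 v w + q 3 1 v w) / 2) ((q 0 3 v w + q 1 2 v w) / 2)" for v w
  proof -
    let ?V = "ext_field p v" and ?W = "ext_field p w"
    note X = ext_smooth(1)[of p]
    have phgA: "phg Sp (Ap V (extend M Sp p u))" if "zero_field M V" for V u
      by (rule connection_phg[OF zero_connections(3) that ext_phg(3)])
    have "curv_op Ap ?V ?W (extend M Sp p u) p =
       (?P v ** ?P w - ?P w ** ?P v - ?P (dx p v *\<^sub>R w - dx p w *\<^sub>R v)) *v u" for u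
      unfolding curv_op_def A[OF X phgA[OF X]] A[OF X ext_phg(3)] A[OF zero_field_bracket[OF X X] ext_phg(3)]
        bracket_bdry[OF p] ext_value
      by (simp only: matrix_vector_mult_diff_rdistrib matrix_vector_mul_assoc)
    then have "curvature_form M x Sp Ap p v w = ?P v ** ?P w - ?P w ** ?P v - ?P (dx p v *\<^sub>R w - dx p w *\<^sub>R v)"
      by (simp add: curvature_form_def curvature_curv_op[abs_def] matrix_of_matrix_vector_mul)
    also have "\<dots> = pauli_combination ((q 0 1 v w + q 2 3 v w) / 2) ((q 0 2 v w + q 3 1 v w) / 2) ((q 0 3 v w + q 1 2 v w) / 2)"
      unfolding pauli_commutator
      by (rule complex_matrix_eqI; simp add: pauli_combination_entries complex_eq_iff q_def dx inner_diff_right field_simps)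
    finally show ?thesis .
  qed
  show ?thesis
  proof (rule self_dual_of_frame)
    show "bilinear (curvature_form M x Sp Ap p)"
      unfolding bilinear_def F[abs_def]
      by (intro conjI allI linearI; unfold pauli_combination_linear[symmetric] pauli_combination_inject;
          simp add: q_def inner_add_right field_simps)
    show "curvature_form M x Sp Ap p v w = - curvature_form M x Sp Ap p w v" for v w
      unfolding F pauli_combination_linear[symmetric] pauli_combination_inject by (simp add: q_def field_simps)
    show "curvature_form M x Sp Ap p (f 2) (f 3) = curvature_form M x Sp Ap p (f 0) (f 1)"
      "curvature_form M x Sp Ap p (f 3) (f 1) = curvature_form M x Sp Ap p (f 0) (f 2)"
      "curvature_form M x Sp Ap p (f 1) (f 2) = curvature_form M x Sp Ap p (f 0) (f 3)"
      by (simp_all add: F q_def e_f)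
  qed
qed

theorem spin_connection_self_dual: "self_dual M x g Sp Ap"
  unfolding self_dual_def
proof (intro allI ext)
  fix p v w
  show "curvature_form M x Sp Ap p v w = hodge_star (g p) (curvature_form M x Sp Ap p) v w"
    using interior_self_dual[of p v w] boundary_self_dual[of p v w] by (cases "p \<in> bdry M") simp_all
qed

theorem spin_connection_nahm_pole: "nahm_pole M x g Sp Ap"
  unfolding nahm_pole_def
proof (rule ballI)
  fix p assume p: "p \<in> bdry M"
  obtain e b where b: "b \<in> SU2" and e: "frame4 (g p) e" "\<And>i u. clifford p (e i) u = b *v (spin_matrix i *v u)"
    and e0: "e 0 = - dx_covector p"
    using adapted_frame_exists[OF p] by blast
  interpret frame4 "g p" e by (rule e(1))
  let ?P = "\<lambda>v. pauli_combination (e 1 \<bullet> v / 2) (e 2 \<bullet> v / 2) (e 3 \<bullet> v / 2)"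
  have res: "residue M x Sp Ap p v = ?P v" for v
  proof -
    have "x p = 0" using p bdf_zero_iff by simp
    then have "residue M x Sp Ap p v = matrix (\<lambda>u. Ap (ext_field p v) (extend M Sp p u) p)"
      by (simp add: residue_def Let_def)
    also have "\<dots> = ?P v"
      by (simp add: connection_bdry[OF p e b e0 ext_smooth(1) ext_phg(3)] ext_value matrix_of_matrix_vector_mul)
    finally show ?thesis .
  qed
  have K: "K_space M x p = {v. e 0 \<bullet> v = 0}"
    by (simp add: K_space_def e0 dx_inner dx_def)
  have f0: "outward_normal M x g p = f 0"
  proof -
    have n: "sharp (g p) (\<chi> i. tderiv M x p (axis i 1)) = normal p"
      by (simp add: normal_def dx_covector_def dx_def)
    have "outward_normal M x g p = - normal p"
      unfolding outward_normal_def Let_def n normal_unit[OF p] by simp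
    also have "\<dots> = f 0"
      by (rule G_eqI) (simp add: G_simps g_normal G_f e0 dx_inner)
    finally show ?thesis .
  qed
  \<comment> \<open>As \<open>f 0\<close> is the outward normal, these components for k = 1, 2, 3
    are those of the Euclidean cross product in the coordinates e^1, e^2, e^3.\<close>
  have cross: "e k \<bullet> K_cross M x g p v w = volume_form (g p) (f 0) v w (f k)" for k v w
  proof -
    have "(\<chi> i. volume_form (g p) (f 0) v w (axis i 1)) \<bullet> y = volume_form (g p) (f 0) v w y" for y
    proof -
      have "volume_form (g p) (f 0) v w y = volume_form (g p) (f 0) v w (\<Sum>i\<in>UNIV. (y $ i) *\<^sub>R axis i 1)"
        by (simp add: basis_expansion scalar_mult_eq_scaleR[symmetric])
      then show ?thesis
        by (simp add: inner_vec_def linear_sum[OF volume_form_linear_last] linear_scale[OF volume_form_linear_last] mult.commute)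
    qed
    then show ?thesis by (simp add: K_cross_def f0 G_f'[symmetric] G_sharp)
  qed
  show "(\<forall>v. (\<forall>k\<in>K_space M x p. g p v k = 0) \<longrightarrow> residue M x Sp Ap p v = 0) \<and>
    (\<forall>v\<in>K_space M x p. \<forall>w\<in>K_space M x p. \<forall>a b.
       residue M x Sp Ap p (a *\<^sub>R v + b *\<^sub>R w) = a *\<^sub>R residue M x Sp Ap p v + b *\<^sub>R residue M x Sp Ap p w) \<and>
    bij_betw (residue M x Sp Ap p) (K_space M x p) su2 \<and>
    (\<forall>v\<in>K_space M x p. \<forall>w\<in>K_space M x p.
       residue M x Sp Ap p (K_cross M x g p v w) =
         residue M x Sp Ap p v ** residue M x Sp Ap p w - residue M x Sp Ap p w ** residue M x Sp Ap p v)"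
  proof (intro conjI allI ballI impI)
    fix v assume "\<forall>k\<in>K_space M x p. g p v k = 0"
    \<comment> \<open>The vectors \<open>f 1\<close>, \<open>f 2\<close>, \<open>f 3\<close> lie in
      K and detect precisely the components that enter the residue.\<close>
    then have "g p v (f i) = 0" if "i \<noteq> 0" for i using that by (simp add: K e_f)
    then have "e i \<bullet> v = 0" if "i \<noteq> 0" for i using that by (simp add: G_f')
    then show "residue M x Sp Ap p v = 0" by (simp add: res pauli_combination_def)
  next
    fix v w a b
    show "residue M x Sp Ap p (a *\<^sub>R v + b *\<^sub>R w) = a *\<^sub>R residue M x Sp Ap p v + b *\<^sub>R residue M x Sp Ap p w"
      unfolding res pauli_combination_linear[symmetric] pauli_combination_inject
      by (simp add: inner_add_right field_simps)
  next
    show "bij_betw (residue M x Sp Ap p) (K_space M x p) su2"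
    proof (rule bij_betwI')
      fix v w assume "v \<in> K_space M x p" "w \<in> K_space M x p"
      then have *: "e 0 \<bullet> v = e 0 \<bullet> w" by (simp add: K)
      show "residue M x Sp Ap p v = residue M x Sp Ap p w \<longleftrightarrow> v = w"
      proof
        assume "residue M x Sp Ap p v = residue M x Sp Ap p w"
        then have "e i \<bullet> v = e i \<bullet> w" for i
          using * forall_4'[of "\<lambda>i. e i \<bullet> v = e i \<bullet> w"] by (simp add: res pauli_combination_inject)
        then have "(\<Sum>i\<in>UNIV. (e i \<bullet> v) *\<^sub>R f i) = (\<Sum>i\<in>UNIV. (e i \<bullet> w) *\<^sub>R f i)" by simp
        then show "v = w" using vector_expand[of v] vector_expand[of w] by metis
      qed simp
    next
      show "residue M x Sp Ap p v \<in> su2" for v unfolding res by (rule pauli_combination_su2)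
    next
      fix a assume "a \<in> su2"
      then obtain a1 a2 a3 where a: "a = pauli_combination a1 a2 a3" using su2_pauli by blast
      \<comment> \<open>The witness doubles the coordinates to undo the halves in \<open>?P\<close>;
        having no \<open>f 0\<close> component, it lies in K.\<close>
      show "\<exists>v\<in>K_space M x p. a = residue M x Sp Ap p v"
        by (rule bexI[of _ "(2 * a1) *\<^sub>R f 1 + (2 * a2) *\<^sub>R f 2 + (2 * a3) *\<^sub>R f 3"])
          (simp_all add: a res K e_f inner_add_right)
    qed
  next
    fix v w assume "v \<in> K_space M x p" "w \<in> K_space M x p"
    then have "e 0 \<bullet> v = 0" "e 0 \<bullet> w = 0" by (simp_all add: K)
    \<comment> \<open>The factor 2 of \<open>pauli_commutator\<close> against two halves leaves one
      half of the cross product, which is the residue on the left.\<close>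
    then show "residue M x Sp Ap p (K_cross M x g p v w) =
         residue M x Sp Ap p v ** residue M x Sp Ap p w - residue M x Sp Ap p w ** residue M x Sp Ap p v"
      unfolding res pauli_commutator pauli_combination_inject cross
      by (simp add: volume_form_frame det_4 e_f field_simps)
  qed
qed

end

theorem corollary4p12:
  fixes M :: "'m::t2_space chart set"
    and x :: "'m \<Rightarrow> real"
    and g :: "'m \<Rightarrow> real^4 \<Rightarrow> real^4 \<Rightarrow> real"
    and nab :: "('m \<Rightarrow> real^4) \<Rightarrow> ('m \<Rightarrow> real^4) \<Rightarrow> 'm \<Rightarrow> real^4"
    and Sp Sm :: "('m, complex^2) vbundle"
    and c :: "'m \<Rightarrow> real^4 \<Rightarrow> (complex^2) \<times> (complex^2) \<Rightarrow> (complex^2) \<times> (complex^2)"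
    and Ap Am :: "('m \<Rightarrow> real^4) \<Rightarrow> ('m \<Rightarrow> complex^2) \<Rightarrow> 'm \<Rightarrow> complex^2"
  assumes "compact_oriented_manifold M"
    and "bdf M x"
    and "poincare_einstein M x g nab"
    and "zero_spin_structure M x g Sp Sm c"
    and "levi_civita_spin_connections M x nab Sp Sm c Ap Am"
  shows "self_dual M x g Sp Ap \<and> nahm_pole M x g Sp Ap"
proof -
  note h = assms(5)[unfolded levi_civita_spin_connections_def]
  have su2: "su2_connection M x Sp Ap" "su2_connection M x Sm Am"
    using h by simp_all
  from h[THEN conjunct2, THEN conjunct2] obtain nab' where d: "dual_connection M x nab nab'"
    and cc: "\<forall>V \<alpha> s t. zero_field M V \<and> phg_section M x (zero_cotangent_bundle M) \<alpha> \<and>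
           phg_section M x Sp s \<and> phg_section M x Sm t \<longrightarrow>
           (\<forall>p. (Ap V (\<lambda>q. fst (c q (\<alpha> q) (s q, t q))) p, Am V (\<lambda>q. snd (c q (\<alpha> q) (s q, t q))) p) =
                c p (nab' V \<alpha> p) (s p, t p) + c p (\<alpha> p) (Ap V s p, Am V t p))"
    by (elim exE conjE)
  interpret poincare_einstein_spin M x g nab Sp Sm c Ap Am nab'
  proof
    show "oriented_atlas M" using assms(1) by (simp add: compact_oriented_manifold_def)
    show "bdf M x" "zero_spin_structure M x g Sp Sm c" by (rule assms)+
    show "conformally_compact_metric M x g" "levi_civita M x g nab" "ricci M x nab p v w + 3 * g p v w = 0" for p v w
      using assms(3) by (simp_all add: poincare_einstein_def)
    show "(Ap V (\<lambda>q. fst (c q (\<alpha> q) (s q, t q))) p, Am V (\<lambda>q. snd (c q (\<alpha> q) (s q, t q))) p) =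
        c p (nab' V \<alpha> p) (s p, t p) + c p (\<alpha> p) (Ap V s p, Am V t p)"
      if "zero_field M V" "phg_section M x (zero_cotangent_bundle M) \<alpha>" "phg_section M x Sp s" "phg_section M x Sm t"
      for V \<alpha> s t p
      by (rule cc[rule_format]) (intro conjI that)
  qed (rule su2 d)+
  show ?thesis using spin_connection_self_dual spin_connection_nahm_pole by blast
qed

end
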